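(* Let $G$ be a compact Lie group with complexification $G^{\mathbb C}$, and let $$N=\{(g,\mathfrak t_1,\mathfrak t_2,\mathfrak t_3)\in G^{\mathbb C}\times\mathfrak g^{\mathbb C}\times\mathfrak g^{\mathbb C}\times\mathfrak g^{\mathbb C}\mid [\mathfrak t_i,\mathfrak t_j]=0\ \text{for all } i,j\}$$ be the set of commuting triples of $T^*G^{\mathbb C}=G^{\mathbb C}\times\mathfrak g^{\mathbb C}$. There is a one-to-one correspondence between the moduli space $\mathcal M^{\mathrm{de}}_{\mathbb O}$ of solutions to the decoupled octonionic Nahm's equations over $[0,1]$ and $N$; namely, the map $$\Theta:\mathcal M^{\mathrm{de}}_{\mathbb O}\to N,\qquad [(\alpha,\beta_1,\beta_2,\beta_3)]\mapsto(g(1),\,g\beta_1g^{-1},\,g\beta_2g^{-1},\,g\beta_3g^{-1}),$$ where $g:[0,1]\to G^{\mathbb C}$ is the unique solution of $\frac{dg}{dt}=2g\alpha$ with $g(0)=\mathrm{Id}$ (so that each $g\beta_ig^{-1}$ is constant in $t$), is a bijection.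
   Context: $\mathfrak g$ is the Lie algebra of $G$, $\mathfrak g^{\mathbb C}=\mathfrak g\oplus i\mathfrak g$, and for $X,Y\in\mathfrak g$ we set $(X+iY)^*=-X+iY$. Given $X_0,\dots,X_7:[0,1]\to\mathfrak g$ put $\alpha=\frac12(X_0+iX_1)$, $\beta_1=\frac12(X_2+iX_3)$, $\beta_2=\frac12(X_4+iX_5)$, $\beta_3=\frac12(X_6+iX_7)$ (thus $\alpha,\beta_i$ are arbitrary $\mathfrak g^{\mathbb C}$-valued functions). The decoupled octonionic Nahm's equations are $$\frac{d\beta_i}{dt}+2[\alpha,\beta_i]=0,\quad[\beta_i,\beta_j]=0\quad(i,j=1,2,3),$$ $$\frac{d}{dt}(\alpha+\alpha^* )+2\Big([\alpha,\alpha^*]+\sum_{i=1}^3[\beta_i,\beta_i^*]\Big)=0.$$ $\mathcal M^{\mathrm{de}}_{\mathbb O}$ is the set of smooth solutions on $[0,1]$ modulo the group $\mathcal G_0$ of ($C^2$) maps $u:[0,1]\to G$ with $u(0)=u(1)=1$, acting by $\alpha\mapsto u\alpha u^{-1}-\frac12\frac{du}{dt}u^{-1}$, $\beta_i\mapsto u\beta_iu^{-1}$.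
   Formalization: G is assumed connected: otherwise g(1) stays in the identity component of the complexification and Θ is not onto (e.g. G={1,-1}). Compact Lie groups are taken as compact subgroups of GL(n,C), which is every one up to isomorphism by Peter–Weyl. *)

theory Defs
  imports "HOL-Analysis.Analysis"
begin

type_synonym 'n cmat = "complex^'n^'n"

section \<open>Compact Lie groups and their complexifications\<close>

definition matrix_group :: "('n::finite) cmat set \<Rightarrow> bool" where
  "matrix_group H \<longleftrightarrow> (\<forall>A\<in>H. invertible A) \<and> mat 1 \<in> H \<and>
     (\<forall>A\<in>H. \<forall>B\<in>H. A ** B \<in> H) \<and> (\<forall>A\<in>H. matrix_inv A \<in> H)"

text \<open>A compact Lie group is a compact group with a faithful finite-dimensional representation
  (for compact groups this is the definition of Hofmann and Morris; the equivalence with the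
  definition by smooth charts is the Peter--Weyl theorem together with Cartan's closed subgroup
  theorem). It is identified with its image, a compact subgroup of some GL(n,C), not necessarily
  contained in U(n).\<close>

definition compact_lie_group :: "('n::finite) cmat set \<Rightarrow> bool" where
  "compact_lie_group G \<longleftrightarrow> matrix_group G \<and> compact G"

text \<open>The library's multiplication on \<open>complex^'n^'n\<close> is componentwise and the type is no normed
  algebra for the matrix product, so \<open>exp\<close> is not applicable and the exponential series is spelled
  out.\<close>

definition mexp :: "('n::finite) cmat \<Rightarrow> 'n cmat" where
  "mexp A = (\<Sum>k. (1 / fact k) *\<^sub>R (((**) A ^^ k) (mat 1)))"

definition lie_algebra :: "('n::finite) cmat set \<Rightarrow> 'n cmat set" where
  "lie_algebra G = {X. \<forall>t::real. mexp (t *\<^sub>R X) \<in> G}"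

definition bracket :: "('n::finite) cmat \<Rightarrow> 'n cmat \<Rightarrow> 'n cmat" where
  "bracket A B = A ** B - B ** A"

definition imult :: "('n::finite) cmat \<Rightarrow> 'n cmat" where
  "imult A = map_matrix (\<lambda>z. \<i> * z) A"

text \<open>For compact \<open>G\<close> the Lie algebra meets its multiple by \<open>\<i>\<close> only in 0, so that the following
  subspace of the matrices is the direct sum of the two, and \<open>star\<close> is well defined on it. If \<open>G\<close>
  lies in U(n), then \<open>star\<close> is the conjugate transpose.\<close>

definition complex_lie_algebra :: "('n::finite) cmat set \<Rightarrow> 'n cmat set" where
  "complex_lie_algebra G = {X + imult Y | X Y. X \<in> lie_algebra G \<and> Y \<in> lie_algebra G}"

definition star :: "('n::finite) cmat set \<Rightarrow> 'n cmat \<Rightarrow> 'n cmat" where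
  "star G Z = (THE W. \<exists>X\<in>lie_algebra G. \<exists>Y\<in>lie_algebra G. Z = X + imult Y \<and> W = - X + imult Y)"

text \<open>The complexification of a compact \<open>G\<close>: the subgroup of GL(n,C) generated by \<open>G\<close> and the
  exponentials of the complexified Lie algebra.\<close>

definition complexification :: "('n::finite) cmat set \<Rightarrow> 'n cmat set" where
  "complexification G = matrix_group hull (G \<union> mexp ` complex_lie_algebra G)"

section \<open>The decoupled octonionic Nahm's equations\<close>

text \<open>\<open>C\<^sup>k\<close> functions on the closed unit interval, with one-sided derivatives at the end
  points; \<open>D j\<close> is the \<open>j\<close>-th derivative.\<close>

definition Ck_unit :: "nat \<Rightarrow> (real \<Rightarrow> 'a::real_normed_vector) \<Rightarrow> bool" where
  "Ck_unit k f \<longleftrightarrow> (\<exists>D. (\<forall>t\<in>{0..1}. D 0 t = f t) \<and>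
     (\<forall>j<k. \<forall>t\<in>{0..1}. (D j has_vector_derivative D (Suc j) t) (at t within {0..1})) \<and>
     continuous_on {0..1} (D k))"

definition smooth_unit :: "(real \<Rightarrow> 'a::real_normed_vector) \<Rightarrow> bool" where
  "smooth_unit f \<longleftrightarrow> (\<forall>k. Ck_unit k f)"

text \<open>A configuration consists of \<open>\<alpha>\<close> and the family of the three \<open>\<beta> i\<close>, indexed by the
  three-element type \<open>3\<close>. Only its values on the unit interval are meant.\<close>

type_synonym 'n config = "(real \<Rightarrow> 'n cmat) \<times> (3 \<Rightarrow> real \<Rightarrow> 'n cmat)"

definition nahm_solutions :: "('n::finite) cmat set \<Rightarrow> 'n config set" where
  "nahm_solutions G = {(\<alpha>, \<beta>).
     (\<forall>t\<in>{0..1}. \<alpha> t \<in> complex_lie_algebra G) \<and> smooth_unit \<alpha> \<and>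
     (\<forall>i. (\<forall>t\<in>{0..1}. \<beta> i t \<in> complex_lie_algebra G) \<and> smooth_unit (\<beta> i)) \<and>
     (\<forall>i. \<forall>t\<in>{0..1}.
        vector_derivative (\<beta> i) (at t within {0..1}) + 2 *\<^sub>R bracket (\<alpha> t) (\<beta> i t) = 0) \<and>
     (\<forall>i j. \<forall>t\<in>{0..1}. bracket (\<beta> i t) (\<beta> j t) = 0) \<and>
     (\<forall>t\<in>{0..1}.
        vector_derivative (\<lambda>s. \<alpha> s + star G (\<alpha> s)) (at t within {0..1})
        + 2 *\<^sub>R (bracket (\<alpha> t) (star G (\<alpha> t))
                + (\<Sum>i\<in>UNIV. bracket (\<beta> i t) (star G (\<beta> i t)))) = 0)}"

definition based_gauge_group :: "('n::finite) cmat set \<Rightarrow> (real \<Rightarrow> 'n cmat) set" where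
  "based_gauge_group G =
     {u. (\<forall>t\<in>{0..1}. u t \<in> G) \<and> Ck_unit 2 u \<and> u 0 = mat 1 \<and> u 1 = mat 1}"

definition gauge_act :: "(real \<Rightarrow> ('n::finite) cmat) \<Rightarrow> 'n config \<Rightarrow> 'n config" where
  "gauge_act u = (\<lambda>(\<alpha>, \<beta>).
     ((\<lambda>t. u t ** \<alpha> t ** matrix_inv (u t)
           - (1/2) *\<^sub>R (vector_derivative u (at t within {0..1}) ** matrix_inv (u t))),
      (\<lambda>i t. u t ** \<beta> i t ** matrix_inv (u t))))"

definition config_eq :: "('n::finite) config \<Rightarrow> 'n config \<Rightarrow> bool" where
  "config_eq A B \<longleftrightarrow> (\<forall>t\<in>{0..1}. fst A t = fst B t \<and> (\<forall>i. snd A i t = snd B i t))"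

text \<open>A \<open>C\<^sup>2\<close> gauge transformation need not preserve smoothness, hence the restriction of
  the orbit relation to the smooth solutions.\<close>

definition gauge_rel :: "('n::finite) cmat set \<Rightarrow> ('n config \<times> 'n config) set" where
  "gauge_rel G = {(A, B). A \<in> nahm_solutions G \<and> B \<in> nahm_solutions G \<and>
     (\<exists>u\<in>based_gauge_group G. config_eq (gauge_act u A) B)}"

definition nahm_moduli :: "('n::finite) cmat set \<Rightarrow> 'n config set set" where
  "nahm_moduli G = nahm_solutions G // gauge_rel G"

definition commuting_triples :: "('n::finite) cmat set \<Rightarrow> ('n cmat \<times> (3 \<Rightarrow> 'n cmat)) set" where
  "commuting_triples G = {(g, \<tau>). g \<in> complexification G \<and>
     (\<forall>i. \<tau> i \<in> complex_lie_algebra G) \<and> (\<forall>i j. bracket (\<tau> i) (\<tau> j) = 0)}"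

definition parallel_frame ::
    "('n::finite) cmat set \<Rightarrow> (real \<Rightarrow> 'n cmat) \<Rightarrow> (real \<Rightarrow> 'n cmat) \<Rightarrow> bool" where
  "parallel_frame G \<alpha> g \<longleftrightarrow> (\<forall>t\<in>{0..1}. g t \<in> complexification G) \<and> g 0 = mat 1 \<and>
     (\<forall>t\<in>{0..1}. (g has_vector_derivative 2 *\<^sub>R (g t ** \<alpha> t)) (at t within {0..1}))"

end

theory Submission
  imports Defs
begin

text \<open>A \<open>G\<close>-invariant inner product turns \<open>G\<close> into a group of unitary matrices, so that
  \<open>star G\<close> becomes an adjoint \<open>dag\<close>, and \<open>G\<^sup>C = exp (i\<gg>) G\<close> by polar decomposition.
  A solution with frame \<open>g\<close> satisfies \<open>\<beta>\<^sub>i = g\<^sup>-\<^sup>1 \<tau>\<^sub>i g\<close>, and only the real equation remains, an equation for the path of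
  metrics \<open>g g\<^sup>*\<close> in the space of positive elements of \<open>G\<^sup>C\<close>.

  Injectivity: if two solutions have the same \<open>g 1\<close> and \<open>\<tau>\<close>, then \<open>h = g\<^sub>2\<^sup>-\<^sup>1 g\<^sub>1\<close> intertwines them
  and is 1 at both ends. Since \<open>|h|\<^sup>2\<close> and \<open>|h\<^sup>-\<^sup>1|\<^sup>2\<close> are convex in \<open>t\<close>, both are at most \<open>n\<close>, which forces
  \<open>h\<close> to be unitary, that is, a gauge transformation in \<open>G\<close>.

  Surjectivity: in the gauge with \<open>\<alpha>\<close> Hermitian the equations and the frame form an ordinary differential
  equation with quadratic right-hand side. Shooting from \<open>\<alpha> 0\<close> is injective by the first part, hence open by
  invariance of domain, and its image is closed by an a priori bound; so every positive element of \<open>G\<^sup>C\<close>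
  is reached. A gauge transformation along a smooth path in \<open>G\<close> then corrects the unitary factor of
  \<open>g 1\<close>.\<close>

section \<open>Calculus on an interval\<close>

text \<open>The complexification is given as a generated group, without a manifold structure, so
  that frames stay in it has to be shown by hand. Carrying the inverse along turns exp
  (\<open>herm\<close>) G into a closed set of pairs, and Nagumo's criterion, which asks for one
  tangent curve at each point, keeps the flow inside; even closure of exp (\<open>herm\<close>) G
  under multiplication is obtained by flowing along m exp (t Z). The boundary value problem is
  nonlinear, and a solution with given initial data may blow up before time 1. Neither a variational
  argument nor a linearization is used: convexity gives uniqueness, and for a continuous map between
  spaces of equal dimension injectivity already gives an open image. The same uniqueness, for \<tau>
  = 0, defines the logarithm that maps endpoints into the vector space \<open>herm\<close>.
  Compactness of G is used three times: for the invariant form, for Lie algebra elements as limits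
  of group elements, and to control the unitary factor in limits. Connectedness enters through the
  final gauge correction: a frame is a continuous path from 1, and every unitary factor must be
  joined to 1 inside G.\<close>

lemma nondecreasing_of_deriv:
  fixes f :: "real \<Rightarrow> real"
  assumes "\<And>t. t \<in> {a..b} \<Longrightarrow> (f has_vector_derivative f' t) (at t within {a..b})"
    and "\<And>t. t \<in> {a..b} \<Longrightarrow> 0 \<le> f' t" and "a \<le> x" "x \<le> y" "y \<le> b"
  shows "f x \<le> f y"
proof -
  have "\<exists>u\<in>{x..y}. f y - f x = (\<lambda>h. h *\<^sub>R f' u) (y - x)"
  proof (rule mvt_very_simple[OF \<open>x \<le> y\<close>])
    fix t assume "x \<le> t" "t \<le> y"
    then have "(f has_vector_derivative f' t) (at t within {x..y})"
      using assms by (intro has_vector_derivative_within_subset[OF assms(1)]) auto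
    then show "(f has_derivative (\<lambda>h. h *\<^sub>R f' t)) (at t within {x..y})"
      by (simp add: has_vector_derivative_def)
  qed
  then obtain u where u: "u \<in> {x..y}" "f y - f x = (y - x) * f' u" by auto
  have "0 \<le> f' u" using u(1) assms by auto
  then have "0 \<le> (y - x) * f' u" using assms(4) by simp
  then show ?thesis using u(2) by linarith
qed

text \<open>The derivative f' is monotone, so its sign at t persists to the right of t if it is
  nonnegative and to the left if it is negative; f t is then bounded by the value at that
  end.\<close>

lemma convex_le_endpoints:
  fixes f :: "real \<Rightarrow> real"
  assumes f: "\<And>t. t \<in> {0..1} \<Longrightarrow> (f has_vector_derivative f' t) (at t within {0..1})"
    and f': "\<And>t. t \<in> {0..1} \<Longrightarrow> (f' has_vector_derivative f'' t) (at t within {0..1})"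
    and "\<And>t. t \<in> {0..1} \<Longrightarrow> 0 \<le> f'' t" and t: "t \<in> {0..1}"
  shows "f t \<le> max (f 0) (f 1)"
proof (cases "0 \<le> f' t")
  case True
  have "f t \<le> f 1"
  proof (rule nondecreasing_of_deriv[where f=f and a=t and b=1 and f'=f'])
    fix s assume s: "s \<in> {t..1}"
    show "(f has_vector_derivative f' s) (at s within {t..1})"
      using s t by (intro has_vector_derivative_within_subset[OF f]) auto
    have "f' t \<le> f' s"
      by (rule nondecreasing_of_deriv[OF f' assms(3)]) (use s t in auto)
    then show "0 \<le> f' s" using True by simp
  qed (use t in auto)
  then show ?thesis by simp
next
  case False
  have "- f 0 \<le> - f t"
  proof (rule nondecreasing_of_deriv[where f="\<lambda>s. - f s" and a=0 and b=t and f'="\<lambda>s. - f' s"])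
    fix s assume s: "s \<in> {0..t}"
    show "((\<lambda>s. - f s) has_vector_derivative - f' s) (at s within {0..t})"
      using s t by (intro has_vector_derivative_minus has_vector_derivative_within_subset[OF f]) auto
    have "f' s \<le> f' t"
      by (rule nondecreasing_of_deriv[OF f' assms(3)]) (use s t in auto)
    then show "0 \<le> - f' s" using False by simp
  qed (use t in auto)
  then show ?thesis by simp
qed

section \<open>Gronwall's inequality and uniqueness for linear equations\<close>

text \<open>The squared norm is differentiable also where z vanishes, and by Cauchy-Schwarz |z|^2
  exp (-2 L (s - a)) has nonpositive derivative; \<open>f\<close> is its negative.\<close>

lemma gronwall:
  fixes z :: "real \<Rightarrow> 'a::real_inner"
  assumes z: "\<And>t. t \<in> {a..b} \<Longrightarrow> (z has_vector_derivative w t) (at t within {a..b})"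
    and w: "\<And>t. t \<in> {a..b} \<Longrightarrow> norm (w t) \<le> L * norm (z t)" and t: "t \<in> {a..b}"
  shows "norm (z t) \<le> norm (z a) * exp (L * (t - a))"
proof -
  define f where "f s = - ((z s \<bullet> z s) * exp (- 2 * L * (s - a)))" for s
  have "f a \<le> f t"
  proof (rule nondecreasing_of_deriv[where f=f and a=a and b=b
        and f'="\<lambda>s. (2 * L * (z s \<bullet> z s) - 2 * (z s \<bullet> w s)) * exp (- 2 * L * (s - a))"])
    fix s assume s: "s \<in> {a..b}"
    show "(f has_vector_derivative (2 * L * (z s \<bullet> z s) - 2 * (z s \<bullet> w s)) * exp (- 2 * L * (s - a)))
        (at s within {a..b})"
      unfolding f_def[abs_def] has_vector_derivative_def
      using z[OF s, unfolded has_vector_derivative_def]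
      by (auto intro!: derivative_eq_intros ext simp: algebra_simps inner_commute)
    have "z s \<bullet> w s \<le> norm (z s) * norm (w s)" by (rule norm_cauchy_schwarz)
    also have "\<dots> \<le> norm (z s) * (L * norm (z s))" by (intro mult_left_mono w s) auto
    also have "\<dots> = L * (z s \<bullet> z s)" by (simp add: dot_square_norm power2_eq_square)
    finally show "0 \<le> (2 * L * (z s \<bullet> z s) - 2 * (z s \<bullet> w s)) * exp (- 2 * L * (s - a))" by simp
  qed (use t in auto)
  then have "(norm (z t))\<^sup>2 * exp (- 2 * L * (t - a)) \<le> (norm (z a))\<^sup>2"
    by (simp add: f_def dot_square_norm)
  then have "(norm (z t))\<^sup>2 * exp (- 2 * L * (t - a)) * exp (2 * L * (t - a)) \<le> (norm (z a))\<^sup>2 * exp (2 * L * (t - a))"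
    by (intro mult_right_mono) auto
  then have "(norm (z t))\<^sup>2 \<le> (norm (z a) * exp (L * (t - a)))\<^sup>2"
    by (simp add: mult.assoc exp_add[symmetric] power_mult_distrib exp_double[symmetric])
  then show ?thesis by (rule power2_le_imp_le) simp
qed

lemma linear_ode_zero:
  fixes z :: "real \<Rightarrow> 'a::real_inner"
  assumes "\<And>t. t \<in> {a..b} \<Longrightarrow> (z has_vector_derivative w t) (at t within {a..b})"
    and "\<And>t. t \<in> {a..b} \<Longrightarrow> norm (w t) \<le> L * norm (z t)" and "z a = 0" and "t \<in> {a..b}"
  shows "z t = 0"
  using gronwall[OF assms(1,2,4)] assms(3) by simp

lemma has_vector_derivative_zero_eq:
  fixes z :: "real \<Rightarrow> 'a::real_inner"
  assumes "\<And>t. t \<in> {a..b} \<Longrightarrow> (z has_vector_derivative 0) (at t within {a..b})" "t \<in> {a..b}"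
  shows "z t = z a"
proof -
  have "z t - z a = 0"
    by (rule linear_ode_zero[where w="\<lambda>_. 0" and L=0 and a=a and b=b])
      (use assms in \<open>auto intro!: derivative_eq_intros\<close>)
  then show ?thesis by simp
qed

section \<open>Matrix algebra and the exponential\<close>

text \<open>In finite dimension bilinearity implies boundedness; the interpretation that follows
  transfers the generic rules on limits, continuity and derivatives of products to
  \<open>**\<close>.\<close>

lemma bounded_bilinear_cmat_mult: "bounded_bilinear ((**) :: 'n::finite cmat \<Rightarrow> 'n cmat \<Rightarrow> 'n cmat)"
proof -
  have "bilinear ((**) :: 'n cmat \<Rightarrow> 'n cmat \<Rightarrow> 'n cmat)"
    unfolding bilinear_def
    by (intro conjI allI linearI)
       (simp_all add: vec_eq_iff matrix_matrix_mult_def algebra_simps sum.distrib scaleR_sum_right)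
  then show ?thesis by (simp add: bilinear_conv_bounded_bilinear)
qed

interpretation mmul: bounded_bilinear "(**) :: 'n::finite cmat \<Rightarrow> 'n cmat \<Rightarrow> 'n cmat"
  by (rule bounded_bilinear_cmat_mult)

lemmas mmul_simps = mmul.add_left mmul.add_right mmul.diff_left mmul.diff_right
  mmul.minus_left mmul.minus_right mmul.scaleR_left mmul.scaleR_right matrix_mul_assoc

lemmas has_vector_derivative_mmul [derivative_intros] =
  mmul.has_vector_derivative

abbreviation mpow :: "'n::finite cmat \<Rightarrow> nat \<Rightarrow> 'n cmat" where
  "mpow A k \<equiv> ((**) A ^^ k) (mat 1)"

lemma mpow_commute: "mpow A k ** A = A ** mpow A k"
  by (induction k) (simp_all add: matrix_mul_assoc[symmetric])

lemma mpow_scaleR: "mpow (t *\<^sub>R A) k = t ^ k *\<^sub>R mpow A k"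
  by (induction k) (simp_all add: mmul_simps mult.commute)

lemma mmul_norm_bound: "\<exists>K\<ge>1. \<forall>(A::'n::finite cmat) (B::'n cmat). norm (A ** B) \<le> K * norm A * norm B"
proof -
  obtain K where K: "K > 0" "\<And>(A::'n cmat) (B::'n cmat). norm (A ** B) \<le> norm A * norm B * K"
    using mmul.pos_bounded by blast
  have "norm (A ** B) \<le> max 1 K * norm A * norm B" for A B :: "'n cmat"
    using K(2)[of A B] mult_right_mono[of K "max 1 K" "norm A * norm B"] by (simp add: mult_ac)
  then show ?thesis by (intro exI[of _ "max 1 K"]) auto
qed

section \<open>Convergence and differentiation of the exponential series\<close>

lemma norm_mpow_le:
  fixes A :: "'n::finite cmat"
  assumes "\<forall>(A::'n::finite cmat) (B::'n cmat). norm (A ** B) \<le> K * norm A * norm B" "0 \<le> K"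
  shows "norm (mpow A k) \<le> (K * norm A) ^ k * norm (mat 1 :: 'n cmat)"
proof (induction k)
  case (Suc k)
  have "norm (mpow A (Suc k)) \<le> K * norm A * norm (mpow A k)" using assms(1) by (simp only: funpow.simps o_apply)
  also have "\<dots> \<le> K * norm A * ((K * norm A) ^ k * norm (mat 1 :: 'n cmat))"
    by (intro mult_left_mono Suc) (use assms(2) in auto)
  finally show ?case by (simp add: mult_ac)
qed simp

lemma summable_mexp: "summable (\<lambda>k. norm ((1 / fact k) *\<^sub>R mpow (A :: 'n::finite cmat) k))"
proof -
  obtain K where K: "K \<ge> 1" "\<forall>(A::'n cmat) (B::'n cmat). norm (A ** B) \<le> K * norm A * norm B"
    using mmul_norm_bound by blast
  show ?thesis
  proof (rule summable_comparison_test'[where N=0])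
    show "summable (\<lambda>k. (inverse (fact k) * (K * norm A) ^ k) * norm (mat 1 :: 'n cmat))"
      by (intro summable_mult2 summable_exp)
    show "norm (norm ((1 / fact k) *\<^sub>R mpow A k)) \<le> (inverse (fact k) * (K * norm A) ^ k) * norm (mat 1 :: 'n cmat)" for k :: nat
      using norm_mpow_le[where K=K and A=A and k=k] K by (simp add: divide_simps)
  qed
qed

lemma mexp_sums: "(\<lambda>k. (1 / fact k) *\<^sub>R mpow A k) sums mexp A"
  unfolding mexp_def by (rule summable_sums[OF summable_norm_cancel[OF summable_mexp]])

lemma mexp_zero [simp]: "mexp (0 :: 'n::finite cmat) = mat 1"
proof -
  have "mpow (0::'n cmat) k = (if k = 0 then mat 1 else 0)" for k
    by (cases k) (auto simp: mmul.zero_left)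
  then have "(\<lambda>k. (1 / fact k) *\<^sub>R mpow (0::'n cmat) k) = (\<lambda>k. if k = 0 then mat 1 else 0)"
    by (auto simp: fun_eq_iff)
  then show ?thesis using mexp_sums[of "0::'n cmat"] sums_single[of 0 "\<lambda>_. mat 1 :: 'n cmat"] by (simp add: sums_iff)
qed

text \<open>Each entry of exp (t A) is an everywhere convergent complex power series restricted to
  real t, so it may be differentiated termwise; the entries are then put together over the standard
  basis.\<close>

lemma mexp_has_vector_derivative_left:
  fixes A :: "'n::finite cmat"
  shows "((\<lambda>t. mexp (t *\<^sub>R A)) has_vector_derivative A ** mexp (t *\<^sub>R A)) (at t within S)"
proof -
  have comp: "((\<lambda>t. mexp (t *\<^sub>R A) $ i $ j) has_vector_derivative (A ** mexp (t *\<^sub>R A)) $ i $ j) (at t within S)" for i j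
  proof -
    define c where "c k = (1 / fact k) *\<^sub>R (mpow A k $ i $ j)" for k
    have lin: "bounded_linear (\<lambda>B::'n cmat. B $ i $ j)"
      by (rule bounded_linear_compose[OF bounded_linear_vec_nth bounded_linear_vec_nth])
    have summand: "((1 / fact k) *\<^sub>R mpow (t *\<^sub>R A) k) $ i $ j = c k * of_real t ^ k" for t k
    proof -
      have "((1 / fact k) *\<^sub>R mpow (t *\<^sub>R A) k) $ i $ j = (1 / fact k) *\<^sub>R t ^ k *\<^sub>R (mpow A k $ i $ j)"
        by (simp only: mpow_scaleR vector_scaleR_component)
      then show ?thesis by (simp add: c_def scaleR_conv_of_real)
    qed
    have s0: "(\<lambda>k. c k * of_real t ^ k) sums (mexp (t *\<^sub>R A) $ i $ j)" for t
      using bounded_linear.sums[OF lin mexp_sums[of "t *\<^sub>R A"]]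
      by (simp only: summand)
    \<comment> \<open>The entry series at complex z is dominated by the matrix series at the real
      argument |z|.\<close>
    have sm: "summable (\<lambda>k. c k * z ^ k)" for z
    proof (rule summable_norm_cancel)
      have "summable (\<lambda>k. norm ((1 / fact k) *\<^sub>R mpow (norm z *\<^sub>R A) k))" by (rule summable_mexp)
      then show "summable (\<lambda>k. norm (c k * z ^ k))"
      proof (rule summable_comparison_test'[where N=0])
        fix k
        have "norm (mpow A k $ i $ j) \<le> norm (mpow A k)"
          by (rule order_trans[OF Finite_Cartesian_Product.norm_nth_le[of "mpow A k $ i" j] Finite_Cartesian_Product.norm_nth_le[of "mpow A k" i]])
        then show "norm (norm (c k * z ^ k)) \<le> norm ((1 / fact k) *\<^sub>R mpow (norm z *\<^sub>R A) k)"
          by (simp add: c_def mpow_scaleR norm_mult norm_power mult_right_mono divide_right_mono mult.commute[of "norm z ^ k"])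
      qed
    qed
    have d: "((\<lambda>z. \<Sum>k. c k * z ^ k) has_field_derivative (\<Sum>k. diffs c k * z ^ k)) (at z)" for z
      by (rule termdiffs_strong_converges_everywhere[OF sm])
    have "((\<lambda>z. \<Sum>k. c k * z ^ k) \<circ> of_real has_vector_derivative 1 * (\<Sum>k. diffs c k * of_real t ^ k)) (at t within S)"
      by (rule field_vector_diff_chain_within[OF _ has_field_derivative_at_within[OF d]])
        (use bounded_linear.has_vector_derivative[OF bounded_linear_of_real has_vector_derivative_id] in simp)
    moreover have "((\<lambda>z. \<Sum>k. c k * z ^ k) \<circ> of_real) = (\<lambda>t. mexp (t *\<^sub>R A) $ i $ j)"
      using s0 by (auto simp: o_def sums_iff)
    moreover have "(\<lambda>k. diffs c k * of_real t ^ k) sums (A ** mexp (t *\<^sub>R A)) $ i $ j"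
    proof -
      have "(\<lambda>k. (A ** ((1 / fact k) *\<^sub>R mpow (t *\<^sub>R A) k)) $ i $ j) sums (A ** mexp (t *\<^sub>R A)) $ i $ j"
        by (intro bounded_linear.sums[OF lin] bounded_linear.sums[OF mmul.bounded_linear_right] mexp_sums)
      moreover have "(A ** ((1 / fact k) *\<^sub>R mpow (t *\<^sub>R A) k)) $ i $ j = diffs c k * of_real t ^ k" for k
      proof -
        have "A ** ((1 / fact k) *\<^sub>R mpow (t *\<^sub>R A) k) = (1 / fact k) *\<^sub>R t ^ k *\<^sub>R mpow A (Suc k)"
          by (simp add: mpow_scaleR mmul.scaleR_right)
        then have "(A ** ((1 / fact k) *\<^sub>R mpow (t *\<^sub>R A) k)) $ i $ j = (1 / fact k) *\<^sub>R t ^ k *\<^sub>R (mpow A (Suc k) $ i $ j)"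
          by (simp only: vector_scaleR_component)
        moreover have "of_nat (Suc k) * c (Suc k) = (1 / fact k) *\<^sub>R (mpow A (Suc k) $ i $ j)"
          by (simp add: c_def scaleR_conv_of_real divide_simps del: funpow.simps of_nat_Suc)
        ultimately show ?thesis by (simp add: diffs_def scaleR_conv_of_real del: funpow.simps)
      qed
      ultimately show ?thesis by simp
    qed
    ultimately show ?thesis by (simp add: sums_iff)
  qed
  have "((\<lambda>t. mexp (t *\<^sub>R A)) has_derivative (\<lambda>h. h *\<^sub>R (A ** mexp (t *\<^sub>R A)))) (at t within S)"
    unfolding has_derivative_componentwise_within[of "\<lambda>t. mexp (t *\<^sub>R A)"]
  proof
    fix b :: "'n cmat" assume "b \<in> Basis"
    then obtain i j b' where b: "b = axis i (axis j b')" "b' \<in> Basis"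
      by (auto simp: Basis_vec_def)
    show "((\<lambda>x. mexp (x *\<^sub>R A) \<bullet> b) has_derivative (\<lambda>x. x *\<^sub>R (A ** mexp (t *\<^sub>R A)) \<bullet> b)) (at t within S)"
      using has_derivative_inner_left[OF comp[of i j, unfolded has_vector_derivative_def], of b']
      by (simp add: b inner_axis)
  qed
  then show ?thesis by (simp add: has_vector_derivative_def)
qed

lemma norm_diff_le_deriv_bound:
  fixes z :: "real \<Rightarrow> 'a::real_inner"
  assumes z: "\<And>t. t \<in> {a..b} \<Longrightarrow> (z has_vector_derivative w t) (at t within {a..b})"
    and w: "\<And>t. t \<in> {a..b} \<Longrightarrow> norm (w t) \<le> C" and t: "t \<in> {a..b}"
  shows "norm (z t - z a) \<le> C * (t - a)"
proof -
  have "norm (z t - z a) \<le> C * norm (t - a)"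
  proof (rule differentiable_bound[where S="{a..b}" and f'="\<lambda>t h. h *\<^sub>R w t"])
    show "(z has_derivative (\<lambda>h. h *\<^sub>R w t)) (at t within {a..b})" if "t \<in> {a..b}" for t
      using z[OF that] by (simp add: has_vector_derivative_def)
    show "onorm (\<lambda>h. h *\<^sub>R w t) \<le> C" if "t \<in> {a..b}" for t
      using w[OF that] by (intro onorm_le) (simp add: mult_left_mono mult.commute[of C])
  qed (use t in auto)
  then show ?thesis using t by simp
qed

lemma has_vector_derivative_of_quadratic_bound:
  fixes f :: "real \<Rightarrow> 'a::real_normed_vector"
  assumes "\<And>h. \<bar>h\<bar> \<le> 1 \<Longrightarrow> norm (f h - f 0 - h *\<^sub>R v) \<le> C * h\<^sup>2"
  shows "(f has_vector_derivative v) (at 0)"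
  unfolding has_vector_derivative_def has_derivative_at_alt
proof (intro conjI allI impI)
  show "bounded_linear (\<lambda>x. x *\<^sub>R v)" by (rule bounded_linear_scaleR_left)
  fix e :: real assume e: "0 < e"
  define d where "d = min 1 (e / (\<bar>C\<bar> + 1))"
  have d: "d > 0" "d \<le> 1" using e by (auto simp: d_def)
  have "norm (f y - f 0 - (y - 0) *\<^sub>R v) \<le> e * norm (y - 0)" if y: "norm (y - 0) < d" for y
  proof -
    have "\<bar>y\<bar> \<le> e / (\<bar>C\<bar> + 1)" using y by (simp add: d_def)
    then have "(\<bar>C\<bar> + 1) * \<bar>y\<bar> \<le> e" by (simp add: field_simps)
    then have "(\<bar>C\<bar> + 1) * \<bar>y\<bar> * \<bar>y\<bar> \<le> e * \<bar>y\<bar>" by (rule mult_right_mono) simp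
    moreover have "C * y\<^sup>2 \<le> (\<bar>C\<bar> + 1) * \<bar>y\<bar> * \<bar>y\<bar>"
      using mult_right_mono[of C "\<bar>C\<bar> + 1" "y\<^sup>2"] by (simp add: power2_eq_square mult.assoc abs_mult_self_eq)
    moreover have "norm (f y - f 0 - y *\<^sub>R v) \<le> C * y\<^sup>2" using y d by (intro assms) auto
    ultimately show ?thesis by simp
  qed
  then show "\<exists>d>0. \<forall>y. norm (y - 0) < d \<longrightarrow> norm (f y - f 0 - (y - 0) *\<^sub>R v) \<le> e * norm (y - 0)"
    using d(1) by blast
qed

lemmas has_vector_derivative_mmul_const =
  bounded_linear.has_vector_derivative[OF mmul.bounded_linear_left]
  bounded_linear.has_vector_derivative[OF mmul.bounded_linear_right]

section \<open>Exponential laws from uniqueness of solutions\<close>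

lemma linear_matrix_ode_unique:
  fixes A :: "'n::finite cmat" and y z :: "real \<Rightarrow> 'n cmat"
  assumes y: "\<And>t. t \<in> {0..b} \<Longrightarrow> (y has_vector_derivative A ** y t) (at t within {0..b})"
    and z: "\<And>t. t \<in> {0..b} \<Longrightarrow> (z has_vector_derivative A ** z t) (at t within {0..b})"
    and "y 0 = z 0" "t \<in> {0..b}"
  shows "y t = z t"
proof -
  obtain K where K: "K \<ge> 1" "\<forall>(A::'n cmat) (B::'n cmat). norm (A ** B) \<le> K * norm A * norm B"
    using mmul_norm_bound by blast
  have "y t - z t = 0"
  proof (rule linear_ode_zero[where a=0 and b=b and w="\<lambda>t. A ** (y t - z t)" and L="K * norm A" and z="\<lambda>t. y t - z t"])
    show "((\<lambda>t. y t - z t) has_vector_derivative A ** (y t - z t)) (at t within {0..b})" if "t \<in> {0..b}" for t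
      using has_vector_derivative_diff[OF y[OF that] z[OF that]] by (simp add: mmul_simps)
    show "norm (A ** (y t - z t)) \<le> K * norm A * norm (y t - z t)" for t using K(2) by blast
  qed (use assms in auto)
  then show ?thesis by simp
qed

text \<open>The tool for all identities between exponentials: both sides are shown to solve the same
  linear equation, and no product of series is formed.\<close>

lemma mexp_ode_unique:
  fixes A :: "'n::finite cmat" and y :: "real \<Rightarrow> 'n cmat"
  assumes "\<And>t. t \<in> {0..b} \<Longrightarrow> (y has_vector_derivative A ** y t) (at t within {0..b})" "t \<in> {0..b}"
  shows "y t = mexp (t *\<^sub>R A) ** y 0"
proof (rule linear_matrix_ode_unique[OF assms(1) _ _ assms(2)])
  show "((\<lambda>t. mexp (t *\<^sub>R A) ** y 0) has_vector_derivative A ** (mexp (t *\<^sub>R A) ** y 0)) (at t within {0..b})" for t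
    by (rule derivative_eq_intros mexp_has_vector_derivative_left refl)+ (simp add: mmul_simps mmul.zero_right)
qed auto

text \<open>For t >= 0 the curve A exp (t A) solves y' = A y with y 0 = A, as does exp (t A) A.
  Negative t are reduced to this by replacing A with -A.\<close>

lemma mexp_commute:
  fixes A :: "'n::finite cmat"
  shows "mexp (t *\<^sub>R A) ** A = A ** mexp (t *\<^sub>R A)"
proof -
  have *: "mexp (t *\<^sub>R A) ** A = A ** mexp (t *\<^sub>R A)" if "t \<ge> 0" for t and A :: "'n cmat"
  proof -
    have "A ** mexp (t *\<^sub>R A) = mexp (t *\<^sub>R A) ** (A ** mexp (0 *\<^sub>R A))"
      by (rule mexp_ode_unique[where b=t and y="\<lambda>t. A ** mexp (t *\<^sub>R A)"])
         (use that in \<open>auto intro!: derivative_eq_intros mexp_has_vector_derivative_left simp: mmul_simps mmul.zero_left\<close>)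
    then show ?thesis by simp
  qed
  show ?thesis
    using *[of t A] *[of "- t" "- A"] by (cases "t \<ge> 0") (auto simp: mmul_simps)
qed

lemma mexp_has_vector_derivative_right:
  fixes A :: "'n::finite cmat"
  shows "((\<lambda>t. mexp (t *\<^sub>R A)) has_vector_derivative mexp (t *\<^sub>R A) ** A) (at t within S)"
  using mexp_has_vector_derivative_left by (simp add: mexp_commute)

lemma mexp_neg_has_vector_derivative_right:
  fixes A :: "'n::finite cmat"
  shows "((\<lambda>t. mexp (- (t *\<^sub>R A))) has_vector_derivative - (mexp (- (t *\<^sub>R A)) ** A)) (at t within S)"
  using mexp_has_vector_derivative_right[of "- A" t S] by (simp add: mmul_simps)

lemma mexp_minus_right [simp]:
  fixes A :: "'n::finite cmat"
  shows "mexp A ** mexp (- A) = mat 1"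
proof -
  have "mexp (1 *\<^sub>R A) ** mexp (1 *\<^sub>R (- A)) = mexp (0 *\<^sub>R A) ** mexp (0 *\<^sub>R (- A))"
    by (rule has_vector_derivative_zero_eq[where a=0 and b=1 and z="\<lambda>s. mexp (s *\<^sub>R A) ** mexp (s *\<^sub>R (- A))"])
      (auto intro!: derivative_eq_intros mexp_has_vector_derivative_left mexp_has_vector_derivative_right
         mexp_neg_has_vector_derivative_right simp: mmul_simps mexp_commute[of _ "- A", simplified mmul_simps, simplified])
  then show ?thesis by simp
qed

lemma mexp_minus_left [simp]:
  fixes A :: "'n::finite cmat"
  shows "mexp (- A) ** mexp A = mat 1"
  using mexp_minus_right[of "- A"] by simp

lemma mexp_cancel [simp]:
  fixes A :: "'n::finite cmat"
  shows "B ** mexp A ** mexp (- A) = B" "B ** mexp (- A) ** mexp A = B"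
  by (simp_all add: matrix_mul_assoc[symmetric])

lemma invertible_mexp [simp]: "invertible (mexp (A :: 'n::finite cmat))"
  unfolding invertible_def using mexp_minus_left mexp_minus_right by blast

lemma mexp_add_scaleR:
  fixes A :: "'n::finite cmat"
  shows "mexp ((s + t) *\<^sub>R A) = mexp (s *\<^sub>R A) ** mexp (t *\<^sub>R A)"
proof -
  have *: "mexp ((s + t) *\<^sub>R A) = mexp (s *\<^sub>R A) ** mexp (t *\<^sub>R A)" if "s \<ge> 0" for s t
  proof -
    have "mexp ((s + t) *\<^sub>R A) = mexp (s *\<^sub>R A) ** mexp ((0 + t) *\<^sub>R A)"
    proof (rule mexp_ode_unique[where b=s and y="\<lambda>s. mexp ((s + t) *\<^sub>R A)"])
      fix u
      have "((\<lambda>s. mexp (s *\<^sub>R A)) \<circ> (\<lambda>s. s + t) has_vector_derivative 1 *\<^sub>R (A ** mexp ((u + t) *\<^sub>R A))) (at u within {0..s})"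
        by (rule vector_diff_chain_within[OF _ mexp_has_vector_derivative_left]) (auto intro!: derivative_eq_intros)
      then show "((\<lambda>s. mexp ((s + t) *\<^sub>R A)) has_vector_derivative A ** mexp ((u + t) *\<^sub>R A)) (at u within {0..s})"
        by (simp add: o_def)
    qed (use that in auto)
    then show ?thesis by simp
  qed
  show ?thesis
  proof (cases "s \<ge> 0")
    case False
    then have "mexp (t *\<^sub>R A) = mexp (- (s *\<^sub>R A)) ** mexp ((s + t) *\<^sub>R A)" using *[of "- s" "s + t"] by simp
    then show ?thesis by (simp add: matrix_mul_assoc)
  qed (rule *)
qed

lemma mexp_conj:
  fixes A P Q :: "'n::finite cmat"
  assumes "Q ** P = mat 1" "P ** Q = mat 1"
  shows "mexp (P ** A ** Q) = P ** mexp A ** Q"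
proof -
  have QP: "X ** Q ** P = X" for X :: "'n cmat" by (metis assms(1) matrix_mul_assoc matrix_mul_rid)
  have "((\<lambda>s. P ** mexp (s *\<^sub>R A) ** Q) has_vector_derivative (P ** A ** Q) ** (P ** mexp (t *\<^sub>R A) ** Q)) (at t within {0..1})" for t
    using has_vector_derivative_mmul_const(1)[OF has_vector_derivative_mmul_const(2)[OF mexp_has_vector_derivative_left[of A t "{0..1}"]], of P Q]
    by (simp add: matrix_mul_assoc QP)
  then have "P ** mexp (1 *\<^sub>R A) ** Q = mexp (1 *\<^sub>R (P ** A ** Q)) ** (P ** mexp (0 *\<^sub>R A) ** Q)"
    by (intro mexp_ode_unique[where b=1 and y="\<lambda>s. P ** mexp (s *\<^sub>R A) ** Q"]) auto
  then show ?thesis by (simp add: assms)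
qed

section \<open>Lipschitz and Taylor estimates for the exponential\<close>

lemma norm_mexp_le:
  "\<exists>K\<ge>1. \<forall>A :: 'n::finite cmat. norm (mexp A) \<le> norm (mat 1 :: 'n cmat) * exp (K * norm A)"
proof -
  obtain K where K: "K \<ge> 1" "\<forall>(A::'n cmat) (B::'n cmat). norm (A ** B) \<le> K * norm A * norm B"
    using mmul_norm_bound by blast
  have "norm (mexp A) \<le> norm (mat 1 :: 'n cmat) * exp (K * norm A)" for A :: "'n cmat"
    using gronwall[where a=0 and b=1 and t=1 and L="K * norm A", OF mexp_has_vector_derivative_left[of A]] K(2) by simp
  then show ?thesis using K(1) by blast
qed

text \<open>Duhamel's argument: exp (-s A) exp (s B) has derivative exp (-s A) (B - A) exp (s B), so
  at s = 1 it differs from 1 by O(|B - A|); multiplying by exp A from the left gives the difference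
  of the exponentials.\<close>

lemma mexp_lipschitz:
  "\<exists>C. \<forall>(A :: 'n::finite cmat) B. norm A \<le> R \<longrightarrow> norm B \<le> R \<longrightarrow> norm (mexp B - mexp A) \<le> C * norm (B - A)"
proof -
  obtain K where K: "K \<ge> 1" "\<And>(A::'n cmat) (B::'n cmat). norm (A ** B) \<le> K * norm A * norm B"
    using mmul_norm_bound by blast
  obtain L where L: "L \<ge> 1" "\<And>A :: 'n cmat. norm (mexp A) \<le> norm (mat 1 :: 'n cmat) * exp (L * norm A)"
    using norm_mexp_le by blast
  define M where "M = norm (mat 1 :: 'n cmat) * exp (L * R)"
  have M: "norm (mexp A) \<le> M" if "norm A \<le> R" for A :: "'n cmat"
    using L(2)[of A] that L(1) unfolding M_def by (meson exp_le_cancel_iff mult_left_mono norm_ge_zero order_trans zero_le_one)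
  have "norm (mexp B - mexp A) \<le> K * M * (K * (K * M) * M) * norm (B - A)" if A: "norm A \<le> R" and B: "norm B \<le> R" for A B :: "'n cmat"
  proof -
    have R: "R \<ge> 0" using norm_ge_zero A by (rule order_trans)
    have M0: "M \<ge> 0" by (simp add: M_def)
    define z where "z s = mexp (s *\<^sub>R (- A)) ** mexp (s *\<^sub>R B)" for s
    have "norm (z 1 - z 0) \<le> (K * (K * M) * M * norm (B - A)) * (1 - 0)"
    proof (rule norm_diff_le_deriv_bound[where z=z and a=0 and b=1 and w="\<lambda>s. mexp (s *\<^sub>R (- A)) ** (B - A) ** mexp (s *\<^sub>R B)"])
      fix s :: real assume s: "s \<in> {0..1}"
      show "(z has_vector_derivative mexp (s *\<^sub>R (- A)) ** (B - A) ** mexp (s *\<^sub>R B)) (at s within {0..1})"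
        unfolding z_def[abs_def]
        by (auto intro!: derivative_eq_intros mexp_has_vector_derivative_left mexp_neg_has_vector_derivative_right simp: mmul_simps)
      have "norm (s *\<^sub>R (- A)) \<le> R" "norm (s *\<^sub>R B) \<le> R"
        using s A B mult_mono[of s 1 "norm A" R] mult_mono[of s 1 "norm B" R] by auto
      note m = this[THEN M]
      have "norm (mexp (s *\<^sub>R (- A)) ** (B - A) ** mexp (s *\<^sub>R B)) \<le> K * (K * norm (mexp (s *\<^sub>R (- A))) * norm (B - A)) * norm (mexp (s *\<^sub>R B))"
        by (rule order_trans[OF K(2)]) (intro mult_right_mono mult_left_mono K(2), use K(1) in auto)
      also have "\<dots> \<le> K * (K * M * norm (B - A)) * M"
        using K(1) M0 m by (intro mult_mono mult_nonneg_nonneg) auto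
      finally show "norm (mexp (s *\<^sub>R (- A)) ** (B - A) ** mexp (s *\<^sub>R B)) \<le> K * (K * M) * M * norm (B - A)"
        by (simp add: mult_ac)
    qed auto
    then have z: "norm (z 1 - mat 1) \<le> K * (K * M) * M * norm (B - A)" by (simp add: z_def)
    have "mexp B - mexp A = mexp A ** (z 1 - mat 1)" by (simp add: z_def mmul_simps)
    then have "norm (mexp B - mexp A) \<le> K * norm (mexp A) * norm (z 1 - mat 1)" using K(2) by simp
    also have "\<dots> \<le> K * M * (K * (K * M) * M * norm (B - A))"
      using K(1) M0 M[OF A] z by (intro mult_mono) auto
    finally show ?thesis by (simp add: mult_ac)
  qed
  then show ?thesis by blast
qed

lemma continuous_on_mexp: "continuous_on S (mexp :: 'n::finite cmat \<Rightarrow> 'n cmat)"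
proof -
  have "isCont mexp A" for A :: "'n cmat"
  proof -
    obtain C where C: "\<And>B :: 'n cmat. norm B \<le> norm A + 1 \<Longrightarrow> norm (mexp B - mexp A) \<le> C * norm (B - A)"
      using mexp_lipschitz[of "norm A + 1"] by force
    have "(mexp \<longlongrightarrow> mexp A) (at A)"
    proof (rule Lim_transform_bound[where f="\<lambda>B. mexp B - mexp A" and g="\<lambda>B. C * norm (B - A)", THEN Lim_null[THEN iffD2]])
      have "eventually (\<lambda>B. dist B A < 1) (at A)" by (auto simp: eventually_at intro: exI[of _ 1])
      then show "eventually (\<lambda>B. norm (mexp B - mexp A) \<le> norm (C * norm (B - A))) (at A)"
      proof eventually_elim
        case (elim B)
        have "norm B \<le> norm A + 1" using elim norm_triangle_ineq2[of B A] by (simp add: dist_norm)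
        from C[OF this] show ?case by simp
      qed
      show "((\<lambda>B. C * norm (B - A)) \<longlongrightarrow> 0) (at A)" by (auto intro!: tendsto_eq_intros)
    qed
    then show ?thesis by (simp add: isCont_def)
  qed
  then show ?thesis by (simp add: continuous_at_imp_continuous_on)
qed

lemmas continuous_on_mexp_compose [continuous_intros] = continuous_on_compose2[OF continuous_on_mexp _ subset_UNIV]
lemmas continuous_on_mmul [continuous_intros] = mmul.continuous_on

text \<open>The remainder exp (s X) - 1 - s X has derivative X (exp (s X) - 1), which the Lipschitz
  estimate bounds by a multiple of |X|^2.\<close>

lemma mexp_taylor:
  "\<exists>C. \<forall>X :: 'n::finite cmat. norm X \<le> 1 \<longrightarrow> norm (mexp X - mat 1 - X) \<le> C * (norm X)\<^sup>2"
proof -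
  obtain K where K: "K \<ge> 1" "\<And>(A::'n cmat) (B::'n cmat). norm (A ** B) \<le> K * norm A * norm B"
    using mmul_norm_bound by blast
  obtain C where C: "\<And>B :: 'n cmat. norm B \<le> 1 \<Longrightarrow> norm (mexp B - mat 1) \<le> C * norm B"
    using mexp_lipschitz[of 1, where 'n='n] by (force dest: spec[of _ 0])
  have "norm (mexp X - mat 1 - X) \<le> (K * \<bar>C\<bar>) * (norm X)\<^sup>2" if X: "norm X \<le> 1" for X :: "'n cmat"
  proof -
    have "norm ((mexp (1 *\<^sub>R X) - mat 1 - 1 *\<^sub>R X) - (mexp (0 *\<^sub>R X) - mat 1 - 0 *\<^sub>R X)) \<le> (K * \<bar>C\<bar>) * (norm X)\<^sup>2 * (1 - 0)"
    proof (rule norm_diff_le_deriv_bound[where z="\<lambda>s. mexp (s *\<^sub>R X) - mat 1 - s *\<^sub>R X" and a=0 and b=1 and w="\<lambda>s. X ** (mexp (s *\<^sub>R X) - mat 1)"])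
      fix s :: real assume s: "s \<in> {0..1}"
      show "((\<lambda>s. mexp (s *\<^sub>R X) - mat 1 - s *\<^sub>R X) has_vector_derivative X ** (mexp (s *\<^sub>R X) - mat 1)) (at s within {0..1})"
        by (auto intro!: derivative_eq_intros mexp_has_vector_derivative_left simp: mmul_simps)
      have sX: "norm (s *\<^sub>R X) \<le> norm X" using s by (simp add: mult_left_le_one_le)
      have "norm (mexp (s *\<^sub>R X) - mat 1) \<le> C * norm (s *\<^sub>R X)" by (rule C) (use sX X in linarith)
      also have "\<dots> \<le> \<bar>C\<bar> * norm (s *\<^sub>R X)" by (rule mult_right_mono) auto
      also have "\<dots> \<le> \<bar>C\<bar> * norm X" by (rule mult_left_mono[OF sX]) simp
      finally have "norm (X ** (mexp (s *\<^sub>R X) - mat 1)) \<le> K * norm X * (\<bar>C\<bar> * norm X)"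
        using K by (meson mult_left_mono mult_nonneg_nonneg norm_ge_zero order_trans zero_le_one)
      then show "norm (X ** (mexp (s *\<^sub>R X) - mat 1)) \<le> (K * \<bar>C\<bar>) * (norm X)\<^sup>2"
        by (simp add: power2_eq_square mult_ac)
    qed auto
    then show ?thesis by simp
  qed
  then show ?thesis by blast
qed

section \<open>The differential of the exponential\<close>

text \<open>At t = 1 this is the left-trivialized differential of the exponential at A, that is (1 -
  exp (- ad A)) / ad A applied to B. With the upper limit t left free it is a curve whose velocity
  is a conjugate of B.\<close>

definition dexp :: "'n::finite cmat \<Rightarrow> 'n cmat \<Rightarrow> real \<Rightarrow> 'n cmat" where
  "dexp A B t = integral {0..t} (\<lambda>s. mexp (- (s *\<^sub>R A)) ** B ** mexp (s *\<^sub>R A))"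

lemma dexp_has_vector_derivative:
  fixes A :: "'n::finite cmat"
  assumes "t \<in> {0..1}"
  shows "(dexp A B has_vector_derivative mexp (- (t *\<^sub>R A)) ** B ** mexp (t *\<^sub>R A)) (at t within {0..1})"
  unfolding dexp_def[abs_def]
  by (rule integral_has_vector_derivative) (use assms in \<open>auto intro!: continuous_intros\<close>)

lemma dexp_0 [simp]: "dexp A B 0 = 0" by (simp add: dexp_def)

lemma dexp_integrable:
  "(\<lambda>s. mexp (- (s *\<^sub>R A)) ** B ** mexp (s *\<^sub>R (A::'n::finite cmat))) integrable_on {0..t}"
  by (rule integrable_continuous_interval) (intro continuous_intros)

lemma linear_dexp: "linear (\<lambda>B. dexp (A::'n::finite cmat) B t)"
proof (rule linearI)
  show "dexp A (B + C) t = dexp A B t + dexp A C t" for B C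
    unfolding dexp_def by (simp add: mmul_simps integral_add dexp_integrable)
  show "dexp A (c *\<^sub>R B) t = c *\<^sub>R dexp A B t" for c B
    unfolding dexp_def by (simp add: mmul_simps integral_cmul dexp_integrable)
qed

text \<open>Here \<open>z h s\<close> is exp (-s A) exp (s (A + h B)) minus its expected first order
  term. Its derivative in s carries a factor h and the difference of two exponentials at distance
  O(h), so the error at s = 1 is O(h^2).\<close>

lemma mexp_line_has_vector_derivative:
  fixes A :: "'n::finite cmat"
  shows "((\<lambda>h. mexp (A + h *\<^sub>R B)) has_vector_derivative mexp A ** dexp A B 1) (at 0)"
proof -
  obtain K where K: "K \<ge> 1" "\<And>(A::'n cmat) (B::'n cmat). norm (A ** B) \<le> K * norm A * norm B"
    using mmul_norm_bound by blast
  define R where "R = norm A + norm B"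
  obtain L where L: "\<And>(A :: 'n cmat) B. norm A \<le> R \<Longrightarrow> norm B \<le> R \<Longrightarrow> norm (mexp B - mexp A) \<le> L * norm (B - A)"
    using mexp_lipschitz[of R] by blast
  have "bounded ((\<lambda>s. mexp (- (s *\<^sub>R A)) ** B) ` {0..1::real})"
    by (intro compact_imp_bounded compact_continuous_image) (auto intro!: continuous_intros)
  then obtain M where M: "\<And>s. s \<in> {0..1::real} \<Longrightarrow> norm (mexp (- (s *\<^sub>R A)) ** B) \<le> M"
    unfolding bounded_iff by blast
  have M0: "M \<ge> 0" using order_trans[OF norm_ge_zero M[of 0]] by simp
  define z where "z h s = mexp (- (s *\<^sub>R A)) ** mexp (s *\<^sub>R (A + h *\<^sub>R B)) - h *\<^sub>R dexp A B s" for h s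
  have z: "norm (z h 1 - z h 0) \<le> (K * M * (\<bar>L\<bar> * norm B)) * h\<^sup>2 * (1 - 0)" if h: "\<bar>h\<bar> \<le> 1" for h
  proof (rule norm_diff_le_deriv_bound[where z="z h" and a=0 and b=1
        and w="\<lambda>s. h *\<^sub>R ((mexp (- (s *\<^sub>R A)) ** B) ** (mexp (s *\<^sub>R (A + h *\<^sub>R B)) - mexp (s *\<^sub>R A)))"])
    fix s :: real assume s: "s \<in> {0..1}"
    show "(z h has_vector_derivative h *\<^sub>R ((mexp (- (s *\<^sub>R A)) ** B) ** (mexp (s *\<^sub>R (A + h *\<^sub>R B)) - mexp (s *\<^sub>R A)))) (at s within {0..1})"
      unfolding z_def[abs_def]
      by (rule derivative_eq_intros mexp_has_vector_derivative_left[of "A + h *\<^sub>R B"] mexp_neg_has_vector_derivative_right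
           dexp_has_vector_derivative s refl)+ (simp add: mmul_simps algebra_simps)
    have sR: "norm (s *\<^sub>R X) \<le> norm X" for X :: "'n cmat" using s by (simp add: mult_left_le_one_le)
    have "norm (A + h *\<^sub>R B) \<le> R"
      using norm_triangle_ineq[of A "h *\<^sub>R B"] h mult_right_mono[of "\<bar>h\<bar>" 1 "norm B"] by (simp add: R_def)
    then have "norm (mexp (s *\<^sub>R (A + h *\<^sub>R B)) - mexp (s *\<^sub>R A)) \<le> L * norm (s *\<^sub>R (A + h *\<^sub>R B) - s *\<^sub>R A)"
      using sR[of "A + h *\<^sub>R B"] sR[of A] by (intro L) (auto simp: R_def intro: order_trans)
    also have "\<dots> = L * norm (s *\<^sub>R (h *\<^sub>R B))" by (simp add: algebra_simps)
    also have "\<dots> \<le> \<bar>L\<bar> * norm (s *\<^sub>R (h *\<^sub>R B))" by (rule mult_right_mono) auto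
    also have "\<dots> \<le> \<bar>L\<bar> * norm (h *\<^sub>R B)" by (rule mult_left_mono[OF sR]) simp
    finally have l: "norm (mexp (s *\<^sub>R (A + h *\<^sub>R B)) - mexp (s *\<^sub>R A)) \<le> \<bar>L\<bar> * norm B * \<bar>h\<bar>" by (simp add: mult_ac)
    have "norm ((mexp (- (s *\<^sub>R A)) ** B) ** (mexp (s *\<^sub>R (A + h *\<^sub>R B)) - mexp (s *\<^sub>R A))) \<le> K * M * (\<bar>L\<bar> * norm B * \<bar>h\<bar>)"
      using K(1) M0 by (intro order_trans[OF K(2)] mult_mono l M s) auto
    then have "\<bar>h\<bar> * norm ((mexp (- (s *\<^sub>R A)) ** B) ** (mexp (s *\<^sub>R (A + h *\<^sub>R B)) - mexp (s *\<^sub>R A))) \<le> \<bar>h\<bar> * (K * M * (\<bar>L\<bar> * norm B * \<bar>h\<bar>))"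
      by (rule mult_left_mono) simp
    also have "\<dots> = (K * M * (\<bar>L\<bar> * norm B)) * h\<^sup>2"
      using abs_mult_self_eq[of h] by (simp add: power2_eq_square mult_ac del: abs_mult_self_eq)
    finally show "norm (h *\<^sub>R ((mexp (- (s *\<^sub>R A)) ** B) ** (mexp (s *\<^sub>R (A + h *\<^sub>R B)) - mexp (s *\<^sub>R A)))) \<le> (K * M * (\<bar>L\<bar> * norm B)) * h\<^sup>2"
      by simp
  qed auto
  show ?thesis
  proof (rule has_vector_derivative_of_quadratic_bound)
    fix h :: real assume h: "\<bar>h\<bar> \<le> 1"
    have "mexp (A + h *\<^sub>R B) - mexp (A + 0 *\<^sub>R B) - h *\<^sub>R (mexp A ** dexp A B 1) = mexp A ** (z h 1 - z h 0)"
      by (simp add: z_def mmul_simps)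
    then have "norm (mexp (A + h *\<^sub>R B) - mexp (A + 0 *\<^sub>R B) - h *\<^sub>R (mexp A ** dexp A B 1)) \<le> K * norm (mexp A) * norm (z h 1 - z h 0)"
      using K(2) by simp
    also have "\<dots> \<le> K * norm (mexp A) * (K * M * (\<bar>L\<bar> * norm B) * h\<^sup>2)"
      by (rule mult_left_mono) (use z[OF h] K(1) in auto)
    finally show "norm (mexp (A + h *\<^sub>R B) - mexp (A + 0 *\<^sub>R B) - h *\<^sub>R (mexp A ** dexp A B 1)) \<le> (K * norm (mexp A) * (K * M * (\<bar>L\<bar> * norm B))) * h\<^sup>2"
      by (simp add: mult_ac)
  qed
qed

section \<open>Ordinary differential equations\<close>

text \<open>The fixed point sought is exp (- K t) z t rather than z t. In this weighted norm the
  integral operator contracts on the whole interval at once, so no local solutions have to be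
  glued.\<close>

theorem picard_global:
  fixes f :: "real \<Rightarrow> 'a::euclidean_space \<Rightarrow> 'a"
  assumes cont: "continuous_on ({0..1} \<times> UNIV) (\<lambda>(t, x). f t x)"
    and lip: "\<And>t x y. t \<in> {0..1} \<Longrightarrow> norm (f t x - f t y) \<le> L * norm (x - y)"
  shows "\<exists>z. z 0 = x0 \<and> (\<forall>t\<in>{0..1}. (z has_vector_derivative f t (z t)) (at t within {0..1}))"
proof -
  \<comment> \<open>Integrating exp (K s) gains a factor 1 / K, so this choice makes the contraction
    constant |L| / K at most 1 / 2.\<close>
  define K where "K = 2 * \<bar>L\<bar> + 1"
  have K: "K > 0" "\<bar>L\<bar> / K \<le> 1 / 2" by (auto simp: K_def field_simps)
  \<comment> \<open>Bounded continuous functions live on the whole line; clamping the time to the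
    unit interval extends the operator to them.\<close>
  define c :: "real \<Rightarrow> real" where "c t = max 0 (min 1 t)" for t
  have c: "c t \<in> {0..1}" "t \<in> {0..1} \<Longrightarrow> c t = t" for t by (auto simp: c_def)
  have c_cont: "continuous_on UNIV c" unfolding c_def by (intro continuous_intros)
  define g where "g \<phi> s = f s (exp (K * s) *\<^sub>R apply_bcontfun \<phi> s)" for \<phi> :: "real \<Rightarrow>\<^sub>C 'a" and s
  have g_cont: "continuous_on {0..1} (g \<phi>)" for \<phi>
  proof -
    have "continuous_on {0..1} (\<lambda>s. (\<lambda>(t, x). f t x) (s, exp (K * s) *\<^sub>R apply_bcontfun \<phi> s))"
      by (rule continuous_on_compose2[OF cont]) (auto intro!: continuous_intros)
    then show ?thesis by (simp add: g_def[abs_def])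
  qed
  have g_int: "g \<phi> integrable_on {0..u}" if "u \<in> {0..1}" for \<phi> u
    by (rule integrable_continuous_interval, rule continuous_on_subset[OF g_cont]) (use that in auto)
  define h where "h \<phi> u = exp (- (K * u)) *\<^sub>R (x0 + integral {0..u} (g \<phi>))" for \<phi> u
  have h_cont: "continuous_on {0..1} (h \<phi>)" for \<phi>
    unfolding h_def by (intro continuous_intros indefinite_integral_continuous_1 g_int) auto
  have hc: "h \<phi> \<circ> c \<in> bcontfun" for \<phi>
  proof -
    have "bounded (h \<phi> ` {0..1})" by (intro compact_imp_bounded compact_continuous_image h_cont) auto
    then obtain B where B: "\<And>u. u \<in> {0..1} \<Longrightarrow> norm (h \<phi> u) \<le> B" unfolding bounded_iff by blast
    show ?thesis
    proof (rule bcontfun_normI)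
      show "continuous_on UNIV (h \<phi> \<circ> c)"
        by (rule continuous_on_compose[OF c_cont]) (rule continuous_on_subset[OF h_cont], use c in auto)
      show "norm ((h \<phi> \<circ> c) t) \<le> B" for t using B c by simp
    qed
  qed
  define T where "T \<phi> = Bcontfun (h \<phi> \<circ> c)" for \<phi>
  have T: "apply_bcontfun (T \<phi>) t = h \<phi> (c t)" for \<phi> t
    by (simp add: T_def Bcontfun_inverse[OF hc])
  have exp_int: "((\<lambda>s. exp (K * s)) has_integral (exp (K * u) / K - 1 / K)) {0..u}" if "0 \<le> u" for u
  proof -
    have "((\<lambda>s. exp (K * s)) has_integral (exp (K * u) / K - exp (K * 0) / K)) {0..u}"
      by (rule fundamental_theorem_of_calculus[OF that])
        (use K(1) in \<open>auto intro!: derivative_eq_intros simp: has_real_derivative_iff_has_vector_derivative[symmetric]\<close>)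
    then show ?thesis by simp
  qed
  have "\<exists>!\<phi>. T \<phi> = \<phi>"
  proof (rule banach_fix_type[of "1/2"])
    show "\<forall>\<phi> \<psi>. dist (T \<phi>) (T \<psi>) \<le> 1 / 2 * dist \<phi> \<psi>"
    proof (intro allI dist_bound)
      fix \<phi> \<psi> t
      define u where "u = c t"
      have u: "u \<in> {0..1}" using c by (simp add: u_def)
      have b: "norm (g \<phi> s - g \<psi> s) \<le> (\<bar>L\<bar> * dist \<phi> \<psi>) * exp (K * s)" if "s \<in> {0..u}" for s
      proof -
        have "norm (g \<phi> s - g \<psi> s) \<le> L * norm (exp (K * s) *\<^sub>R apply_bcontfun \<phi> s - exp (K * s) *\<^sub>R apply_bcontfun \<psi> s)"
          unfolding g_def by (rule lip) (use that u in auto)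
        also have "\<dots> = L * (exp (K * s) * dist (apply_bcontfun \<phi> s) (apply_bcontfun \<psi> s))"
          by (simp add: scaleR_diff_right[symmetric] dist_norm)
        also have "\<dots> \<le> \<bar>L\<bar> * (exp (K * s) * dist \<phi> \<psi>)"
          by (intro mult_mono mult_left_mono dist_bounded) auto
        finally show ?thesis by (simp add: mult_ac)
      qed
      have "norm (integral {0..u} (\<lambda>s. g \<phi> s - g \<psi> s)) \<le> integral {0..u} (\<lambda>s. (\<bar>L\<bar> * dist \<phi> \<psi>) * exp (K * s))"
        by (intro integral_norm_bound_integral integrable_diff g_int u b)
          (auto intro!: integrable_continuous_interval continuous_intros)
      also have "\<dots> = (\<bar>L\<bar> * dist \<phi> \<psi>) * (exp (K * u) / K - 1 / K)"
        using has_integral_mult_right[OF exp_int, of u "\<bar>L\<bar> * dist \<phi> \<psi>"] u by (intro integral_unique) auto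
      also have "\<dots> \<le> (\<bar>L\<bar> * dist \<phi> \<psi>) * (exp (K * u) / K)"
        using K(1) by (intro mult_left_mono) auto
      finally have i: "norm (integral {0..u} (g \<phi>) - integral {0..u} (g \<psi>)) \<le> (\<bar>L\<bar> / K * dist \<phi> \<psi>) * exp (K * u)"
        by (simp add: integral_diff[OF g_int[OF u] g_int[OF u]] mult_ac)
      have "dist (apply_bcontfun (T \<phi>) t) (apply_bcontfun (T \<psi>) t) = exp (- (K * u)) * norm (integral {0..u} (g \<phi>) - integral {0..u} (g \<psi>))"
        by (simp add: T h_def u_def[symmetric] dist_norm scaleR_diff_right[symmetric])
      also have "\<dots> \<le> exp (- (K * u)) * ((\<bar>L\<bar> / K * dist \<phi> \<psi>) * exp (K * u))" by (rule mult_left_mono[OF i]) simp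
      also have "\<dots> = \<bar>L\<bar> / K * dist \<phi> \<psi>" by (simp add: exp_minus field_simps)
      also have "\<dots> \<le> 1 / 2 * dist \<phi> \<psi>" by (rule mult_right_mono[OF K(2)]) simp
      finally show "dist (apply_bcontfun (T \<phi>) t) (apply_bcontfun (T \<psi>) t) \<le> 1 / 2 * dist \<phi> \<psi>" .
    qed
  qed auto
  then obtain \<phi> where \<phi>: "T \<phi> = \<phi>" by blast
  define z where "z t = x0 + integral {0..t} (g \<phi>)" for t
  have zg: "g \<phi> t = f t (z t)" if "t \<in> {0..1}" for t
  proof -
    have "apply_bcontfun \<phi> t = h \<phi> t" using T[of \<phi> t] \<phi> c(2)[OF that] by simp
    then show ?thesis by (simp add: g_def h_def z_def exp_minus)
  qed
  have "(z has_vector_derivative f t (z t)) (at t within {0..1})" if "t \<in> {0..1}" for t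
    using integral_has_vector_derivative[OF g_cont that, of \<phi>] zg[OF that]
    unfolding z_def[abs_def] by (auto intro!: derivative_eq_intros)
  moreover have "z 0 = x0" by (simp add: z_def)
  ultimately show ?thesis by blast
qed

text \<open>Nagumo's theorem: the distance \<open>d\<close> from \<open>\<gamma>\<close> to \<open>K\<close> satisfies
  \<open>d (t + h) \<le> (1 + L h) d t + o(h)\<close>.\<close>

theorem nagumo_viability:
  fixes \<gamma> :: "real \<Rightarrow> 'a::euclidean_space"
  assumes K: "closed K" and \<gamma>0: "\<gamma> 0 \<in> K" and r: "0 < r"
    and \<gamma>: "\<And>t. t \<in> {0..1} \<Longrightarrow> (\<gamma> has_vector_derivative v t) (at t within {0..1})"
    and tangent: "\<And>t x. t \<in> {0..<1} \<Longrightarrow> x \<in> K \<Longrightarrow> dist x (\<gamma> t) \<le> r \<Longrightarrow>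
       \<exists>c w. c 0 = x \<and> (\<forall>h\<ge>0. c h \<in> K) \<and> (c has_vector_derivative w) (at 0 within {0..}) \<and>
         norm (w - v t) \<le> L * dist x (\<gamma> t)"
    and t: "t \<in> {0..1}"
  shows "\<gamma> t \<in> K"
proof -
  define d where "d s = infdist (\<gamma> s) K" for s
  have \<gamma>_cont: "continuous_on {0..1} \<gamma>"
    using \<gamma> by (meson continuous_on_eq_continuous_within has_vector_derivative_continuous)
  have d_cont: "continuous_on {0..1} d" unfolding d_def by (intro continuous_on_infdist \<gamma>_cont)
  \<comment> \<open>The summand 1 pays for two first order errors, of the tangent curve
    \<open>c\<close> and of \<gamma>, each made at most h times half of
    \<open>\<psi> T\<close>.\<close>
  define M where "M = \<bar>L\<bar> + 1"
  have bound: "d t \<le> e * exp (M * t)" if e: "e > 0" "e * exp M \<le> r" for e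
  proof (rule ccontr)
    define \<psi> where "\<psi> s = e * exp (M * s)" for s
    assume "\<not> d t \<le> e * exp (M * t)"
    then have t': "d t > \<psi> t" by (simp add: \<psi>_def)
    define S where "S = {s \<in> {0..t}. d s \<le> \<psi> s}"
    have "continuous_on {0..t} d" using t by (intro continuous_on_subset[OF d_cont]) auto
    then have "closed S" unfolding S_def \<psi>_def by (intro continuous_on_closed_Collect_le continuous_intros) auto
    moreover have "bounded S" by (rule bounded_subset[of "{0..t}"]) (auto simp: S_def)
    ultimately have "compact S" by (simp add: compact_eq_bounded_closed)
    moreover have "0 \<in> S" using t \<gamma>0 e by (auto simp: S_def d_def \<psi>_def)
    \<comment> \<open>The last time at which \<open>d\<close> lies below the barrier \<psi>. The
      bound \<open>e * exp M \<le> r\<close> keeps the nearest point of K within the radius in which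
      tangency is assumed, and the step from T to T + h contradicts maximality.\<close>
    ultimately obtain T where T: "T \<in> S" "\<And>s. s \<in> S \<Longrightarrow> s \<le> T"
      using compact_attains_sup[of S] by blast
    then have Tt: "0 \<le> T" "T < t" "d T \<le> \<psi> T" using t' by (auto simp: S_def less_le)
    have \<psi>T: "0 < \<psi> T" using e by (simp add: \<psi>_def)
    have "\<psi> T \<le> e * exp M" using e Tt t by (auto simp: \<psi>_def M_def intro!: mult_left_le)
    then have "d T \<le> r" using Tt e by linarith
    moreover obtain x where x: "x \<in> K" "d T = dist (\<gamma> T) x"
      by (rule infdist_attains_inf[OF K, of "\<gamma> T"]) (use \<gamma>0 in \<open>auto simp: d_def\<close>)
    ultimately obtain c w where c: "c 0 = x" "\<And>h. h \<ge> 0 \<Longrightarrow> c h \<in> K"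
        "(c has_vector_derivative w) (at 0 within {0..})" "norm (w - v T) \<le> L * dist x (\<gamma> T)"
      using tangent[of T x] Tt t by (auto simp: dist_commute)
    have "\<exists>\<delta>>0. \<forall>y\<in>{0..}. norm (y - 0) < \<delta> \<longrightarrow> norm (c y - c 0 - (y - 0) *\<^sub>R w) \<le> (\<psi> T / 2) * norm (y - 0)"
      using c(3) \<psi>T unfolding has_vector_derivative_def has_derivative_within_alt by (metis half_gt_zero)
    then obtain \<delta>1 where \<delta>1: "\<delta>1 > 0" "\<And>y. y \<ge> 0 \<Longrightarrow> y < \<delta>1 \<Longrightarrow> norm (c y - x - y *\<^sub>R w) \<le> (\<psi> T / 2) * y"
      using c(1) by auto
    have "\<exists>\<delta>>0. \<forall>y\<in>{0..1}. norm (y - T) < \<delta> \<longrightarrow> norm (\<gamma> y - \<gamma> T - (y - T) *\<^sub>R v T) \<le> (\<psi> T / 2) * norm (y - T)"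
    proof -
      have "T \<in> {0..1}" using Tt t by simp
      from \<gamma>[OF this] have D: "\<forall>e>0. \<exists>\<delta>>0. \<forall>y\<in>{0..1}. norm (y - T) < \<delta> \<longrightarrow> norm (\<gamma> y - \<gamma> T - (y - T) *\<^sub>R v T) \<le> e * norm (y - T)"
        unfolding has_vector_derivative_def has_derivative_within_alt by (rule conjunct2)
      show ?thesis by (rule D[rule_format]) (use \<psi>T in simp)
    qed
    then obtain \<delta>2 where \<delta>2: "\<delta>2 > 0" "\<And>y. y \<in> {0..1} \<Longrightarrow> norm (y - T) < \<delta>2 \<Longrightarrow> norm (\<gamma> y - \<gamma> T - (y - T) *\<^sub>R v T) \<le> (\<psi> T / 2) * norm (y - T)"
      by blast
    define h where "h = min (t - T) (min (\<delta>1 / 2) (\<delta>2 / 2))"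
    have h: "h > 0" "h \<le> t - T" "h < \<delta>1" "h < \<delta>2" using Tt \<delta>1(1) \<delta>2(1) by (auto simp: h_def min_def)
    have 1: "norm (c h - x - h *\<^sub>R w) \<le> (\<psi> T / 2) * h" using \<delta>1(2)[of h] h by simp
    have 2: "norm (\<gamma> (T + h) - \<gamma> T - h *\<^sub>R v T) \<le> (\<psi> T / 2) * h" using \<delta>2(2)[of "T + h"] h Tt t by simp
    have "norm (w - v T) \<le> \<bar>L\<bar> * \<psi> T"
    proof -
      have "L * dist x (\<gamma> T) \<le> \<bar>L\<bar> * \<psi> T"
        using x Tt by (intro mult_mono) (auto simp: dist_commute)
      then show ?thesis using c(4) by linarith
    qed
    then have 3: "norm (h *\<^sub>R (w - v T)) \<le> h * (\<bar>L\<bar> * \<psi> T)" using h by simp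
    have "d (T + h) \<le> norm (\<gamma> (T + h) - c h)"
      unfolding d_def dist_norm[symmetric] by (rule infdist_le) (use c h in auto)
    also have "\<gamma> (T + h) - c h = (\<gamma> T - x) + (\<gamma> (T + h) - \<gamma> T - h *\<^sub>R v T) - (c h - x - h *\<^sub>R w) - h *\<^sub>R (w - v T)"
      by (simp add: algebra_simps)
    also have "norm \<dots> \<le> norm (\<gamma> T - x) + norm (\<gamma> (T + h) - \<gamma> T - h *\<^sub>R v T) + norm (c h - x - h *\<^sub>R w) + norm (h *\<^sub>R (w - v T))"
      by (meson add_mono_thms_linordered_semiring(3) norm_triangle_ineq norm_triangle_ineq4 order_trans)
    also have "\<dots> \<le> \<psi> T + (\<psi> T / 2) * h + (\<psi> T / 2) * h + h * (\<bar>L\<bar> * \<psi> T)"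
    proof -
      have "norm (\<gamma> T - x) \<le> \<psi> T" using Tt x by (simp add: dist_norm)
      then show ?thesis using 1 2 3 by linarith
    qed
    also have "\<dots> = \<psi> T * (1 + M * h)" by (simp add: M_def algebra_simps)
    also have "\<dots> \<le> \<psi> T * exp (M * h)" using \<psi>T by (intro mult_left_mono exp_ge_add_one_self) auto
    also have "\<dots> = \<psi> (T + h)" by (simp add: \<psi>_def distrib_left exp_add)
    finally have "T + h \<in> S" using h Tt by (auto simp: S_def)
    then show False using T(2)[of "T + h"] h by simp
  qed
  have "d t \<le> 0"
  proof (rule field_le_epsilon)
    fix e :: real assume "e > 0"
    define e' where "e' = min e r / exp M"
    have M: "M \<ge> 0" by (simp add: M_def)
    have "d t \<le> e' * exp (M * t)" by (rule bound) (use \<open>e > 0\<close> r in \<open>auto simp: e'_def\<close>)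
    also have "\<dots> \<le> e' * exp M"
      using t M \<open>e > 0\<close> r by (intro mult_left_mono) (auto simp: e'_def mult_left_le)
    also have "\<dots> \<le> e" by (simp add: e'_def)
    finally show "d t \<le> 0 + e" by simp
  qed
  then have "infdist (\<gamma> t) K = 0" using infdist_nonneg[of "\<gamma> t" K] by (simp add: d_def)
  then show ?thesis using in_closed_iff_infdist_zero[OF K] \<gamma>0 by blast
qed

text \<open>From x in a subspace the straight line x + h w stays inside, so the tangent curves
  reduce to vectors w of the subspace.\<close>

corollary subspace_viability:
  fixes \<gamma> :: "real \<Rightarrow> 'a::euclidean_space"
  assumes K: "subspace K" and \<gamma>0: "\<gamma> 0 \<in> K" and r: "0 < r"
    and \<gamma>: "\<And>t. t \<in> {0..1} \<Longrightarrow> (\<gamma> has_vector_derivative v t) (at t within {0..1})"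
    and tangent: "\<And>t x. t \<in> {0..<1} \<Longrightarrow> x \<in> K \<Longrightarrow> dist x (\<gamma> t) \<le> r \<Longrightarrow>
       \<exists>w\<in>K. norm (w - v t) \<le> L * dist x (\<gamma> t)"
    and t: "t \<in> {0..1}"
  shows "\<gamma> t \<in> K"
proof (rule nagumo_viability[OF closed_subspace[OF K] \<gamma>0 r \<gamma> _ t])
  fix t x assume "t \<in> {0..<1::real}" "x \<in> K" "dist x (\<gamma> t) \<le> r"
  from tangent[OF this] obtain w where w: "w \<in> K" "norm (w - v t) \<le> L * dist x (\<gamma> t)" by blast
  have "((\<lambda>h. x + h *\<^sub>R w) has_vector_derivative w) (at 0 within {0..})" by (auto intro!: derivative_eq_intros)
  then show "\<exists>c w. c 0 = x \<and> (\<forall>h\<ge>0. c h \<in> K) \<and> (c has_vector_derivative w) (at 0 within {0..}) \<and>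
         norm (w - v t) \<le> L * dist x (\<gamma> t)"
    using w \<open>x \<in> K\<close> K by (intro exI[of _ "\<lambda>h. x + h *\<^sub>R w"] exI[of _ w]) (auto simp: subspace_add subspace_scale)
qed

section \<open>Quadratic autonomous systems and their dependence on initial data\<close>

text \<open>The field is the diagonal of a bilinear map. Survival up to time 1 belongs to the
  notion: for which x it holds is precisely what the shooting argument has to control.\<close>

definition quad_sol :: "('a::euclidean_space \<Rightarrow> 'a \<Rightarrow> 'a) \<Rightarrow> 'a \<Rightarrow> (real \<Rightarrow> 'a) \<Rightarrow> bool" where
  "quad_sol Q x z \<longleftrightarrow> z 0 = x \<and> (\<forall>t\<in>{0..1}. (z has_vector_derivative Q (z t) (z t)) (at t within {0..1}))"

lemma quad_sol_continuous: "quad_sol Q x z \<Longrightarrow> continuous_on {0..1} z"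
  unfolding quad_sol_def by (meson continuous_on_eq_continuous_within has_vector_derivative_continuous)

lemma quad_sol_bounded:
  assumes "quad_sol Q x z"
  obtains R where "R > 0" "\<And>t. t \<in> {0..1} \<Longrightarrow> norm (z t) \<le> R"
proof -
  have "bounded (z ` {0..1})"
    by (intro compact_imp_bounded compact_continuous_image quad_sol_continuous[OF assms]) auto
  then show ?thesis using that unfolding bounded_pos by blast
qed

lemma quad_lipschitz:
  assumes "bounded_bilinear Q"
  obtains L where "L \<ge> 0"
    "\<And>x y. norm x \<le> R \<Longrightarrow> norm y \<le> R \<Longrightarrow> norm (Q x x - Q y y) \<le> L * norm (x - y)"
proof -
  interpret bounded_bilinear Q by fact
  obtain B where B: "B \<ge> 0" "\<And>x y. norm (Q x y) \<le> norm x * norm y * B" using nonneg_bounded by blast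
  have "norm (Q x x - Q y y) \<le> (2 * \<bar>R\<bar> * B) * norm (x - y)" if "norm x \<le> R" "norm y \<le> R" for x y
  proof -
    have "Q x x - Q y y = Q x (x - y) + Q (x - y) y" by (simp add: diff_left diff_right)
    also have "norm \<dots> \<le> norm x * norm (x - y) * B + norm (x - y) * norm y * B"
      using B(2) by (meson add_mono norm_triangle_le)
    also have "\<dots> = (norm x + norm y) * (B * norm (x - y))" by (simp add: algebra_simps)
    also have "\<dots> \<le> (2 * \<bar>R\<bar>) * (B * norm (x - y))" using that B(1) by (intro mult_right_mono) auto
    finally show ?thesis by simp
  qed
  then show ?thesis using that[of "2 * \<bar>R\<bar> * B"] B(1) by auto
qed

lemma quad_sol_dist:
  assumes Q: "bounded_bilinear Q"
  obtains L where "\<And>x y z w t. quad_sol Q x z \<Longrightarrow> quad_sol Q y w \<Longrightarrow> (\<And>t. t \<in> {0..1} \<Longrightarrow> norm (z t) \<le> R) \<Longrightarrow>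
     (\<And>t. t \<in> {0..1} \<Longrightarrow> norm (w t) \<le> R) \<Longrightarrow> t \<in> {0..1} \<Longrightarrow> norm (z t - w t) \<le> norm (x - y) * exp L"
proof -
  obtain L where L: "L \<ge> 0" "\<And>x y. norm x \<le> R \<Longrightarrow> norm y \<le> R \<Longrightarrow> norm (Q x x - Q y y) \<le> L * norm (x - y)"
    using quad_lipschitz[OF Q] by metis
  have "norm (z t - w t) \<le> norm (x - y) * exp L"
    if s: "quad_sol Q x z" "quad_sol Q y w" and b: "\<And>t. t \<in> {0..1} \<Longrightarrow> norm (z t) \<le> R" "\<And>t. t \<in> {0..1} \<Longrightarrow> norm (w t) \<le> R"
      and t: "t \<in> {0..1}" for x y z w t
  proof -
    have "norm (z t - w t) \<le> norm (z 0 - w 0) * exp (L * (t - 0))"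
    proof (rule gronwall[where a=0 and b=1 and z="\<lambda>t. z t - w t" and w="\<lambda>t. Q (z t) (z t) - Q (w t) (w t)"])
      show "((\<lambda>t. z t - w t) has_vector_derivative Q (z t) (z t) - Q (w t) (w t)) (at t within {0..1})" if "t \<in> {0..1}" for t
        using s that unfolding quad_sol_def by (intro has_vector_derivative_diff) auto
    qed (use L b t in auto)
    also have "\<dots> \<le> norm (x - y) * exp L"
      using s t L(1) unfolding quad_sol_def by (intro mult_mono) (auto simp: mult_left_le)
    finally show ?thesis .
  qed
  then show ?thesis using that by blast
qed

lemma quad_sol_unique:
  assumes Q: "bounded_bilinear Q" and s: "quad_sol Q x z" "quad_sol Q x w" and t: "t \<in> {0..1}"
  shows "z t = w t"
proof -
  obtain R1 where R1: "\<And>t. t \<in> {0..1} \<Longrightarrow> norm (z t) \<le> R1" using quad_sol_bounded[OF s(1)] by metis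
  obtain R2 where R2: "\<And>t. t \<in> {0..1} \<Longrightarrow> norm (w t) \<le> R2" using quad_sol_bounded[OF s(2)] by metis
  obtain L where L: "norm (z t - w t) \<le> norm (x - x) * exp L"
    using quad_sol_dist[OF Q, of "max R1 R2"] s R1 R2 t by (metis max.coboundedI1 max.coboundedI2)
  then show ?thesis by simp
qed

text \<open>Replacing the argument of the quadratic field by its projection to a ball makes it globally
  Lipschitz; its solutions that stay in the ball are the solutions of the original equation.\<close>

lemma quad_truncated_flow:
  fixes Q :: "'a::euclidean_space \<Rightarrow> 'a \<Rightarrow> 'a"
  assumes Q: "bounded_bilinear Q" and R: "R \<ge> 0"
  obtains \<Phi> L where "\<And>x y t. t \<in> {0..1} \<Longrightarrow> norm (\<Phi> x t - \<Phi> y t) \<le> norm (x - y) * exp L"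
    "\<And>x. (\<And>t. t \<in> {0..1} \<Longrightarrow> norm (\<Phi> x t) \<le> R) \<Longrightarrow> quad_sol Q x (\<Phi> x)"
    "\<And>x z t. quad_sol Q x z \<Longrightarrow> (\<And>t. t \<in> {0..1} \<Longrightarrow> norm (z t) \<le> R) \<Longrightarrow> t \<in> {0..1} \<Longrightarrow> z t = \<Phi> x t"
proof -
  define P :: "'a \<Rightarrow> 'a" where "P = closest_point (cball 0 R)"
  have P: "norm (P x) \<le> R" "norm x \<le> R \<Longrightarrow> P x = x" "norm (P x - P y) \<le> norm (x - y)" for x y
    using closest_point_in_set[of "cball 0 R" x] closest_point_self[of x "cball 0 R"]
      closest_point_lipschitz[of "cball 0 R" x y] R by (auto simp: P_def dist_norm)
  obtain L where L: "L \<ge> 0" "\<And>x y. norm x \<le> R \<Longrightarrow> norm y \<le> R \<Longrightarrow> norm (Q x x - Q y y) \<le> L * norm (x - y)"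
    using quad_lipschitz[OF Q] by metis
  define f where "f x = Q (P x) (P x)" for x
  have lip: "norm (f x - f y) \<le> L * norm (x - y)" for x y
    unfolding f_def by (rule order_trans[OF L(2)]) (auto intro: P L mult_left_mono)
  have P_cont: "continuous_on UNIV P"
    unfolding P_def by (rule continuous_on_closest_point) (use R in auto)
  have "continuous_on ({0..1} \<times> UNIV) (\<lambda>(t::real, x). f x)"
    unfolding f_def split_beta by (intro bounded_bilinear.continuous_on[OF Q] continuous_on_compose2[OF P_cont] continuous_intros) auto
  then have "\<exists>z. z 0 = x \<and> (\<forall>t\<in>{0..1}. (z has_vector_derivative f (z t)) (at t within {0..1}))" for x
    by (rule picard_global) (rule lip)
  then obtain \<Phi> where \<Phi>: "\<And>x. \<Phi> x 0 = x" "\<And>x t. t \<in> {0..1} \<Longrightarrow> (\<Phi> x has_vector_derivative f (\<Phi> x t)) (at t within {0..1})"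
    by metis
  have dist: "norm (z t - w t) \<le> norm (z 0 - w 0) * exp L"
    if "\<And>t. t \<in> {0..1} \<Longrightarrow> (z has_vector_derivative f (z t)) (at t within {0..1})"
      "\<And>t. t \<in> {0..1} \<Longrightarrow> (w has_vector_derivative f (w t)) (at t within {0..1})" "t \<in> {0..1}" for z w t
  proof -
    have "norm (z t - w t) \<le> norm (z 0 - w 0) * exp (L * (t - 0))"
      by (rule gronwall[where a=0 and b=1 and z="\<lambda>t. z t - w t" and w="\<lambda>t. f (z t) - f (w t)"])
        (use that lip in \<open>auto intro!: has_vector_derivative_diff\<close>)
    also have "\<dots> \<le> norm (z 0 - w 0) * exp L" using that L(1) by (intro mult_left_mono) (auto simp: mult_left_le)
    finally show ?thesis .
  qed
  show ?thesis
  proof (rule that[of \<Phi> L])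
    show "norm (\<Phi> x t - \<Phi> y t) \<le> norm (x - y) * exp L" if "t \<in> {0..1}" for x y t
      using dist[OF \<Phi>(2) \<Phi>(2) that, of x y] by (simp add: \<Phi>(1))
    show "quad_sol Q x (\<Phi> x)" if "\<And>t. t \<in> {0..1} \<Longrightarrow> norm (\<Phi> x t) \<le> R" for x
      using \<Phi>(2)[of _ x] that by (auto simp: quad_sol_def \<Phi>(1) f_def P(2))
    show "z t = \<Phi> x t" if z: "quad_sol Q x z" "\<And>t. t \<in> {0..1} \<Longrightarrow> norm (z t) \<le> R" and t: "t \<in> {0..1}" for x z t
    proof -
      have "norm (z t - \<Phi> x t) \<le> norm (z 0 - \<Phi> x 0) * exp L"
        by (rule dist[OF _ \<Phi>(2) t]) (use z in \<open>auto simp: quad_sol_def f_def P(2)\<close>)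
      then show ?thesis using z by (simp add: \<Phi>(1) quad_sol_def)
    qed
  qed
qed

text \<open>Truncate at radius R + e, where R bounds z. By the Lipschitz dependence with factor exp
  L, data within e exp (- L) of x give truncated trajectories e-close to z; they stay in the ball
  and so solve the original equation.\<close>

lemma quad_sol_open:
  fixes Q :: "'a::euclidean_space \<Rightarrow> 'a \<Rightarrow> 'a"
  assumes Q: "bounded_bilinear Q" and z: "quad_sol Q x z" and e: "e > 0"
  obtains d where "d > 0" "\<And>y. norm (y - x) < d \<Longrightarrow> \<exists>w. quad_sol Q y w \<and> (\<forall>t\<in>{0..1}. norm (w t - z t) < e)"
proof -
  obtain R where R: "R > 0" "\<And>t. t \<in> {0..1} \<Longrightarrow> norm (z t) \<le> R" using quad_sol_bounded[OF z] by metis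
  have Re: "R + e \<ge> 0" using R(1) e by simp
  obtain \<Phi> L where \<Phi>: "\<And>x y t. t \<in> {0..1} \<Longrightarrow> norm (\<Phi> x t - \<Phi> y t) \<le> norm (x - y) * exp L"
    "\<And>x. (\<And>t. t \<in> {0..1} \<Longrightarrow> norm (\<Phi> x t) \<le> R + e) \<Longrightarrow> quad_sol Q x (\<Phi> x)"
    "\<And>x z t. quad_sol Q x z \<Longrightarrow> (\<And>t. t \<in> {0..1} \<Longrightarrow> norm (z t) \<le> R + e) \<Longrightarrow> t \<in> {0..1} \<Longrightarrow> z t = \<Phi> x t"
    by (rule quad_truncated_flow[OF Q Re]) blast
  have zR: "norm (z t) \<le> R + e" if "t \<in> {0..1}" for t using R(2)[OF that] e by simp
  show ?thesis
  proof (rule that[of "e * exp (- L)"])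
    fix y assume "norm (y - x) < e * exp (- L)"
    then have lt: "norm (y - x) * exp L < e" by (simp add: exp_minus field_simps)
    have close: "norm (\<Phi> y t - z t) < e" if "t \<in> {0..1}" for t
      using \<Phi>(1)[OF that, of y x] \<Phi>(3)[OF z zR that] lt by simp
    have "norm (\<Phi> y t) \<le> R + e" if "t \<in> {0..1}" for t
      using close[OF that] R(2)[OF that] norm_triangle_ineq2[of "\<Phi> y t" "z t"] by simp
    then show "\<exists>w. quad_sol Q y w \<and> (\<forall>t\<in>{0..1}. norm (w t - z t) < e)"
      using \<Phi>(2) close by blast
  qed (use e in simp)
qed

text \<open>Solutions bounded by R are trajectories of one and the same truncated flow, which
  depends continuously on its initial point. The bound passes to the limit trajectory, so that one
  also solves the original equation.\<close>

lemma quad_sol_closed: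
  fixes Q :: "'a::euclidean_space \<Rightarrow> 'a \<Rightarrow> 'a"
  assumes Q: "bounded_bilinear Q" and z: "\<And>n. quad_sol Q (x n) (z n)"
    and R: "\<And>n t. t \<in> {0..1} \<Longrightarrow> norm (z n t) \<le> R" and x: "x \<longlonglongrightarrow> x0"
  obtains w where "quad_sol Q x0 w" "\<And>t. t \<in> {0..1} \<Longrightarrow> (\<lambda>n. z n t) \<longlonglongrightarrow> w t"
proof -
  have "R \<ge> 0" using order_trans[OF norm_ge_zero R[of 0 0]] by simp
  obtain \<Phi> L where \<Phi>: "\<And>x y t. t \<in> {0..1} \<Longrightarrow> norm (\<Phi> x t - \<Phi> y t) \<le> norm (x - y) * exp L"
    "\<And>x. (\<And>t. t \<in> {0..1} \<Longrightarrow> norm (\<Phi> x t) \<le> R) \<Longrightarrow> quad_sol Q x (\<Phi> x)"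
    "\<And>x z t. quad_sol Q x z \<Longrightarrow> (\<And>t. t \<in> {0..1} \<Longrightarrow> norm (z t) \<le> R) \<Longrightarrow> t \<in> {0..1} \<Longrightarrow> z t = \<Phi> x t"
    by (rule quad_truncated_flow[OF Q \<open>R \<ge> 0\<close>]) blast
  have lim: "(\<lambda>n. z n t) \<longlonglongrightarrow> \<Phi> x0 t" if t: "t \<in> {0..1}" for t
  proof -
    have "(\<lambda>n. norm (x n - x0) * exp L) \<longlonglongrightarrow> norm (x0 - x0) * exp L"
      by (intro tendsto_intros x)
    then have l: "(\<lambda>n. norm (x n - x0) * exp L) \<longlonglongrightarrow> 0" by simp
    have "(\<lambda>n. \<Phi> (x n) t - \<Phi> x0 t) \<longlonglongrightarrow> 0"
      by (rule Lim_null_comparison[OF _ l]) (use \<Phi>(1)[OF t] in auto)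
    then have "(\<lambda>n. \<Phi> (x n) t) \<longlonglongrightarrow> \<Phi> x0 t" by (rule LIM_zero_cancel)
    then show ?thesis using \<Phi>(3)[OF z R t] by simp
  qed
  have b: "norm (\<Phi> x0 t) \<le> R" if t: "t \<in> {0..1}" for t
    by (rule LIMSEQ_le_const2[OF tendsto_norm[OF lim[OF t]]]) (use R[OF t] in auto)
  show ?thesis by (rule that[of "\<Phi> x0"]) (intro \<Phi>(2) b lim; assumption)+
qed

section \<open>The Lie algebra of a compact matrix group\<close>

lemma matrix_inv_eqI:
  fixes A B :: "'n::finite cmat"
  assumes "A ** B = mat 1"
  shows "matrix_inv A = B"
proof -
  have BA: "B ** A = mat 1" using assms by (rule matrix_left_right_inverse1)
  have "A ** matrix_inv A = mat 1 \<and> matrix_inv A ** A = mat 1"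
    unfolding matrix_inv_def by (rule someI[of _ B]) (simp add: assms BA)
  then have "B ** (A ** matrix_inv A) = B" by simp
  then show ?thesis by (simp add: matrix_mul_assoc BA)
qed

lemma matrix_inv_mult:
  fixes A :: "'n::finite cmat"
  assumes "invertible A"
  shows "A ** matrix_inv A = mat 1" "matrix_inv A ** A = mat 1"
    "B ** A ** matrix_inv A = B" "B ** matrix_inv A ** A = B"
proof -
  obtain C where C: "A ** C = mat 1" using assms unfolding invertible_def by blast
  show 1: "A ** matrix_inv A = mat 1" using C matrix_inv_eqI[OF C] by simp
  show 2: "matrix_inv A ** A = mat 1" by (rule matrix_left_right_inverse1[OF 1])
  show "B ** A ** matrix_inv A = B" "B ** matrix_inv A ** A = B"
    by (simp_all add: matrix_mul_assoc[symmetric] 1 2)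
qed

lemma matrix_inv_mexp [simp]: "matrix_inv (mexp (A :: 'n::finite cmat)) = mexp (- A)"
  by (rule matrix_inv_eqI) simp

lemma matrix_group_mpow: "matrix_group G \<Longrightarrow> g \<in> G \<Longrightarrow> mpow g k \<in> G"
  by (induction k) (auto simp: matrix_group_def)

lemma mpow_mexp: "mpow (mexp (A :: 'n::finite cmat)) k = mexp (real k *\<^sub>R A)"
proof (induction k)
  case (Suc k)
  then show ?case using mexp_add_scaleR[of 1 "real k" A] by simp
qed simp

section \<open>Velocities of group elements belong to the Lie algebra\<close>

text \<open>The factors b are replaced by a one at a time; each exchange costs one term with a - b
  between two bounded powers. Boundedness of all powers, available in a compact group, makes the
  estimate linear in m.\<close>

lemma norm_mpow_diff_le:
  fixes a b :: "'n::finite cmat"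
  assumes K: "K \<ge> 0" "\<And>(A :: 'n cmat) (B :: 'n cmat). norm (A ** B) \<le> K * norm A * norm B"
    and a: "\<And>j. j \<le> m \<Longrightarrow> norm (mpow a j) \<le> M" and b: "\<And>j. j \<le> m \<Longrightarrow> norm (mpow b j) \<le> N"
  shows "norm (mpow a m - mpow b m) \<le> m * (K * (K * M * norm (a - b)) * N)"
proof -
  have M: "M \<ge> 0" and N: "N \<ge> 0" using order_trans[OF norm_ge_zero a[of 0]] order_trans[OF norm_ge_zero b[of 0]] by auto
  have "norm (mpow a j ** mpow b (m - j) - mpow b m) \<le> j * (K * (K * M * norm (a - b)) * N)" if "j \<le> m" for j
    using that
  proof (induction j)
    case (Suc j)
    then have "m - j = Suc (m - Suc j)" by simp
    then have "mpow a (Suc j) ** mpow b (m - Suc j) - mpow a j ** mpow b (m - j) = mpow a j ** (a - b) ** mpow b (m - Suc j)"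
      by (simp add: mmul_simps mpow_commute)
    then have "mpow a (Suc j) ** mpow b (m - Suc j) - mpow b m
        = mpow a j ** (a - b) ** mpow b (m - Suc j) + (mpow a j ** mpow b (m - j) - mpow b m)" by (simp add: algebra_simps)
    then have "norm (mpow a (Suc j) ** mpow b (m - Suc j) - mpow b m)
        \<le> norm (mpow a j ** (a - b) ** mpow b (m - Suc j)) + norm (mpow a j ** mpow b (m - j) - mpow b m)"
      by (simp only: norm_triangle_ineq)
    moreover have "norm (mpow a j ** (a - b) ** mpow b (m - Suc j)) \<le> K * (K * M * norm (a - b)) * N"
      using K(1) M N Suc.prems
      by (intro order_trans[OF K(2)] mult_mono mult_left_mono order_trans[OF K(2)] a b mult_nonneg_nonneg) auto
    ultimately show ?case using Suc by (simp add: algebra_simps)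
  qed simp
  from this[of m] show ?thesis by simp
qed

lemma filterlim_nat_floor_ratio:
  assumes c: "filterlim c at_top sequentially" and t: "t \<ge> 0"
  shows "(\<lambda>n. real (nat \<lfloor>t * c n\<rfloor>) / c n) \<longlonglongrightarrow> t"
proof (rule tendsto_sandwich[where f="\<lambda>n. t - 1 / c n" and h="\<lambda>_. t"])
  have pos: "eventually (\<lambda>n. c n > 0) sequentially" using c by (simp add: filterlim_at_top_dense)
  have fl: "real (nat \<lfloor>t * x\<rfloor>) \<le> t * x" "t * x - 1 \<le> real (nat \<lfloor>t * x\<rfloor>)" if "x > 0" for x
  proof -
    have "0 \<le> \<lfloor>t * x\<rfloor>" using t that by simp
    then have "real (nat \<lfloor>t * x\<rfloor>) = of_int \<lfloor>t * x\<rfloor>" by simp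
    then show "real (nat \<lfloor>t * x\<rfloor>) \<le> t * x" "t * x - 1 \<le> real (nat \<lfloor>t * x\<rfloor>)" by linarith+
  qed
  show "eventually (\<lambda>n. t - 1 / c n \<le> real (nat \<lfloor>t * c n\<rfloor>) / c n) sequentially"
    using pos
  proof eventually_elim
    case (elim n)
    have "t - 1 / c n = (t * c n - 1) / c n" using elim by (simp add: diff_divide_distrib)
    then show ?case using divide_right_mono[OF fl(2)[OF elim], of "c n"] elim by simp
  qed
  show "eventually (\<lambda>n. real (nat \<lfloor>t * c n\<rfloor>) / c n \<le> t) sequentially"
    using pos
  proof eventually_elim
    case (elim n)
    then show ?case using divide_right_mono[OF fl(1)[OF elim], of "c n"] by simp
  qed
  have "(\<lambda>n. 1 / c n) \<longlonglongrightarrow> 0"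
    using tendsto_inverse_0_at_top[OF c] by (simp add: inverse_eq_divide)
  then have "(\<lambda>n. t - 1 / c n) \<longlonglongrightarrow> t - 0" by (intro tendsto_intros)
  then show "(\<lambda>n. t - 1 / c n) \<longlonglongrightarrow> t" by simp
qed simp

text \<open>A power of \<open>g n\<close> with exponent about t \<open>c n\<close> lies in G. Since
  \<open>g n\<close> agrees with exp (X / \<open>c n\<close>) up to o(1 / \<open>c n\<close>), the
  telescoping estimate shows that these powers converge to exp (t X), and G is closed.\<close>

theorem lie_algebraI_sequence:
  fixes G :: "'n::finite cmat set"
  assumes G: "compact_lie_group G" and g: "\<And>n. g n \<in> G" and c: "filterlim c at_top sequentially"
    and lim: "(\<lambda>n. c n *\<^sub>R (g n - mat 1)) \<longlonglongrightarrow> X"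
  shows "X \<in> lie_algebra G"
proof -
  have grp: "matrix_group G" and cmp: "compact G" using G by (auto simp: compact_lie_group_def)
  obtain K where K: "K \<ge> 1" "\<And>(A :: 'n cmat) (B :: 'n cmat). norm (A ** B) \<le> K * norm A * norm B"
    using mmul_norm_bound by blast
  obtain M where M: "\<And>g. g \<in> G \<Longrightarrow> norm g \<le> M" using compact_imp_bounded[OF cmp] by (auto simp: bounded_iff)
  have pos: "eventually (\<lambda>n. c n > 0) sequentially" using c by (simp add: filterlim_at_top_dense)
  have inv: "(\<lambda>n. 1 / c n) \<longlonglongrightarrow> 0"
    using tendsto_inverse_0_at_top[OF c] by (simp add: inverse_eq_divide)
  define e where "e n = mexp ((1 / c n) *\<^sub>R X)" for n
  have ge: "(\<lambda>n. c n *\<^sub>R (g n - e n)) \<longlonglongrightarrow> 0"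
  proof -
    obtain C where C: "\<And>Y :: 'n cmat. norm Y \<le> 1 \<Longrightarrow> norm (mexp Y - mat 1 - Y) \<le> C * (norm Y)\<^sup>2"
      using mexp_taylor by blast
    have "(\<lambda>n. (1 / c n) *\<^sub>R X) \<longlonglongrightarrow> 0 *\<^sub>R X" by (intro tendsto_intros inv)
    then have "eventually (\<lambda>n. norm ((1 / c n) *\<^sub>R X) < 1) sequentially"
      by (intro order_tendstoD(2)[of "\<lambda>n. norm ((1 / c n) *\<^sub>R X)" 0] tendsto_norm_zero) auto
    with pos have "eventually (\<lambda>n. norm (c n *\<^sub>R (e n - mat 1) - X) \<le> (C * (norm X)\<^sup>2) * (1 / c n)) sequentially"
    proof eventually_elim
      case (elim n)
      have "c n *\<^sub>R (e n - mat 1) - X = c n *\<^sub>R (e n - mat 1 - (1 / c n) *\<^sub>R X)"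
        using elim by (simp add: algebra_simps)
      then have "norm (c n *\<^sub>R (e n - mat 1) - X) = c n * norm (e n - mat 1 - (1 / c n) *\<^sub>R X)" using elim by simp
      also have "\<dots> \<le> c n * (C * (norm ((1 / c n) *\<^sub>R X))\<^sup>2)"
        unfolding e_def using elim by (intro mult_left_mono C) auto
      also have "\<dots> = (C * (norm X)\<^sup>2) * (1 / c n)"
        using elim by (simp add: power2_eq_square)
      finally show ?case .
    qed
    then have "(\<lambda>n. c n *\<^sub>R (e n - mat 1) - X) \<longlonglongrightarrow> 0"
      by (rule Lim_null_comparison) (rule tendsto_mult_right_zero[OF inv])
    then have "(\<lambda>n. c n *\<^sub>R (g n - mat 1) - X - (c n *\<^sub>R (e n - mat 1) - X)) \<longlonglongrightarrow> (X - X) - 0"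
      by (intro tendsto_intros lim)
    then show ?thesis by (simp add: algebra_simps)
  qed
  have main: "mexp (t *\<^sub>R X) \<in> G" if t: "t \<ge> 0" for t
  proof -
    define m where "m n = nat \<lfloor>t * c n\<rfloor>" for n
    have mlim: "(\<lambda>n. real (m n) / c n) \<longlonglongrightarrow> t" unfolding m_def by (rule filterlim_nat_floor_ratio[OF c t])
    have "(\<lambda>n. mexp ((real (m n) / c n) *\<^sub>R X)) \<longlonglongrightarrow> mexp (t *\<^sub>R X)"
      by (rule continuous_on_tendsto_compose[OF continuous_on_mexp[of UNIV]]) (auto intro!: tendsto_intros mlim)
    moreover have "(\<lambda>n. mpow (g n) (m n) - mexp ((real (m n) / c n) *\<^sub>R X)) \<longlonglongrightarrow> 0"
    proof -
      have "bounded ((\<lambda>s. mexp (s *\<^sub>R X)) ` {0..t + 1})"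
        by (intro compact_imp_bounded compact_continuous_image) (auto intro!: continuous_intros)
      then obtain N where N: "\<And>s. s \<in> {0..t + 1} \<Longrightarrow> norm (mexp (s *\<^sub>R X)) \<le> N" unfolding bounded_iff by blast
      have "eventually (\<lambda>n. real (m n) / c n < t + 1) sequentially"
        by (rule order_tendstoD(2)[OF mlim]) simp
      with pos have "eventually (\<lambda>n. norm (mpow (g n) (m n) - mexp ((real (m n) / c n) *\<^sub>R X))
          \<le> (real (m n) / c n) * (K * (K * M * norm (c n *\<^sub>R (g n - e n))) * N)) sequentially"
      proof eventually_elim
        case (elim n)
        have "norm (mpow (g n) (m n) - mpow (e n) (m n)) \<le> m n * (K * (K * M * norm (g n - e n)) * N)"
        proof (rule norm_mpow_diff_le)
          show "norm (mpow (e n) j) \<le> N" if "j \<le> m n" for j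
          proof -
            have "real j / c n \<le> real (m n) / c n" using that elim by (simp add: divide_right_mono)
            then have "real j / c n \<in> {0..t + 1}" using elim by auto
            from N[OF this] show ?thesis by (simp add: e_def mpow_mexp)
          qed
        qed (use K M matrix_group_mpow[OF grp g] in auto)
        also have "\<dots> = (real (m n) / c n) * (K * (K * M * norm (c n *\<^sub>R (g n - e n))) * N)"
          using elim by simp
        finally show ?case by (simp add: e_def mpow_mexp)
      qed
      moreover have "(\<lambda>n. (real (m n) / c n) * (K * (K * M * norm (c n *\<^sub>R (g n - e n))) * N)) \<longlonglongrightarrow> t * (K * (K * M * 0) * N)"
        by (intro tendsto_intros mlim tendsto_norm_zero ge)
      then have "(\<lambda>n. (real (m n) / c n) * (K * (K * M * norm (c n *\<^sub>R (g n - e n))) * N)) \<longlonglongrightarrow> 0" by simp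
      ultimately show ?thesis by (rule Lim_null_comparison)
    qed
    ultimately have "(\<lambda>n. mpow (g n) (m n) - mexp ((real (m n) / c n) *\<^sub>R X) + mexp ((real (m n) / c n) *\<^sub>R X)) \<longlonglongrightarrow> 0 + mexp (t *\<^sub>R X)"
      by (intro tendsto_add)
    then show ?thesis
      using closed_sequentially[OF compact_imp_closed[OF cmp], of "\<lambda>n. mpow (g n) (m n)"] matrix_group_mpow[OF grp g] by simp
  qed
  have "mexp (t *\<^sub>R X) \<in> G" for t
  proof (cases "t \<ge> 0")
    case False
    then have "matrix_inv (mexp ((- t) *\<^sub>R X)) \<in> G" using main[of "- t"] grp by (simp add: matrix_group_def del: matrix_inv_mexp)
    then show ?thesis by simp
  qed (rule main)
  then show ?thesis by (simp add: lie_algebra_def)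
qed

text \<open>Sample the curve at the points a + (b - a) / (n + 1) and rescale by the inverse steps.
  The derivative at the left end is one-sided, which suits paths on the closed unit
  interval.\<close>

lemma lie_algebraI_curve:
  fixes G :: "'n::finite cmat set"
  assumes G: "compact_lie_group G" and c: "(c has_vector_derivative X) (at a within {a..b})" and "a < b"
    and cG: "\<And>s. s \<in> {a..b} \<Longrightarrow> c s \<in> G" and ca: "c a = mat 1"
  shows "X \<in> lie_algebra G"
proof -
  define s where "s n = (b - a) / real (Suc n)" for n
  have s: "s n > 0" "a + s n \<in> {a..b}" for n
    using \<open>a < b\<close> by (auto simp: s_def field_simps mult_right_mono)
  have s_ne: "s n \<noteq> 0" for n using s(1)[of n] by simp
  have s0: "s \<longlonglongrightarrow> 0"
    unfolding s_def using LIMSEQ_Suc[OF lim_const_over_n[of "b - a"]] by simp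
  show ?thesis
  proof (rule lie_algebraI_sequence[OF G])
    show "c (a + s n) \<in> G" for n using cG s by simp
    have "filterlim s (at_right 0) sequentially"
      using s0 s(1) s_ne by (simp add: filterlim_at)
    then show "filterlim (\<lambda>n. inverse (s n)) at_top sequentially"
      by (rule filterlim_compose[OF filterlim_inverse_at_top_right])
    have "((\<lambda>y. (1 / norm (y - a)) *\<^sub>R (c y - (c a + (y - a) *\<^sub>R X))) \<longlongrightarrow> 0) (at a within {a..b})"
      using c by (simp add: has_vector_derivative_def has_derivative_within)
    moreover have "filterlim (\<lambda>n. a + s n) (at a within {a..b}) sequentially"
      unfolding filterlim_at using s0 s tendsto_add[OF tendsto_const s0, of a] by (simp add: s_ne)
    ultimately have "(\<lambda>n. (1 / norm (s n)) *\<^sub>R (c (a + s n) - (c a + s n *\<^sub>R X))) \<longlonglongrightarrow> 0"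
      using filterlim_compose[of _ _ _ "\<lambda>n. a + s n" sequentially] by force
    moreover have "(1 / norm (s n)) *\<^sub>R (c (a + s n) - (c a + s n *\<^sub>R X)) = inverse (s n) *\<^sub>R (c (a + s n) - mat 1) - X" for n
      using s(1)[of n] by (simp add: ca algebra_simps inverse_eq_divide)
    ultimately show "(\<lambda>n. inverse (s n) *\<^sub>R (c (a + s n) - mat 1)) \<longlonglongrightarrow> X"
      by (simp add: LIM_zero_iff)
  qed
qed

lemma lie_algebra_mexp: "X \<in> lie_algebra G \<Longrightarrow> mexp (t *\<^sub>R X) \<in> G" "X \<in> lie_algebra G \<Longrightarrow> mexp X \<in> G"
  unfolding lie_algebra_def using scaleR_one by (metis (mono_tags, lifting) mem_Collect_eq)+

text \<open>The sum X + Y is the velocity at 0 of exp (t X) exp (t Y).\<close>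

lemma subspace_lie_algebra:
  fixes G :: "'n::finite cmat set"
  assumes G: "compact_lie_group G"
  shows "subspace (lie_algebra G)"
proof (rule subspaceI)
  have grp: "matrix_group G" using G by (auto simp: compact_lie_group_def)
  show "0 \<in> lie_algebra G" using grp by (simp add: lie_algebra_def matrix_group_def)
  show "c *\<^sub>R X \<in> lie_algebra G" if "X \<in> lie_algebra G" for c X using that by (simp add: lie_algebra_def)
  fix X Y assume X: "X \<in> lie_algebra G" and Y: "Y \<in> lie_algebra G"
  show "X + Y \<in> lie_algebra G"
  proof (rule lie_algebraI_curve[OF G, where a=0 and b=1])
    show "((\<lambda>t. mexp (t *\<^sub>R X) ** mexp (t *\<^sub>R Y)) has_vector_derivative X + Y) (at 0 within {0..1})"
      using has_vector_derivative_mmul[OF mexp_has_vector_derivative_left[of X 0 "{0..1}"] mexp_has_vector_derivative_left[of Y 0 "{0..1}"]]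
      by (simp add: add.commute)
    show "mexp (s *\<^sub>R X) ** mexp (s *\<^sub>R Y) \<in> G" for s
      using grp lie_algebra_mexp(1)[OF X, of s] lie_algebra_mexp(1)[OF Y, of s] by (simp add: matrix_group_def)
  qed auto
qed

lemma lie_algebra_Ad:
  fixes G :: "'n::finite cmat set"
  assumes G: "matrix_group G" and g: "g \<in> G" and X: "X \<in> lie_algebra G"
  shows "g ** X ** matrix_inv g \<in> lie_algebra G"
proof -
  have inv: "invertible g" and gi: "matrix_inv g \<in> G" using G g by (auto simp: matrix_group_def)
  have "mexp (t *\<^sub>R (g ** X ** matrix_inv g)) = g ** mexp (t *\<^sub>R X) ** matrix_inv g" for t
    using mexp_conj[OF matrix_inv_mult(2,1)[OF inv], of "t *\<^sub>R X"] by (simp add: mmul_simps)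
  then show ?thesis using G g gi lie_algebra_mexp[OF X] by (simp add: lie_algebra_def matrix_group_def)
qed

text \<open>Every y orthogonal to S is orthogonal to all values of f and hence to d; in finite
  dimension S equals its double orthogonal complement.\<close>

lemma has_vector_derivative_in_subspace:
  fixes f :: "real \<Rightarrow> 'a::euclidean_space"
  assumes S: "subspace S" and f: "(f has_vector_derivative d) (at t within {a..b})" and t: "t \<in> {a..b}" "a < b"
    and fS: "\<And>s. s \<in> {a..b} \<Longrightarrow> f s \<in> S"
  shows "d \<in> S"
proof -
  have "y \<bullet> d = 0" if y: "\<And>x. x \<in> S \<Longrightarrow> y \<bullet> x = 0" for y
  proof -
    have "((\<lambda>s. y \<bullet> f s) has_vector_derivative y \<bullet> d) (at t within {a..b})"
      by (rule bounded_linear.has_vector_derivative[OF bounded_linear_inner_right f])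
    moreover have "((\<lambda>s. y \<bullet> f s) has_vector_derivative 0) (at t within {a..b})"
      by (rule has_vector_derivative_transform[OF t(1) _ has_vector_derivative_const[of 0]]) (use y fS in auto)
    ultimately show ?thesis
      using vector_derivative_unique_within[of t "{a..b}"] t trivial_limit_within islimpt_Icc by (metis (no_types, lifting) vector_derivative_unique_within)
  qed
  then have "d \<in> S\<^sup>\<bottom>\<^sup>\<bottom>" by (auto simp: orthogonal_comp_def orthogonal_def inner_commute)
  then show ?thesis by (simp add: orthogonal_comp_self[OF S])
qed

text \<open>The bracket is the velocity at 0 of the path exp (t X) Y exp (- t X) in the Lie
  algebra.\<close>

lemma lie_algebra_bracket:
  fixes G :: "'n::finite cmat set"
  assumes G: "compact_lie_group G" and X: "X \<in> lie_algebra G" and Y: "Y \<in> lie_algebra G"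
  shows "bracket X Y \<in> lie_algebra G"
proof (rule has_vector_derivative_in_subspace[OF subspace_lie_algebra[OF G], where a=0 and b=1 and t=0])
  show "((\<lambda>t. mexp (t *\<^sub>R X) ** Y ** mexp (- (t *\<^sub>R X))) has_vector_derivative bracket X Y) (at 0 within {0..1})"
    using has_vector_derivative_mmul[OF has_vector_derivative_mmul_const(1)[OF mexp_has_vector_derivative_left[of X 0 "{0..1}"], of Y]
        mexp_neg_has_vector_derivative_right[of X 0 "{0..1}"]] by (simp add: bracket_def mmul_simps)
  show "mexp (s *\<^sub>R X) ** Y ** mexp (- (s *\<^sub>R X)) \<in> lie_algebra G" for s
    using lie_algebra_Ad[of G "mexp (s *\<^sub>R X)" Y] G lie_algebra_mexp X Y by (auto simp: compact_lie_group_def)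
qed auto

text \<open>Cartan's closed subgroup theorem. If group elements near 1 were missed, write them as
  \<open>mexp X ** mexp Y\<close> with \<open>X\<close> in the Lie algebra and \<open>Y \<noteq> 0\<close> orthogonal to it; a limit of the
  normalized \<open>Y\<close> would lie in the Lie algebra.\<close>

theorem closed_subgroup:
  fixes G :: "'n::finite cmat set"
  assumes G: "compact_lie_group G"
  obtains e where "e > 0" "\<And>g. g \<in> G \<Longrightarrow> norm (g - mat 1) < e \<Longrightarrow> \<exists>X\<in>lie_algebra G. g = mexp X"
proof (rule ccontr)
  note that' = that
  assume "\<not> thesis"
  then have bad: "\<exists>g. g \<in> G \<and> norm (g - mat 1) < e \<and> (\<forall>X\<in>lie_algebra G. g \<noteq> mexp X)" if "e > 0" for e
    using that that' by blast
  have grp: "matrix_group G" and cmp: "compact G" using G by (auto simp: compact_lie_group_def)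
  note sub = subspace_lie_algebra[OF G]
  obtain B where B: "B \<subseteq> lie_algebra G" "pairwise orthogonal B" "\<And>x. x \<in> B \<Longrightarrow> norm x = 1"
    "independent B" "span B = lie_algebra G"
    using orthonormal_basis_subspace[OF sub] by metis
  have fin: "finite B" using B(4) independent_imp_finite by blast
  \<comment> \<open>The orthogonal projection onto the Lie algebra, written in an orthonormal
    basis.\<close>
  define P where "P Z = (\<Sum>b\<in>B. (Z \<bullet> b) *\<^sub>R b)" for Z
  have linP: "linear P" unfolding P_def by (intro linearI) (simp_all add: inner_add_left scaleR_left_distrib sum.distrib scaleR_sum_right)
  have PL: "P Z \<in> lie_algebra G" for Z
    unfolding P_def using B(1) by (intro subspace_sum[OF sub] subspace_scale[OF sub]) auto
  have orth: "(Z - P Z) \<bullet> x = 0" if x: "x \<in> lie_algebra G" for Z x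
  proof -
    have "(Z - P Z) \<bullet> b = 0" if b: "b \<in> B" for b
    proof -
      have "P Z \<bullet> b = (\<Sum>c\<in>B. (Z \<bullet> c) * (c \<bullet> b))" by (simp add: P_def inner_sum_left)
      also have "\<dots> = (\<Sum>c\<in>B. if c = b then Z \<bullet> b else 0)"
        using B(2,3) b by (intro sum.cong) (auto simp: pairwise_def orthogonal_def dot_square_norm)
      finally show ?thesis using b fin by (simp add: inner_diff_left)
    qed
    then have "span B \<subseteq> {x. (Z - P Z) \<bullet> x = 0}"
      by (intro span_minimal) (auto simp: subspace_def inner_add_right)
    then show ?thesis using x B(5) by blast
  qed
  define F where "F Z = mexp (P Z) ** mexp (Z - P Z)" for Z
  have blP: "bounded_linear P" using linP by (simp add: linear_conv_bounded_linear)
  have contP: "continuous_on S P" for S by (rule linear_continuous_on[OF blP])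
  have F_cont: "continuous_on UNIV F"
    unfolding F_def by (intro continuous_intros contP)
  have mexp_der: "(mexp has_derivative (\<lambda>h. h)) (at (0 :: 'n cmat))"
    unfolding has_derivative_at_alt
  proof (intro conjI allI impI)
    fix e :: real assume e: "e > 0"
    obtain C where C: "\<And>Y :: 'n cmat. norm Y \<le> 1 \<Longrightarrow> norm (mexp Y - mat 1 - Y) \<le> C * (norm Y)\<^sup>2"
      using mexp_taylor by blast
    show "\<exists>d>0. \<forall>y :: 'n cmat. norm (y - 0) < d \<longrightarrow> norm (mexp y - mexp 0 - (y - 0)) \<le> e * norm (y - 0)"
    proof (intro exI conjI allI impI)
      show "min 1 (e / (\<bar>C\<bar> + 1)) > 0" using e by simp
      fix y :: "'n cmat" assume y: "norm (y - 0) < min 1 (e / (\<bar>C\<bar> + 1))"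
      have "C * (norm y)\<^sup>2 \<le> (\<bar>C\<bar> + 1) * norm y * norm y"
        by (simp add: power2_eq_square mult_right_mono mult.assoc)
      also have "\<dots> \<le> e * norm y" using y by (intro mult_right_mono) (auto simp: field_simps)
      finally show "norm (mexp y - mexp 0 - (y - 0)) \<le> e * norm (y - 0)" using C[of y] y by simp
    qed
  qed simp
  have F_der: "(F has_derivative id) (at 0)"
  proof -
    have P0: "P 0 = 0" by (rule linear_0[OF linP])
    have 1: "((\<lambda>Z. mexp (P Z)) has_derivative P) (at 0)"
      using diff_chain_at[OF bounded_linear_imp_has_derivative[OF blP, of "at 0"], of mexp "\<lambda>h. h"] mexp_der P0 by (simp add: o_def)
    have "((\<lambda>Z. Z - P Z) has_derivative (\<lambda>Z. Z - P Z)) (at 0)"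
      by (intro derivative_intros bounded_linear_imp_has_derivative[OF blP])
    then have 2: "((\<lambda>Z. mexp (Z - P Z)) has_derivative (\<lambda>Z. Z - P Z)) (at 0)"
      using diff_chain_at[of "\<lambda>Z. Z - P Z" _ 0 mexp "\<lambda>h. h"] mexp_der P0 by (simp add: o_def)
    show ?thesis
      using bounded_bilinear.FDERIV[OF bounded_bilinear_cmat_mult 1 2] by (simp add: F_def[abs_def] P0 id_def)
  qed
  have F0: "F 0 = mat 1" by (simp add: F_def linear_0[OF linP])
  have near: "\<exists>e>0. \<forall>g. norm (g - mat 1) < e \<longrightarrow> (\<exists>Z. norm Z < d \<and> F Z = g)" if d: "d > 0" for d
  proof -
    \<comment> \<open>\<open>F\<close> is continuous and its derivative at 0 is the identity; the
      open mapping theorem at a point of differentiability then shows that \<open>F\<close> covers a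
      neighbourhood of 1.\<close>
    have "F 0 \<in> interior (F ` ball 0 d)"
      by (rule sussmann_open_mapping[OF open_UNIV F_cont _ F_der, of id]) (use d in \<open>auto simp: interior_open bounded_linear_ident id_def\<close>)
    then obtain e where "e > 0" "ball (mat 1) e \<subseteq> F ` ball 0 d" unfolding F0 mem_interior by blast
    then show ?thesis by (auto simp: subset_iff image_iff dist_norm norm_minus_commute intro!: exI[of _ e]) (metis dist_0_norm dist_norm norm_minus_commute mem_ball)
  qed
  have "\<exists>Y. Y \<noteq> 0 \<and> norm Y < d \<and> mexp Y \<in> G \<and> (\<forall>x\<in>lie_algebra G. Y \<bullet> x = 0)" if d: "d > 0" for d
  proof -
    obtain d' where d': "d' > 0" "\<And>Z. norm Z < d' \<Longrightarrow> norm (Z - P Z) < d"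
    proof -
      have "isCont (\<lambda>Z. Z - P Z) 0"
        using contP[of UNIV] by (intro continuous_intros) (auto simp: continuous_on_eq_continuous_at)
      then show ?thesis using that d by (auto simp: continuous_at_eps_delta dist_norm linear_0[OF linP])
    qed
    obtain e where e: "e > 0" "\<And>g. norm (g - mat 1) < e \<Longrightarrow> \<exists>Z. norm Z < d' \<and> F Z = g" using near[OF d'(1)] by blast
    obtain g where g: "g \<in> G" "norm (g - mat 1) < e" "\<And>X. X \<in> lie_algebra G \<Longrightarrow> g \<noteq> mexp X" using bad[OF e(1)] by blast
    obtain Z where Z: "norm Z < d'" "F Z = g" using e(2)[OF g(2)] by blast
    have "mexp (Z - P Z) = mexp (- P Z) ** g" using Z(2) by (auto simp: F_def matrix_mul_assoc)
    moreover have "mexp (- P Z) \<in> G" using lie_algebra_mexp(1)[OF PL, of "-1" Z] by simp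
    ultimately have "mexp (Z - P Z) \<in> G" using grp g by (simp add: matrix_group_def)
    moreover have "Z - P Z \<noteq> 0" using Z(2) g(3)[OF PL, of Z] by (auto simp: F_def)
    ultimately show ?thesis using d'(2)[OF Z(1)] orth by blast
  qed
  then have "\<forall>n. \<exists>Y. Y \<noteq> 0 \<and> norm Y < 1 / real (Suc n) \<and> mexp Y \<in> G \<and> (\<forall>x\<in>lie_algebra G. Y \<bullet> x = 0)" by simp
  then obtain Y where Y: "\<And>n. Y n \<noteq> 0" "\<And>n. norm (Y n) < 1 / real (Suc n)" "\<And>n. mexp (Y n) \<in> G"
      "\<And>n x. x \<in> lie_algebra G \<Longrightarrow> Y n \<bullet> x = 0"
    by metis
  have "\<forall>n. (1 / norm (Y n)) *\<^sub>R Y n \<in> sphere 0 1" using Y(1) by simp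
  then obtain U \<sigma> where U: "U \<in> sphere 0 1" "strict_mono (\<sigma> :: nat \<Rightarrow> nat)" "((\<lambda>n. (1 / norm (Y n)) *\<^sub>R Y n) \<circ> \<sigma>) \<longlonglongrightarrow> U"
    by (rule seq_compactE[OF compact_imp_seq_compact[OF compact_sphere]])
  define W where "W n = Y (\<sigma> n)" for n
  have W0: "W n \<noteq> 0" for n using Y(1) by (simp add: W_def)
  have WU: "(\<lambda>n. (1 / norm (W n)) *\<^sub>R W n) \<longlonglongrightarrow> U" using U(3) by (simp add: W_def o_def)
  have Wlim: "(\<lambda>n. norm (W n)) \<longlonglongrightarrow> 0"
  proof (rule Lim_null_comparison)
    show "eventually (\<lambda>n. norm (norm (W n)) \<le> 1 / real (Suc n)) sequentially"
    proof (rule always_eventually, rule allI)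
      fix n
      have "norm (W n) \<le> 1 / real (Suc (\<sigma> n))" using Y(2)[of "\<sigma> n"] by (simp add: W_def)
      also have "\<dots> \<le> 1 / real (Suc n)" using seq_suble[OF U(2), of n] by (simp add: frac_le)
      finally show "norm (norm (W n)) \<le> 1 / real (Suc n)" by simp
    qed
    show "(\<lambda>n. 1 / real (Suc n)) \<longlonglongrightarrow> 0" using LIMSEQ_inverse_real_of_nat by (simp add: inverse_eq_divide)
  qed
  have "U \<in> lie_algebra G"
  proof (rule lie_algebraI_sequence[OF G])
    show "mexp (W n) \<in> G" for n using Y(3) by (simp add: W_def)
    have "filterlim (\<lambda>n. norm (W n)) (at_right 0) sequentially"
      using Wlim W0 by (simp add: filterlim_at)
    then show "filterlim (\<lambda>n. inverse (norm (W n))) at_top sequentially"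
      by (rule filterlim_compose[OF filterlim_inverse_at_top_right])
    obtain C where C: "\<And>Y :: 'n cmat. norm Y \<le> 1 \<Longrightarrow> norm (mexp Y - mat 1 - Y) \<le> C * (norm Y)\<^sup>2"
      using mexp_taylor by blast
    have "(\<lambda>n. inverse (norm (W n)) *\<^sub>R (mexp (W n) - mat 1 - W n)) \<longlonglongrightarrow> 0"
    proof (rule Lim_null_comparison)
      have "eventually (\<lambda>n. norm (W n) < 1) sequentially" by (rule order_tendstoD(2)[OF Wlim]) simp
      then show "eventually (\<lambda>n. norm (inverse (norm (W n)) *\<^sub>R (mexp (W n) - mat 1 - W n)) \<le> C * norm (W n)) sequentially"
      proof eventually_elim
        case (elim n)
        have "norm (inverse (norm (W n)) *\<^sub>R (mexp (W n) - mat 1 - W n)) \<le> inverse (norm (W n)) * (C * (norm (W n))\<^sup>2)"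
          using C[of "W n"] elim by (simp add: mult_left_mono)
        also have "\<dots> = C * norm (W n)" using W0[of n] by (simp add: power2_eq_square)
        finally show ?case .
      qed
      show "(\<lambda>n. C * norm (W n)) \<longlonglongrightarrow> 0" using tendsto_mult_right_zero[OF Wlim] by simp
    qed
    from tendsto_add[OF this WU] show "(\<lambda>n. inverse (norm (W n)) *\<^sub>R (mexp (W n) - mat 1)) \<longlonglongrightarrow> U"
      by (simp add: algebra_simps inverse_eq_divide)
  qed
  \<comment> \<open>Orthogonality to the Lie algebra survives in the limit, so the unit vector U
    would be orthogonal to itself.\<close>
  moreover have "U \<bullet> x = 0" if "x \<in> lie_algebra G" for x
  proof -
    have "(\<lambda>n. (1 / norm (W n)) *\<^sub>R W n \<bullet> x) \<longlonglongrightarrow> U \<bullet> x" by (intro tendsto_intros WU)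
    then have "(\<lambda>n. 0) \<longlonglongrightarrow> U \<bullet> x" using Y(4)[OF that] by (simp add: W_def)
    then show ?thesis by (simp add: LIMSEQ_const_iff)
  qed
  ultimately have "U \<bullet> U = 0" by blast
  then show False using U(1) by simp
qed

section \<open>Smooth paths\<close>

lemma has_vector_derivative_imp_continuous_on:
  "(\<And>t. t \<in> S \<Longrightarrow> (f has_vector_derivative f' t) (at t within S)) \<Longrightarrow> continuous_on S f"
  by (auto simp: continuous_on_eq_continuous_within intro: has_vector_derivative_continuous)

lemma Ck_unit_0: "Ck_unit 0 f \<longleftrightarrow> continuous_on {0..1} f"
proof
  assume "Ck_unit 0 f"
  then obtain D where "\<forall>t\<in>{0..1}. D 0 t = f t" "continuous_on {0..1} (D (0::nat))" unfolding Ck_unit_def by blast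
  then show "continuous_on {0..1} f" using continuous_on_cong[of "{0..1}" "{0..1}" "D 0" f] by simp
next
  assume "continuous_on {0..1} f"
  then show "Ck_unit 0 f" unfolding Ck_unit_def by (intro exI[of _ "\<lambda>_. f"]) simp
qed

text \<open>Turns the sequence of derivatives into a recursion on k, the form in which all closure
  properties are proved.\<close>

lemma Ck_unit_Suc:
  "Ck_unit (Suc k) f \<longleftrightarrow>
   (\<exists>f'. (\<forall>t\<in>{0..1}. (f has_vector_derivative f' t) (at t within {0..1})) \<and> Ck_unit k f')"
proof
  assume "Ck_unit (Suc k) f"
  then obtain D where D: "\<forall>t\<in>{0..1}. D 0 t = f t" "continuous_on {0..1} (D (Suc k))"
    "\<forall>j<Suc k. \<forall>t\<in>{0..1}. (D j has_vector_derivative D (Suc j) t) (at t within {0..1})" unfolding Ck_unit_def by blast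
  have "(f has_vector_derivative D 1 t) (at t within {0..1})" if "t \<in> {0..1}" for t
    by (rule has_vector_derivative_transform[of _ _ _ "D 0"]) (use D(1,3) that in auto)
  moreover have "Ck_unit k (D 1)"
    unfolding Ck_unit_def by (rule exI[of _ "\<lambda>j. D (Suc j)"]) (use D in auto)
  ultimately show "\<exists>f'. (\<forall>t\<in>{0..1}. (f has_vector_derivative f' t) (at t within {0..1})) \<and> Ck_unit k f'" by blast
next
  assume "\<exists>f'. (\<forall>t\<in>{0..1}. (f has_vector_derivative f' t) (at t within {0..1})) \<and> Ck_unit k f'"
  then obtain f' D where f': "\<forall>t\<in>{0..1}. (f has_vector_derivative f' t) (at t within {0..1})"
    and D: "\<forall>t\<in>{0..1}. D 0 t = f' t" "continuous_on {0..1} (D k)"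
    "\<forall>j<k. \<forall>t\<in>{0..1}. (D j has_vector_derivative D (Suc j) t) (at t within {0..1})" unfolding Ck_unit_def by blast
  show "Ck_unit (Suc k) f"
    unfolding Ck_unit_def
  proof (intro exI[of _ "case_nat f D"] conjI ballI allI impI)
    fix j t assume "j < Suc k" "t \<in> {0..1::real}"
    then show "((case_nat f D) j has_vector_derivative (case_nat f D) (Suc j) t) (at t within {0..1})"
      using f' D by (cases j) auto
  qed (use D in auto)
qed

lemma Ck_unit_cong: "(\<And>t. t \<in> {0..1} \<Longrightarrow> f t = g t) \<Longrightarrow> Ck_unit k f \<longleftrightarrow> Ck_unit k g"
proof -
  assume "\<And>t. t \<in> {0..1} \<Longrightarrow> f t = g t"
  then have "(\<forall>t\<in>{0..1}. D t = f t) \<longleftrightarrow> (\<forall>t\<in>{0..1}. D t = g t)" for D by auto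
  then show ?thesis unfolding Ck_unit_def by presburger
qed

lemma Ck_unit_Suc_imp: "Ck_unit (Suc k) f \<Longrightarrow> Ck_unit k f"
proof (induction k arbitrary: f)
  case 0
  then show ?case
    unfolding Ck_unit_0 Ck_unit_Suc using has_vector_derivative_imp_continuous_on by blast
next
  case (Suc k)
  from Suc.prems obtain f' where "\<forall>t\<in>{0..1}. (f has_vector_derivative f' t) (at t within {0..1})" "Ck_unit (Suc k) f'"
    by (subst (asm) Ck_unit_Suc) blast
  then show ?case using Suc.IH[of f'] by (subst Ck_unit_Suc) (rule exI[of _ f'], simp)
qed

lemma Ck_unit_const: "Ck_unit k (\<lambda>_. c)"
proof (induction k arbitrary: c)
  case (Suc k)
  show ?case unfolding Ck_unit_Suc by (rule exI[of _ "\<lambda>_. 0"]) (simp add: Suc)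
qed (simp add: Ck_unit_0)

lemma Ck_unit_add: "Ck_unit k f \<Longrightarrow> Ck_unit k g \<Longrightarrow> Ck_unit k (\<lambda>t. f t + g t)"
proof (induction k arbitrary: f g)
  case (Suc k)
  then obtain f' g' where "\<forall>t\<in>{0..1}. (f has_vector_derivative f' t) (at t within {0..1})" "Ck_unit k f'"
    "\<forall>t\<in>{0..1}. (g has_vector_derivative g' t) (at t within {0..1})" "Ck_unit k g'"
    unfolding Ck_unit_Suc by blast
  then show ?case unfolding Ck_unit_Suc
    by (intro exI[of _ "\<lambda>t. f' t + g' t"] conjI ballI has_vector_derivative_add Suc.IH) auto
qed (simp add: Ck_unit_0 continuous_on_add)

lemma Ck_unit_linear: "bounded_linear L \<Longrightarrow> Ck_unit k f \<Longrightarrow> Ck_unit k (\<lambda>t. L (f t))"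
proof (induction k arbitrary: f)
  case (Suc k)
  then obtain f' where "\<forall>t\<in>{0..1}. (f has_vector_derivative f' t) (at t within {0..1})" "Ck_unit k f'"
    unfolding Ck_unit_Suc by blast
  then show ?case unfolding Ck_unit_Suc
    by (intro exI[of _ "\<lambda>t. L (f' t)"] conjI ballI bounded_linear.has_vector_derivative[OF Suc.prems(1)] Suc.IH[OF Suc.prems(1)]) auto
qed (simp add: Ck_unit_0 bounded_linear.continuous_on)

lemma Ck_unit_bilinear:
  "bounded_bilinear B \<Longrightarrow> Ck_unit k f \<Longrightarrow> Ck_unit k g \<Longrightarrow> Ck_unit k (\<lambda>t. B (f t) (g t))"
proof (induction k arbitrary: f g)
  case (Suc k)
  then obtain f' g' where "\<forall>t\<in>{0..1}. (f has_vector_derivative f' t) (at t within {0..1})" "Ck_unit k f'"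
    "\<forall>t\<in>{0..1}. (g has_vector_derivative g' t) (at t within {0..1})" "Ck_unit k g'"
    unfolding Ck_unit_Suc by blast
  note fg = this
  have "Ck_unit k f" "Ck_unit k g" using Suc.prems Ck_unit_Suc_imp by blast+
  then have "Ck_unit k (\<lambda>t. B (f t) (g' t) + B (f' t) (g t))"
    by (intro Ck_unit_add Suc.IH[OF Suc.prems(1)] fg)
  then show ?case unfolding Ck_unit_Suc using fg(1,3)
    by (intro exI[of _ "\<lambda>t. B (f t) (g' t) + B (f' t) (g t)"])
      (auto intro!: bounded_bilinear.has_vector_derivative[OF Suc.prems(1)])
qed (simp add: Ck_unit_0 bounded_bilinear.continuous_on)

lemma Ck_unit_diff: "Ck_unit k f \<Longrightarrow> Ck_unit k g \<Longrightarrow> Ck_unit k (\<lambda>t. f t - g t)"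
  using Ck_unit_add[of k f "\<lambda>t. - g t"] Ck_unit_linear[OF bounded_linear_minus[OF bounded_linear_ident], of k g] by simp

lemma Ck_unit_scaleR: "Ck_unit k f \<Longrightarrow> Ck_unit k (\<lambda>t. c *\<^sub>R f t)"
  by (rule Ck_unit_linear[OF bounded_linear_scaleR_right])

lemma Ck_unit_mmul:
  fixes f g :: "real \<Rightarrow> 'n::finite cmat"
  shows "Ck_unit k f \<Longrightarrow> Ck_unit k g \<Longrightarrow> Ck_unit k (\<lambda>t. f t ** g t)"
  by (rule Ck_unit_bilinear[OF bounded_bilinear_cmat_mult])

text \<open>Bootstrapping for solutions of differential equations: if the right-hand side inherits
  the regularity of f, every order of differentiability yields the next.\<close>

lemma smooth_unitI:
  assumes f: "\<And>t. t \<in> {0..1} \<Longrightarrow> (f has_vector_derivative f' t) (at t within {0..1})"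
    and step: "\<And>k. Ck_unit k f \<Longrightarrow> Ck_unit k f'"
  shows "smooth_unit f"
proof -
  have "Ck_unit k f" for k
  proof (induction k)
    case 0
    show ?case unfolding Ck_unit_0 by (rule has_vector_derivative_imp_continuous_on[where f'=f']) (rule f)
  next
    case (Suc k)
    show ?case unfolding Ck_unit_Suc by (rule exI[of _ f']) (simp add: f step[OF Suc])
  qed
  then show ?thesis by (simp add: smooth_unit_def)
qed

text \<open>Each k comes with its own sequence of derivatives. Uniqueness of derivatives on the
  interval identifies their first members, so a single f' serves all k.\<close>

lemma smooth_unit_derivative:
  assumes "smooth_unit f"
  obtains f' where "\<And>t. t \<in> {0..1} \<Longrightarrow> (f has_vector_derivative f' t) (at t within {0..1})"
    "\<And>t. t \<in> {0..1} \<Longrightarrow> vector_derivative f (at t within {0..1}) = f' t" "smooth_unit f'"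
proof -
  have "Ck_unit (Suc 0) f" using assms by (simp add: smooth_unit_def)
  then obtain f' where f': "\<And>t. t \<in> {0..1} \<Longrightarrow> (f has_vector_derivative f' t) (at t within {0..1})"
    unfolding Ck_unit_Suc by blast
  have eq: "vector_derivative f (at t within {0..1}) = g t"
    if "\<And>t. t \<in> {0..1} \<Longrightarrow> (f has_vector_derivative g t) (at t within {0..1})" "t \<in> {0..1}" for g t
    using vector_derivative_within_cbox[of 0 1 t f "g t"] that by simp
  have "Ck_unit k f'" for k
  proof -
    have "Ck_unit (Suc k) f" using assms by (simp add: smooth_unit_def)
    then obtain g where g: "\<And>t. t \<in> {0..1} \<Longrightarrow> (f has_vector_derivative g t) (at t within {0..1})" "Ck_unit k g"
      unfolding Ck_unit_Suc by blast
    have "g t = f' t" if "t \<in> {0..1}" for t using eq[OF g(1) that] eq[OF f' that] by simp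
    then show ?thesis using g(2) Ck_unit_cong by blast
  qed
  then show ?thesis using that[of f'] f' eq[OF f'] by (auto simp: smooth_unit_def)
qed

lemma vector_derivative_unit:
  assumes "(f has_vector_derivative d) (at t within {0..1})" "t \<in> {0..1::real}"
  shows "vector_derivative f (at t within {0..1}) = d"
  using vector_derivative_within_cbox[of 0 1 t f d] assms by simp

lemma smooth_unit_mmul:
  fixes f g :: "real \<Rightarrow> 'n::finite cmat"
  shows "smooth_unit f \<Longrightarrow> smooth_unit g \<Longrightarrow> smooth_unit (\<lambda>t. f t ** g t)"
  unfolding smooth_unit_def using Ck_unit_mmul by blast

lemma smooth_unit_mexp: "smooth_unit (\<lambda>t. mexp (t *\<^sub>R (A :: 'n::finite cmat)))"
  by (rule smooth_unitI[OF mexp_has_vector_derivative_left]) (intro Ck_unit_mmul Ck_unit_const)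

text \<open>The endpoints of smooth paths in \<open>G\<close> issuing from 1 form an open and closed subset: nearby
  elements differ by an exponential, and paths are multiplied pointwise.\<close>

theorem smooth_path_in_connected_group:
  fixes G :: "'n::finite cmat set"
  assumes G: "compact_lie_group G" and con: "connected G" and k: "k \<in> G"
  obtains v where "smooth_unit v" "\<And>t. t \<in> {0..1} \<Longrightarrow> v t \<in> G" "v 0 = mat 1" "v 1 = k"
proof -
  have grp: "matrix_group G" and cmp: "compact G" using G by (auto simp: compact_lie_group_def)
  define E where "E = {k \<in> G. \<exists>v. smooth_unit v \<and> (\<forall>t\<in>{0..1}. v t \<in> G) \<and> v 0 = mat 1 \<and> v 1 = k}"
  obtain K where K: "K \<ge> 1" "\<And>(A :: 'n cmat) (B :: 'n cmat). norm (A ** B) \<le> K * norm A * norm B"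
    using mmul_norm_bound by blast
  obtain M where M: "M > 0" "\<And>g. g \<in> G \<Longrightarrow> norm g \<le> M" using compact_imp_bounded[OF cmp] unfolding bounded_pos by blast
  obtain e where e: "e > 0" "\<And>g. g \<in> G \<Longrightarrow> norm (g - mat 1) < e \<Longrightarrow> \<exists>X\<in>lie_algebra G. g = mexp X"
    using closed_subgroup[OF G] by blast
  \<comment> \<open>With K and M the bounds for products and for G, being d-close to h puts
    \<open>matrix_inv h ** g\<close> within e of 1, where every element of G is an
    exponential.\<close>
  define d where "d = e / (K * M)"
  have d: "d > 0" using e K(1) M by (simp add: d_def)
  have near: "g \<in> E" if h: "h \<in> E" and g: "g \<in> G" and gh: "norm (g - h) < d" for g h
  proof -
    obtain v where v: "smooth_unit v" "\<forall>t\<in>{0..1}. v t \<in> G" "v 0 = mat 1" "v 1 = h" and hG: "h \<in> G"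
      using h by (auto simp: E_def)
    have inv: "invertible h" and hi: "matrix_inv h \<in> G" using hG grp by (auto simp: matrix_group_def)
    have "norm (matrix_inv h ** g - mat 1) = norm (matrix_inv h ** (g - h))"
      by (simp add: mmul_simps matrix_inv_mult[OF inv])
    also have "\<dots> \<le> K * norm (matrix_inv h) * norm (g - h)" by (rule K)
    also have "\<dots> \<le> K * M * norm (g - h)" using M(2)[OF hi] K(1) by (intro mult_right_mono mult_left_mono) auto
    also have "\<dots> < e" using gh K(1) M(1) by (simp add: d_def field_simps)
    finally obtain X where X: "X \<in> lie_algebra G" "matrix_inv h ** g = mexp X"
      using e(2)[of "matrix_inv h ** g"] hi g grp by (auto simp: matrix_group_def)
    have "h ** mexp X = g" using X(2)[symmetric] by (simp add: matrix_mul_assoc matrix_inv_mult[OF inv])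
    moreover have "v t ** mexp (t *\<^sub>R X) \<in> G" if "t \<in> {0..1}" for t
      using v(2) that lie_algebra_mexp(1)[OF X(1), of t] grp by (auto simp: matrix_group_def)
    ultimately show ?thesis
      using g v smooth_unit_mmul[OF v(1) smooth_unit_mexp[of X]]
      unfolding E_def by (auto intro!: exI[of _ "\<lambda>t. v t ** mexp (t *\<^sub>R X)"])
  qed
  have "openin (top_of_set G) E"
    unfolding openin_euclidean_subtopology_iff
  proof (intro conjI ballI)
    show "E \<subseteq> G" by (auto simp: E_def)
    show "\<exists>e>0. \<forall>g\<in>G. dist g h < e \<longrightarrow> g \<in> E" if "h \<in> E" for h
      using near[OF that] d by (intro exI[of _ d]) (simp add: dist_norm)
  qed
  moreover have "closedin (top_of_set G) E"
  proof -
    have "openin (top_of_set G) (G - E)"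
      unfolding openin_euclidean_subtopology_iff
    proof (intro conjI ballI)
      show "\<exists>e>0. \<forall>g\<in>G. dist g h < e \<longrightarrow> g \<in> G - E" if h: "h \<in> G - E" for h
      proof (intro exI[of _ d] conjI ballI impI d)
        fix g assume "g \<in> G" "dist g h < d"
        then show "g \<in> G - E" using h near[of g h] by (auto simp: dist_norm norm_minus_commute)
      qed
    qed auto
    then show ?thesis by (auto simp: closedin_def E_def)
  qed
  moreover have "mat 1 \<in> E"
    using grp unfolding E_def matrix_group_def
    by (auto intro!: exI[of _ "\<lambda>_. mat 1"] simp: smooth_unit_def Ck_unit_const)
  ultimately have "E = G" using con unfolding connected_clopen by blast
  then have "k \<in> E" using k by simp
  then show ?thesis unfolding E_def using that by blast
qed

section \<open>An invariant adjoint\<close>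

definition cadj :: "'n::finite cmat \<Rightarrow> 'n cmat" where
  "cadj A = map_matrix cnj (transpose A)"

lemma cadj_nth: "cadj A $ i $ j = cnj (A $ j $ i)"
  by (simp add: cadj_def transpose_def map_matrix_def)

lemma cadj_mult: "cadj (A ** B) = cadj B ** cadj A"
  by (simp add: vec_eq_iff cadj_nth matrix_matrix_mult_def mult.commute)

lemma cadj_cadj [simp]: "cadj (cadj A) = A"
  by (simp add: vec_eq_iff cadj_nth)

lemma cadj_one [simp]: "cadj (mat 1) = mat 1"
  by (simp add: vec_eq_iff cadj_nth mat_def)

lemma linear_cadj: "linear cadj"
  by (rule linearI) (simp_all add: vec_eq_iff cadj_nth)

lemma bounded_linear_cadj: "bounded_linear (cadj :: 'n::finite cmat \<Rightarrow> 'n cmat)"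
  using linear_cadj by (simp add: linear_conv_bounded_linear)

lemmas cadj_add = linear_add[OF linear_cadj] and cadj_scaleR = linear_scale[OF linear_cadj]

definition hform :: "'n::finite cmat \<Rightarrow> complex^'n \<Rightarrow> complex^'n \<Rightarrow> complex" where
  "hform P x y = (\<Sum>i\<in>UNIV. \<Sum>j\<in>UNIV. cnj (x $ i) * P $ i $ j * y $ j)"

lemma hform_add: "hform P x (y + z) = hform P x y + hform P x z"
  by (simp add: hform_def algebra_simps sum.distrib)

lemma hform_diff: "hform P x (y - z) = hform P x y - hform P x z"
  by (simp add: hform_def algebra_simps sum_subtractf)

lemma hform_smult: "hform P x (c *s y) = c * hform P x y"
  by (simp add: hform_def sum_distrib_left mult_ac)

lemma hform_sum: "hform P x (\<Sum>i\<in>I. f i) = (\<Sum>i\<in>I. hform P x (f i))"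
  by (induction I rule: infinite_finite_induct) (simp_all add: hform_add, simp_all add: hform_def)

lemma hform_cnj: "cadj P = P \<Longrightarrow> cnj (hform P x y) = hform P y x"
proof -
  assume P: "cadj P = P"
  have "cnj (P $ i $ j) = P $ j $ i" for i j by (metis P cadj_nth)
  then show ?thesis
    unfolding hform_def by (subst sum.swap) (simp add: mult_ac)
qed

definition posdef :: "'n::finite cmat \<Rightarrow> bool" where
  "posdef P \<longleftrightarrow> cadj P = P \<and> (\<forall>x. x \<noteq> 0 \<longrightarrow> 0 < Re (hform P x x))"

lemma posdef_gram:
  fixes g :: "'n::finite cmat"
  assumes "invertible g"
  shows "posdef (cadj g ** g)"
proof -
  have "Re (hform (cadj g ** g) x x) = (\<Sum>k\<in>UNIV. (cmod ((g *v x) $ k))\<^sup>2)" for x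
  proof -
    have "hform (cadj g ** g) x x = (\<Sum>k\<in>UNIV. cnj ((g *v x) $ k) * (g *v x) $ k)"
    proof -
      have "hform (cadj g ** g) x x = (\<Sum>i\<in>UNIV. \<Sum>j\<in>UNIV. \<Sum>k\<in>UNIV. cnj (g $ k $ i * x $ i) * (g $ k $ j * x $ j))"
        by (simp add: hform_def matrix_matrix_mult_def cadj_nth sum_distrib_left sum_distrib_right mult_ac)
      also have "\<dots> = (\<Sum>k\<in>UNIV. \<Sum>i\<in>UNIV. \<Sum>j\<in>UNIV. cnj (g $ k $ i * x $ i) * (g $ k $ j * x $ j))"
        by (subst sum.swap, subst (2) sum.swap, subst sum.swap) (rule sum.cong[OF refl], rule sum.swap)
      also have "\<dots> = (\<Sum>k\<in>UNIV. cnj ((g *v x) $ k) * (g *v x) $ k)"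
        by (simp add: matrix_vector_mult_def sum_product cnj_sum)
      finally show ?thesis .
    qed
    then show ?thesis by (simp add: complex_norm_square[symmetric] mult.commute)
  qed
  moreover have "(\<Sum>k\<in>UNIV. (cmod ((g *v x) $ k))\<^sup>2) > 0" if "x \<noteq> 0" for x
  proof -
    have "g *v x \<noteq> 0"
      using that assms by (metis inj_matrix_vector_mult injD matrix_vector_mult_0_right)
    then obtain k where "(g *v x) $ k \<noteq> 0" by (auto simp: vec_eq_iff)
    then show ?thesis by (intro sum_pos2[of _ k]) auto
  qed
  ultimately show ?thesis by (simp add: posdef_def cadj_mult)
qed

lemma convex_posdef: "convex {P :: 'n::finite cmat. posdef P}"
proof (rule convexI)
  fix P Q :: "'n cmat" and u v :: real assume PQ: "P \<in> {P. posdef P}" "Q \<in> {P. posdef P}" and uv: "0 \<le> u" "0 \<le> v" "u + v = 1"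
  have "hform (u *\<^sub>R P + v *\<^sub>R Q) x y = u *\<^sub>R hform P x y + v *\<^sub>R hform Q x y" for x y
    by (simp add: hform_def algebra_simps sum.distrib scaleR_sum_right)
  moreover have "0 < u * a + v * b" if "0 < a" "0 < b" for a b
    using uv that by (metis add.commute add_nonneg_pos add_pos_nonneg less_eq_real_def mult_nonneg_nonneg mult_pos_pos mult_zero_left zero_neq_one add_0)
  ultimately show "u *\<^sub>R P + v *\<^sub>R Q \<in> {P. posdef P}"
    using PQ by (simp add: posdef_def cadj_add cadj_scaleR)
qed

text \<open>The invariant form is the unique minimizer, on the convex hull of the \<open>g\<^sup>*g\<close>, of the strictly
  convex \<open>G\<close>-invariant function \<open>P \<mapsto> max {norm (g\<^sup>*Pg) | g \<in> G}\<close>.\<close>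

theorem invariant_posdef:
  fixes G :: "'n::finite cmat set"
  assumes G: "compact_lie_group G"
  obtains P where "posdef P" "\<And>g. g \<in> G \<Longrightarrow> cadj g ** P ** g = P"
proof -
  have grp: "matrix_group G" and cmp: "compact G" using G by (auto simp: compact_lie_group_def)
  have one: "mat 1 \<in> G" and G_mult: "\<And>g h. g \<in> G \<Longrightarrow> h \<in> G \<Longrightarrow> g ** h \<in> G"
    and G_inv: "\<And>g. g \<in> G \<Longrightarrow> invertible g" using grp by (auto simp: matrix_group_def)
  define act where "act g P = cadj g ** P ** g" for g P :: "'n cmat"
  have act_lin: "linear (act g)" for g unfolding act_def by (rule linearI) (simp_all add: mmul_simps)
  have act_act: "act g (act h P) = act (h ** g) P" for g h P
    by (simp add: act_def cadj_mult matrix_mul_assoc)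
  define K where "K = convex hull ((\<lambda>g. act g (mat 1)) ` G)"
  have cadj_cont: "continuous_on S cadj" for S :: "'n cmat set" by (rule linear_continuous_on[OF bounded_linear_cadj])
  have act_cont: "continuous_on G (\<lambda>g. act g P)" for P
    unfolding act_def by (intro continuous_intros cadj_cont)
  have K_cmp: "compact K"
    unfolding K_def by (intro compact_convex_hull compact_continuous_image act_cont cmp)
  have K_pos: "posdef P" if "P \<in> K" for P
  proof -
    have "K \<subseteq> {P. posdef P}"
      unfolding K_def by (rule hull_minimal[where S=convex]) (auto simp: act_def G_inv intro: posdef_gram convex_posdef)
    then show ?thesis using that by blast
  qed
  have K_act: "act h P \<in> K" if h: "h \<in> G" and P: "P \<in> K" for h P
  proof -
    have "act h P \<in> act h ` K" using P by blast
    also have "act h ` K = convex hull (act h ` (\<lambda>g. act g (mat 1)) ` G)"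
      unfolding K_def by (rule convex_hull_linear_image[OF act_lin])
    also have "\<dots> \<subseteq> K"
      unfolding K_def by (rule hull_mono) (use h G_mult act_act in auto)
    finally show ?thesis .
  qed
  define f where "f P = Sup ((\<lambda>g. norm (act g P)) ` G)" for P
  have bdd: "bdd_above ((\<lambda>g. norm (act g P)) ` G)" for P
    by (intro bounded_imp_bdd_above compact_imp_bounded compact_continuous_image cmp continuous_on_norm act_cont)
  have f_ge: "norm (act g P) \<le> f P" if "g \<in> G" for g P
    unfolding f_def by (rule cSUP_upper[OF that bdd])
  have f_att: "\<exists>g\<in>G. f P = norm (act g P)" for P
  proof -
    obtain g where g: "g \<in> G" "\<And>h. h \<in> G \<Longrightarrow> norm (act h P) \<le> norm (act g P)"
      using continuous_attains_sup[OF cmp _ continuous_on_norm[OF act_cont], of P] one by blast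
    have "f P \<le> norm (act g P)" unfolding f_def by (rule cSUP_least) (use one g in auto)
    then show ?thesis using f_ge[OF g(1), of P] g(1) by (intro bexI[of _ g]) auto
  qed
  obtain C where C: "\<And>g P. g \<in> G \<Longrightarrow> norm (act g P) \<le> C * norm P"
  proof -
    obtain L where L: "L \<ge> 1" "\<And>(A :: 'n cmat) (B :: 'n cmat). norm (A ** B) \<le> L * norm A * norm B"
      using mmul_norm_bound by blast
    obtain M where M: "M > 0" "\<And>g. g \<in> G \<Longrightarrow> norm g \<le> M" using compact_imp_bounded[OF cmp] unfolding bounded_pos by blast
    have "bounded (cadj ` G)" by (intro compact_imp_bounded compact_continuous_image cadj_cont cmp)
    then obtain N where N: "N > 0" "\<And>g. g \<in> G \<Longrightarrow> norm (cadj g) \<le> N" unfolding bounded_pos by blast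
    have "norm (act g P) \<le> L * (L * N * norm P) * M" if "g \<in> G" for g P
      unfolding act_def using L(1) M(1) N(1)
      by (intro order_trans[OF L(2)] mult_mono mult_left_mono order_trans[OF L(2)] M(2) N(2) that mult_nonneg_nonneg) auto
    then show ?thesis by (intro that[of "L * (L * N) * M"]) (simp add: mult_ac)
  qed
  have f_lip: "f P \<le> f Q + C * norm (P - Q)" for P Q
  proof -
    obtain g where g: "g \<in> G" "f P = norm (act g P)" using f_att by blast
    have "act g P = act g Q + act g (P - Q)" by (simp add: linear_diff[OF act_lin])
    then have "f P \<le> norm (act g Q) + norm (act g (P - Q))" using g(2) norm_triangle_ineq by metis
    also have "\<dots> \<le> f Q + C * norm (P - Q)" by (intro add_mono f_ge C g)
    finally show ?thesis .
  qed
  have f_cont: "continuous_on K f"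
  proof (rule continuous_on_subset[OF _ subset_UNIV], rule lipschitz_on_continuous_on)
    show "(\<bar>C\<bar>)-lipschitz_on UNIV f"
    proof (rule lipschitz_onI)
      fix P Q :: "'n cmat"
      have "C * norm (P - Q) \<le> \<bar>C\<bar> * norm (P - Q)" by (rule mult_right_mono) auto
      then show "dist (f P) (f Q) \<le> \<bar>C\<bar> * dist P Q"
        using f_lip[of P Q] f_lip[of Q P] by (simp add: dist_norm norm_minus_commute abs_le_iff)
    qed simp
  qed
  have "K \<noteq> {}" using one by (auto simp: K_def)
  then obtain P where P: "P \<in> K" "\<And>Q. Q \<in> K \<Longrightarrow> f P \<le> f Q"
    using continuous_attains_inf[OF K_cmp _ f_cont] by blast
  have "act h P = P" if h: "h \<in> G" for h
  proof (rule ccontr)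
    define Q where "Q = act h P"
    assume "act h P \<noteq> P"
    then have ne: "Q \<noteq> P" by (simp add: Q_def)
    have Q: "Q \<in> K" using K_act[OF h P(1)] by (simp add: Q_def)
    have "(1/2) *\<^sub>R P + (1/2) *\<^sub>R Q \<in> K"
      using convexD[of K P Q "1/2" "1/2"] P(1) Q by (simp add: K_def convex_convex_hull)
    moreover obtain g where g: "g \<in> G" "f ((1/2) *\<^sub>R P + (1/2) *\<^sub>R Q) = norm (act g ((1/2) *\<^sub>R P + (1/2) *\<^sub>R Q))"
      using f_att by blast
    ultimately have le: "f P \<le> norm ((1/2) *\<^sub>R act g P + (1/2) *\<^sub>R act g Q)"
      using P(2)[of "(1/2) *\<^sub>R P + (1/2) *\<^sub>R Q"] by (simp add: linear_add[OF act_lin] linear_scale[OF act_lin])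
    \<comment> \<open>The element g realizes f at the midpoint of P and Q. Both a and b have norm at
      most f P, since b is the translate of P by \<open>h ** g\<close>.\<close>
    define a b where "a = act g P" and "b = act g Q"
    have ab: "norm a \<le> f P" "norm b \<le> f P"
      using f_ge[OF g(1), of P] f_ge[OF G_mult[OF h g(1)], of P] by (auto simp: a_def b_def Q_def act_act)
    have ginv: "g ** matrix_inv g = mat 1" using matrix_inv_mult(1)[OF G_inv[OF g(1)]] .
    have "cadj (matrix_inv g) ** act g X ** matrix_inv g = X" for X
    proof -
      have "cadj (matrix_inv g) ** act g X ** matrix_inv g = cadj (g ** matrix_inv g) ** X ** (g ** matrix_inv g)"
        by (simp add: act_def cadj_mult matrix_mul_assoc)
      also have "\<dots> = X" unfolding ginv by simp
      finally show ?thesis .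
    qed
    then have "a \<noteq> b" using ne by (metis a_def b_def)
    then have "0 < norm (a - b)" by simp
    \<comment> \<open>By the parallelogram law the midpoint of two different points of norm at most
      f P has norm below f P, against the minimality of P.\<close>
    have "(norm (a + b))\<^sup>2 + (norm (a - b))\<^sup>2 = 2 * (norm a)\<^sup>2 + 2 * (norm b)\<^sup>2"
      by (simp add: power2_norm_eq_inner inner_add_left inner_add_right inner_diff_left inner_diff_right inner_commute)
    moreover have "(norm a)\<^sup>2 \<le> (f P)\<^sup>2" "(norm b)\<^sup>2 \<le> (f P)\<^sup>2" using ab by (auto intro: power_mono)
    moreover have "0 < (norm (a - b))\<^sup>2" using \<open>0 < norm (a - b)\<close> by simp
    moreover have "(2 * f P)\<^sup>2 \<le> (norm (a + b))\<^sup>2"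
    proof (rule power_mono)
      have "(1/2) *\<^sub>R a + (1/2) *\<^sub>R b = (1/2) *\<^sub>R (a + b)" by (simp add: scaleR_add_right)
      then have "norm ((1/2) *\<^sub>R a + (1/2) *\<^sub>R b) = norm (a + b) / 2" by simp
      then show "2 * f P \<le> norm (a + b)" using le by (simp add: a_def b_def)
      show "0 \<le> 2 * f P" using order_trans[OF norm_ge_zero ab(1)] by simp
    qed
    then have "4 * (f P)\<^sup>2 \<le> (norm (a + b))\<^sup>2" by (simp add: power_mult_distrib)
    ultimately show False by linarith
  qed
  then show ?thesis using that[of P] K_pos[OF P(1)] by (simp add: act_def)
qed

text \<open>Gram-Schmidt over the coordinate axes. The vectors built for I vanish outside I, so the
  vector obtained for a new axis m has m-th coordinate 1 and is not 0.\<close>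

theorem posdef_orthonormal_frame:
  fixes P :: "'n::finite cmat"
  assumes P: "posdef P"
  obtains B where "cadj B ** P ** B = mat 1"
proof -
  have "\<exists>b :: 'n \<Rightarrow> complex^'n. (\<forall>i\<in>I. \<forall>j\<in>I. hform P (b i) (b j) = (if i = j then 1 else 0)) \<and> (\<forall>i\<in>I. \<forall>l. l \<notin> I \<longrightarrow> b i $ l = 0)"
    if "finite I" for I :: "'n set"
    using that
  proof (induction I)
    case (insert m I)
    then obtain b :: "'n \<Rightarrow> complex^'n" where b: "\<And>i j. i \<in> I \<Longrightarrow> j \<in> I \<Longrightarrow> hform P (b i) (b j) = (if i = j then 1 else 0)"
      "\<And>i l. i \<in> I \<Longrightarrow> l \<notin> I \<Longrightarrow> b i $ l = 0" by blast
    define v where "v = axis m 1 - (\<Sum>i\<in>I. hform P (b i) (axis m 1) *s b i)"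
    have "v $ m = 1" using insert(2) b(2) by (simp add: v_def axis_def)
    then have "v \<noteq> 0" by auto
    then have pos: "0 < Re (hform P v v)" using P by (simp add: posdef_def)
    have v_out: "v $ l = 0" if "l \<notin> insert m I" for l using that b(2) by (simp add: v_def axis_def)
    have orth: "hform P (b i) v = 0" if "i \<in> I" for i
      using that insert(1) b(1)[OF that] by (simp add: v_def hform_diff hform_sum hform_smult if_distrib[of "\<lambda>x. _ * x"] sum.delta cong: if_cong)
    define r where "r = complex_of_real (1 / sqrt (Re (hform P v v)))"
    define w where "w = r *s v"
    have herm: "cadj P = P" using P by (simp add: posdef_def)
    have "Im (hform P v v) = 0" using hform_cnj[OF herm, of v v] by (simp add: complex_eq_iff)
    then have vv: "hform P v v = complex_of_real (Re (hform P v v))" by (simp add: complex_eq_iff)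
    have cnj_r: "hform P (r *s x) y = r * hform P x y" for x y
    proof -
      have "cnj r = r" by (simp add: r_def)
      then show ?thesis by (simp add: hform_def sum_distrib_left mult_ac)
    qed
    have "r * r * hform P v v = 1"
    proof -
      have "r * r * hform P v v = complex_of_real (1 / sqrt (Re (hform P v v)) * (1 / sqrt (Re (hform P v v))) * Re (hform P v v))"
        by (subst vv) (simp only: r_def of_real_mult)
      also have "1 / sqrt (Re (hform P v v)) * (1 / sqrt (Re (hform P v v))) * Re (hform P v v) = 1"
        using pos by (simp add: divide_simps)
      finally show ?thesis by simp
    qed
    then have ww: "hform P w w = 1" by (simp add: w_def hform_smult cnj_r mult.assoc)
    have wb: "hform P (b i) w = 0" "hform P w (b i) = 0" if "i \<in> I" for i
    proof -
      show 1: "hform P (b i) w = 0" using orth[OF that] by (simp add: w_def hform_smult)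
      show "hform P w (b i) = 0" using hform_cnj[OF herm, of "b i" w] 1 by simp
    qed
    show ?case
    proof (intro exI[of _ "b(m := w)"] conjI ballI allI impI)
      fix i j assume "i \<in> insert m I" "j \<in> insert m I"
      then show "hform P ((b(m := w)) i) ((b(m := w)) j) = (if i = j then 1 else 0)"
        using ww wb b(1) insert(2) by auto
    next
      fix i l assume "i \<in> insert m I" "l \<notin> insert m I"
      then show "(b(m := w)) i $ l = 0" using v_out b(2) by (auto simp: w_def)
    qed
  qed simp
  from this[of UNIV] obtain b :: "'n \<Rightarrow> complex^'n" where b: "\<And>i j. hform P (b i) (b j) = (if i = j then 1 else 0)" by auto
  define B where "B = (\<chi> k i. b i $ k)"
  have "(cadj B ** P ** B) $ i $ j = hform P (b i) (b j)" for i j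
  proof -
    have "(cadj B ** P ** B) $ i $ j = (\<Sum>k\<in>UNIV. \<Sum>l\<in>UNIV. cnj (b i $ l) * P $ l $ k * b j $ k)"
      by (simp add: matrix_matrix_mult_def cadj_nth B_def sum_distrib_right)
    then show ?thesis unfolding hform_def by (subst sum.swap) simp
  qed
  then have "cadj B ** P ** B = mat 1" by (simp add: vec_eq_iff b mat_def)
  then show ?thesis by (rule that)
qed

lemma imult_mult_left: "imult A ** B = imult (A ** B)"
  by (simp add: imult_def vec_eq_iff map_matrix_def matrix_matrix_mult_def sum_distrib_left mult_ac)

lemma imult_mult_right: "A ** imult B = imult (A ** B)"
  by (simp add: imult_def vec_eq_iff map_matrix_def matrix_matrix_mult_def sum_distrib_left mult_ac)

section \<open>The adjoint and its trace inner product\<close>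

text \<open>The properties of the conjugate transpose that survive a change of basis. They are
  abstracted because G is unitary only for its invariant form; the two trace conditions make Re
  trace (A \<open>dag\<close> B) an inner product.\<close>

locale adjoint_form =
  fixes dag :: "'n::finite cmat \<Rightarrow> 'n cmat"
  assumes linear_dag: "linear dag"
    and dag_mult: "dag (A ** B) = dag B ** dag A"
    and dag_dag [simp]: "dag (dag A) = A"
    and dag_imult: "dag (imult A) = - imult (dag A)"
    and trace_dag: "trace (dag A) = cnj (trace A)"
    and trace_pos: "A \<noteq> 0 \<Longrightarrow> 0 < Re (trace (A ** dag A))"

text \<open>The conjugate transpose in the coordinates of a P-orthonormal frame B, whose inverse is
  S = \<open>cadj B ** P\<close>; this amounts to A being sent to P^-1 \<open>cadj A\<close> P.
  Invariance of P then says that \<open>dag g\<close> inverts g.\<close>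

theorem adjoint_form_exists:
  fixes G :: "'n::finite cmat set"
  assumes G: "compact_lie_group G"
  obtains dag where "adjoint_form dag" "\<And>g. g \<in> G \<Longrightarrow> g ** dag g = mat 1"
proof -
  obtain P where P: "posdef P" "\<And>g. g \<in> G \<Longrightarrow> cadj g ** P ** g = P" using invariant_posdef[OF G] by blast
  obtain B where B: "cadj B ** P ** B = mat 1" using posdef_orthonormal_frame[OF P(1)] by blast
  define S where "S = cadj B ** P"
  have SB: "S ** B = mat 1" using B by (simp add: S_def)
  have BS: "B ** S = mat 1" by (rule matrix_left_right_inverse1[OF SB])
  have XBS: "X ** B ** S = X" and XSB: "X ** S ** B = X" for X :: "'n cmat"
    by (simp_all add: matrix_mul_assoc[symmetric] BS SB)
  have herm: "cadj P = P" using P(1) by (simp add: posdef_def)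
  have cadj_S: "cadj S = P ** B" by (simp add: S_def cadj_mult herm)
  have SS: "cadj S ** S = P"
  proof -
    have "B ** cadj B ** P = mat 1" using BS by (simp add: S_def matrix_mul_assoc)
    then have "P ** B ** cadj B = mat 1" using matrix_left_right_inverse[of "B ** cadj B" P] by (simp add: matrix_mul_assoc)
    then show ?thesis unfolding cadj_S by (simp add: S_def matrix_mul_assoc)
  qed
  define dag where "dag A = B ** cadj (S ** A ** B) ** S" for A
  have "adjoint_form dag"
  proof (rule adjoint_form.intro)
    show "linear dag" unfolding dag_def by (rule linearI) (simp_all add: mmul_simps cadj_add cadj_scaleR)
    show dm: "dag (X ** Y) = dag Y ** dag X" for X Y
    proof -
      have "S ** (X ** Y) ** B = (S ** X ** B) ** (S ** Y ** B)" by (simp add: matrix_mul_assoc XBS)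
      then show ?thesis by (simp add: dag_def cadj_mult matrix_mul_assoc XSB del: cadj_mult) (simp add: cadj_mult matrix_mul_assoc XSB)
    qed
    show "dag (dag X) = X" for X
    proof -
      have "S ** dag X ** B = cadj (S ** X ** B)" by (simp add: dag_def matrix_mul_assoc SB XSB)
      then have "dag (dag X) = B ** (S ** X ** B) ** S" by (simp add: dag_def[of "dag X"])
      then show ?thesis by (simp add: matrix_mul_assoc BS XBS)
    qed
    show "dag (imult X) = - imult (dag X)" for X
    proof -
      have "cadj (imult Y) = - imult (cadj Y)" for Y :: "'n cmat"
        by (simp add: vec_eq_iff cadj_nth imult_def map_matrix_def)
      then show ?thesis by (simp add: dag_def imult_mult_left imult_mult_right mmul.minus_left mmul.minus_right)
    qed
    have tr: "trace (dag X) = trace (cadj (S ** X ** B))" for X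
      unfolding dag_def by (subst trace_mul_sym) (simp add: matrix_mul_assoc SB)
    have "trace (S ** X ** B) = trace X" for X
      by (subst trace_mul_sym) (simp add: matrix_mul_assoc BS)
    moreover have "trace (cadj Y) = cnj (trace Y)" for Y :: "'n cmat" by (simp add: trace_def cadj_nth)
    ultimately show "trace (dag X) = cnj (trace X)" for X by (simp add: tr)
    show "0 < Re (trace (X ** dag X))" if "X \<noteq> 0" for X
    proof -
      define C where "C = S ** X ** B"
      have "C \<noteq> 0"
      proof
        assume "C = 0"
        then have "B ** C ** S = 0" by (simp add: mmul.zero_left mmul.zero_right)
        then show False using that by (simp add: C_def matrix_mul_assoc BS XBS)
      qed
      then obtain i j where ij: "C $ i $ j \<noteq> 0" by (auto simp: vec_eq_iff)
      have "trace (X ** dag X) = trace (C ** cadj C)"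
      proof -
        have "trace (X ** dag X) = trace (X ** B ** cadj C ** S)" by (simp add: dag_def C_def matrix_mul_assoc)
        also have "\<dots> = trace (S ** (X ** B ** cadj C))" by (rule trace_mul_sym)
        finally show ?thesis by (simp add: C_def matrix_mul_assoc)
      qed
      also have "\<dots> = (\<Sum>i\<in>UNIV. \<Sum>j\<in>UNIV. complex_of_real ((cmod (C $ i $ j))\<^sup>2))"
        by (simp add: trace_def matrix_matrix_mult_def cadj_nth complex_norm_square[symmetric] del: of_real_power)
      finally have "Re (trace (X ** dag X)) = (\<Sum>i\<in>UNIV. \<Sum>j\<in>UNIV. (cmod (C $ i $ j))\<^sup>2)" by simp
      moreover have "0 < (\<Sum>i\<in>UNIV. \<Sum>j\<in>UNIV. (cmod (C $ i $ j))\<^sup>2)"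
        by (rule sum_pos2[of _ i], simp, simp, rule sum_pos2[of _ j]) (use ij in \<open>auto intro: sum_nonneg\<close>)
      ultimately show ?thesis by simp
    qed
  qed
  moreover have "g ** dag g = mat 1" if g: "g \<in> G" for g
  proof -
    have "dag g ** g = B ** (cadj (S ** g ** B) ** (S ** g ** B)) ** S"
      by (simp add: dag_def matrix_mul_assoc XBS)
    also have "cadj (S ** g ** B) ** (S ** g ** B) = cadj B ** (cadj g ** (cadj S ** S) ** g) ** B"
      by (simp add: cadj_mult matrix_mul_assoc)
    also have "\<dots> = mat 1" using P(2)[OF g] B by (simp add: SS)
    finally have "dag g ** g = mat 1" by (simp add: BS)
    then show ?thesis by (rule matrix_left_right_inverse1)
  qed
  ultimately show ?thesis by (rule that)
qed

context adjoint_form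
begin

lemmas dag_add = linear_add[OF linear_dag] and dag_diff = linear_diff[OF linear_dag]
  and dag_scaleR = linear_scale[OF linear_dag] and dag_minus = linear_neg[OF linear_dag]
  and dag_zero [simp] = linear_0[OF linear_dag]

lemma bounded_linear_dag: "bounded_linear dag"
  using linear_dag by (simp add: linear_conv_bounded_linear)

lemmas has_vector_derivative_dag = bounded_linear.has_vector_derivative[OF bounded_linear_dag]
lemmas continuous_on_dag [continuous_intros] = bounded_linear.continuous_on[OF bounded_linear_dag]

lemma dag_one [simp]: "dag (mat 1) = mat 1"
proof -
  have "dag (mat 1) = dag (mat 1) ** dag (dag (mat 1))" by simp
  also have "\<dots> = dag (dag (mat 1) ** mat 1)" by (simp only: dag_mult)
  finally show ?thesis by simp
qed

lemmas dag_simps = dag_add dag_diff dag_scaleR dag_minus dag_mult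

definition ip :: "'n cmat \<Rightarrow> 'n cmat \<Rightarrow> real" where
  "ip A B = Re (trace (A ** dag B))"

lemma ip_commute: "ip A B = ip B A"
proof -
  have "trace (B ** dag A) = cnj (trace (A ** dag B))"
    by (subst trace_dag[symmetric]) (simp add: dag_mult)
  then show ?thesis by (simp add: ip_def)
qed

text \<open>Cyclicity of the trace. Left and right factors move to the other argument as adjoints,
  which drives all inner product computations below.\<close>

lemma ip_cycle: "ip (A ** B) C = ip B (dag A ** C)" "ip (A ** B) C = ip A (C ** dag B)"
proof -
  have "trace (A ** (B ** dag C)) = trace (B ** dag C ** A)" by (rule trace_mul_sym)
  then show "ip (A ** B) C = ip B (dag A ** C)" by (simp add: ip_def dag_mult matrix_mul_assoc)
  show "ip (A ** B) C = ip A (C ** dag B)" by (simp add: ip_def dag_mult matrix_mul_assoc)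
qed

lemma ip_dag: "ip (dag A) (dag B) = ip A B"
  using trace_mul_sym[of "dag A" B] ip_commute[of A B] by (simp add: ip_def)

lemma trace_scaleR: "trace (c *\<^sub>R (A :: 'n cmat)) = c *\<^sub>R trace A"
  by (simp add: trace_def scaleR_sum_right)

lemma bounded_bilinear_ip: "bounded_bilinear ip"
proof -
  have "bilinear ip"
    unfolding bilinear_def ip_def
    by (intro conjI allI linearI) (simp_all add: mmul_simps dag_simps trace_add trace_scaleR)
  then show ?thesis by (simp add: bilinear_conv_bounded_bilinear)
qed

sublocale ip: bounded_bilinear ip by (rule bounded_bilinear_ip)

lemmas ip_simps = ip.add_left ip.add_right ip.diff_left ip.diff_right ip.minus_left ip.minus_right
  ip.scaleR_left ip.scaleR_right

lemma ip_pos: "A \<noteq> 0 \<Longrightarrow> 0 < ip A A" unfolding ip_def by (rule trace_pos)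

lemma ip_nonneg [simp]: "0 \<le> ip A A"
  using ip_pos[of A] by (cases "A = 0") (auto simp: ip.zero_left)

lemma ip_eq_0: "ip A A \<le> 0 \<Longrightarrow> A = 0"
  by (rule ccontr) (drule ip_pos, simp)

lemma ip_le_half: "ip A B \<le> (ip A A + ip B B) / 2"
proof -
  have "0 \<le> ip (A - B) (A - B)" by (rule ip_nonneg)
  then have "2 * ip A B \<le> ip A A + ip B B" using ip_commute[of B A] by (simp add: ip_simps)
  then show ?thesis by simp
qed

lemma ip_cauchy: "(ip A B)\<^sup>2 \<le> ip A A * ip B B"
proof (cases "B = 0")
  case False
  define t where "t = ip A B / ip B B"
  have pos: "0 < ip B B" by (rule ip_pos[OF False])
  have "0 \<le> ip (A - t *\<^sub>R B) (A - t *\<^sub>R B)" by simp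
  also have "\<dots> = ip A A - 2 * t * ip A B + t * t * ip B B"
    by (simp add: ip_simps ip_commute[of B A] algebra_simps del: ip_nonneg)
  also have "\<dots> = ip A A - (ip A B)\<^sup>2 / ip B B"
    using pos by (simp add: t_def power2_eq_square field_simps)
  finally show ?thesis using pos by (simp add: field_simps)
qed (simp add: ip.zero_right)

text \<open>The lower constant is the minimum of \<open>ip\<close> on the compact unit sphere,
  attained and therefore positive.\<close>

lemma ip_norm_bounds:
  obtains c C where "c > 0" "C > 0" "\<And>A. c * (norm A)\<^sup>2 \<le> ip A A" "\<And>A. ip A A \<le> C * (norm A)\<^sup>2"
proof -
  have cont: "continuous_on (sphere 0 1) (\<lambda>A. ip A A)" by (intro ip.continuous_on continuous_intros)
  have ne: "sphere (0 :: 'n cmat) 1 \<noteq> {}" by simp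
  obtain A where A: "A \<in> sphere 0 1" "\<And>B. B \<in> sphere 0 1 \<Longrightarrow> ip A A \<le> ip B B"
    using continuous_attains_inf[OF compact_sphere ne cont] by blast
  obtain K where K: "K > 0" "\<And>A B. norm (ip A B) \<le> norm A * norm B * K" using ip.pos_bounded by blast
  show ?thesis
  proof (rule that[of "ip A A" K])
    show "0 < ip A A" using A(1) by (intro ip_pos) auto
    show "ip A A * (norm B)\<^sup>2 \<le> ip B B" for B
    proof (cases "B = 0")
      case False
      have "ip A A \<le> ip ((1 / norm B) *\<^sub>R B) ((1 / norm B) *\<^sub>R B)" by (rule A(2)) (use False in simp)
      then show ?thesis using False by (simp add: ip_simps power2_eq_square field_simps)
    qed (simp add: ip.zero_left)
    show "ip B B \<le> K * (norm B)\<^sup>2" for B using K(2)[of B B] by (simp add: power2_eq_square mult_ac)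
  qed (rule K)
qed

lemma ip_has_vector_derivative:
  assumes "(f has_vector_derivative f') (at t within S)" "(g has_vector_derivative g') (at t within S)"
  shows "((\<lambda>t. ip (f t) (g t)) has_vector_derivative ip f' (g t) + ip (f t) g') (at t within S)"
  using ip.has_vector_derivative[OF assms] by (simp add: add.commute)

lemma dag_mexp: "dag (mexp A) = mexp (dag A)"
proof -
  have "((\<lambda>t. dag (mexp (t *\<^sub>R A))) has_vector_derivative dag A ** dag (mexp (t *\<^sub>R A))) (at t within {0..1})" for t
    using has_vector_derivative_dag[OF mexp_has_vector_derivative_right[of A t "{0..1}"]] by (simp add: dag_mult)
  then have "dag (mexp (1 *\<^sub>R A)) = mexp (1 *\<^sub>R dag A) ** dag (mexp (0 *\<^sub>R A))"
    by (intro mexp_ode_unique[where b=1 and y="\<lambda>t. dag (mexp (t *\<^sub>R A))"]) auto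
  then show ?thesis by simp
qed

text \<open>On eigenvalues this is 2 cosh (2 x) >= 2 + 4 x^2, proved here without diagonalization.
  The difference \<open>q\<close> along s A has q' = 0 at s = 0, and q'' >= 0 because A exp (s A)
  and A exp (- s A) have inner product \<open>ip A A\<close> for every s. The bound controls A by
  exp A and its inverse.\<close>

lemma mexp_hermitian_growth:
  assumes A: "dag A = A"
  shows "2 * ip (mat 1) (mat 1) + 4 * ip A A \<le> ip (mexp A) (mexp A) + ip (mexp (- A)) (mexp (- A))"
proof -
  define e where "e s = mexp (s *\<^sub>R A)" for s
  define d where "d s = mexp (- (s *\<^sub>R A))" for s
  have e: "(e has_vector_derivative A ** e s) (at s within S)" for s S
    unfolding e_def by (rule mexp_has_vector_derivative_left)
  have d: "(d has_vector_derivative - (A ** d s)) (at s within S)" for s S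
    using mexp_has_vector_derivative_left[of "- A" s S] unfolding d_def[abs_def] by (simp add: mmul_simps)
  have Ae: "((\<lambda>s. A ** e s) has_vector_derivative A ** (A ** e s)) (at s within S)" for s S
    by (rule has_vector_derivative_mmul_const(2)[OF e])
  have Ad: "((\<lambda>s. A ** d s) has_vector_derivative - (A ** (A ** d s))) (at s within S)" for s S
    using has_vector_derivative_mmul_const(2)[OF d, of A] by (simp add: mmul_simps)
  define q where "q s = ip (e s) (e s) + ip (d s) (d s) - 4 * ip A A * s\<^sup>2" for s
  define q' where "q' s = 2 * ip (A ** e s) (e s) - 2 * ip (A ** d s) (d s) - 8 * ip A A * s" for s
  have q: "(q has_vector_derivative q' s) (at s within {0..1})" for s
  proof -
    have "((\<lambda>s. 4 * ip A A * s\<^sup>2) has_vector_derivative 8 * ip A A * s) (at s within {0..1})"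
      by (auto intro!: derivative_eq_intros simp: has_real_derivative_iff_has_vector_derivative[symmetric])
    from has_vector_derivative_diff[OF has_vector_derivative_add[OF ip_has_vector_derivative[OF e e] ip_has_vector_derivative[OF d d]] this]
    show ?thesis unfolding q_def[abs_def] q'_def
      by (simp add: ip_simps ip_commute[of "e s"] ip_commute[of "d s"])
  qed
  have q': "(q' has_vector_derivative 4 * ip (A ** e s) (A ** e s) + 4 * ip (A ** d s) (A ** d s) - 8 * ip A A) (at s within {0..1})" for s
  proof -
    have "((\<lambda>s. 8 * ip A A * s) has_vector_derivative 8 * ip A A) (at s within {0..1})"
      by (auto intro!: derivative_eq_intros simp: has_real_derivative_iff_has_vector_derivative[symmetric])
    moreover have "((\<lambda>s. 2 * ip (A ** e s) (e s)) has_vector_derivative 2 * (ip (A ** (A ** e s)) (e s) + ip (A ** e s) (A ** e s))) (at s within {0..1})"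
      by (rule bounded_linear.has_vector_derivative[OF bounded_linear_mult_right ip_has_vector_derivative[OF Ae e]])
    moreover have "((\<lambda>s. 2 * ip (A ** d s) (d s)) has_vector_derivative 2 * (ip (- (A ** (A ** d s))) (d s) + ip (A ** d s) (- (A ** d s)))) (at s within {0..1})"
      by (rule bounded_linear.has_vector_derivative[OF bounded_linear_mult_right ip_has_vector_derivative[OF Ad d]])
    ultimately have "((\<lambda>s. 2 * ip (A ** e s) (e s) - 2 * ip (A ** d s) (d s) - 8 * ip A A * s) has_vector_derivative
        2 * (ip (A ** (A ** e s)) (e s) + ip (A ** e s) (A ** e s)) - 2 * (ip (- (A ** (A ** d s))) (d s) + ip (A ** d s) (- (A ** d s))) - 8 * ip A A) (at s within {0..1})"
      by (intro has_vector_derivative_diff)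
    moreover have "ip (A ** (A ** X)) X = ip (A ** X) (A ** X)" for X
      by (simp add: ip_cycle(1)[of A "A ** X"] A)
    ultimately show ?thesis unfolding q'_def[abs_def] by (simp add: ip_simps)
  qed
  have nn: "0 \<le> 4 * ip (A ** e s) (A ** e s) + 4 * ip (A ** d s) (A ** d s) - 8 * ip A A" for s
  proof -
    have "ip (A ** e s) (A ** d s) = ip A (A ** d s ** dag (e s))" by (rule ip_cycle(2))
    also have "A ** d s ** dag (e s) = A" by (simp add: dag_mexp d_def e_def dag_simps A)
    finally show ?thesis using ip_le_half[of "A ** e s" "A ** d s"] by simp
  qed
  have "q 0 \<le> q 1"
  proof (rule nondecreasing_of_deriv[where f=q and f'=q' and a=0 and b=1])
    fix s :: real assume s: "s \<in> {0..1}"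
    have "q' 0 \<le> q' s" by (rule nondecreasing_of_deriv[OF q' nn]) (use s in auto)
    then show "0 \<le> q' s" by (simp add: q'_def e_def d_def)
  qed (use q in auto)
  then show ?thesis by (simp add: q_def e_def d_def)
qed

text \<open>Here exp A is its own inverse and has the norm of 1, so the growth bound leaves no room
  for A.\<close>

lemma mexp_hermitian_involution:
  assumes A: "dag A = A" and "mexp A ** mexp A = mat 1"
  shows "A = 0"
proof -
  have inv: "mexp (- A) = mexp A"
    using matrix_inv_eqI[OF assms(2)] by simp
  have "ip (mexp A) (mexp A) = ip (mat 1) (mat 1)"
    using assms by (simp add: ip_def dag_mexp)
  then have "4 * ip A A \<le> 0" using mexp_hermitian_growth[OF A] by (simp add: inv)
  then show ?thesis by (intro ip_eq_0) simp
qed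

end

lemma imult_imult [simp]: "imult (imult A) = - A"
  by (simp add: imult_def vec_eq_iff map_matrix_def mult.assoc[symmetric])

lemma linear_imult: "linear imult"
  by (rule linearI) (simp_all add: imult_def vec_eq_iff map_matrix_def algebra_simps)

lemmas imult_add = linear_add[OF linear_imult] and imult_diff = linear_diff[OF linear_imult]
  and imult_scaleR = linear_scale[OF linear_imult] and imult_minus = linear_neg[OF linear_imult]
  and imult_zero [simp] = linear_0[OF linear_imult]

section \<open>Skew and Hermitian parts of the complexified Lie algebra\<close>

locale unitary_group = adjoint_form +
  fixes G :: "'a cmat set"
  assumes G: "compact_lie_group G" and unitary: "g \<in> G \<Longrightarrow> g ** dag g = mat 1"
begin

lemma grp: "matrix_group G" and cmp: "compact G" using G by (auto simp: compact_lie_group_def)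

lemma G_one: "mat 1 \<in> G" and G_mult: "g \<in> G \<Longrightarrow> h \<in> G \<Longrightarrow> g ** h \<in> G"
  and G_invertible: "g \<in> G \<Longrightarrow> invertible g" and G_inv: "g \<in> G \<Longrightarrow> matrix_inv g \<in> G"
  using grp by (auto simp: matrix_group_def)

lemma unitary': "g \<in> G \<Longrightarrow> dag g ** g = mat 1"
  using matrix_left_right_inverse1[OF unitary] .

lemma matrix_inv_G: "g \<in> G \<Longrightarrow> matrix_inv g = dag g"
  by (rule matrix_inv_eqI[OF unitary])

lemma dag_G: "g \<in> G \<Longrightarrow> dag g \<in> G" using G_inv matrix_inv_G by metis

lemma unitary_cancel: "g \<in> G \<Longrightarrow> A ** g ** dag g = A" "g \<in> G \<Longrightarrow> A ** dag g ** g = A"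
  by (simp_all add: matrix_mul_assoc[symmetric] unitary unitary')

lemma ip_unitary: "g \<in> G \<Longrightarrow> ip (A ** g) (B ** g) = ip A B" "g \<in> G \<Longrightarrow> ip (g ** A) (g ** B) = ip A B"
  by (simp_all add: ip_cycle(2)[of A g] ip_cycle(1)[of g A] matrix_mul_assoc unitary_cancel unitary')

abbreviation lie where "lie \<equiv> lie_algebra G"
abbreviation clie where "clie \<equiv> complex_lie_algebra G"

text \<open>This is i times \<open>lie\<close>: elements of \<open>lie\<close> are skew for
  \<open>dag\<close>, so the first summand of X + i Y vanishes for a Hermitian element.\<close>

definition herm where "herm = {A \<in> clie. dag A = A}"

lemmas subspace_lie = subspace_lie_algebra[OF G]

text \<open>The inverse of exp (t X) is both exp (- t X) and, by unitarity, exp (t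
  \<open>dag X\<close>); compare derivatives at 0.\<close>

lemma dag_lie: assumes "X \<in> lie" shows "dag X = - X"
proof -
  have "mexp (t *\<^sub>R dag X) = mexp (- (t *\<^sub>R X))" for t
    using matrix_inv_G[OF lie_algebra_mexp(1)[OF assms, of t]] by (simp add: dag_mexp dag_scaleR)
  then have "((\<lambda>t. mexp (t *\<^sub>R dag X)) has_vector_derivative - X) (at 0)"
    using mexp_neg_has_vector_derivative_right[of X 0 UNIV] by simp
  moreover have "((\<lambda>t. mexp (t *\<^sub>R dag X)) has_vector_derivative dag X) (at 0)"
    using mexp_has_vector_derivative_right[of "dag X" 0 UNIV] by simp
  ultimately show ?thesis using vector_derivative_unique_at by blast
qed

lemma clieI: "X \<in> lie \<Longrightarrow> Y \<in> lie \<Longrightarrow> X + imult Y \<in> clie"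
  by (auto simp: complex_lie_algebra_def)

lemma clieE:
  assumes "Z \<in> clie"
  obtains X Y where "X \<in> lie" "Y \<in> lie" "Z = X + imult Y" "dag Z = - X + imult Y"
proof -
  obtain X Y where XY: "X \<in> lie" "Y \<in> lie" "Z = X + imult Y" using assms by (auto simp: complex_lie_algebra_def)
  moreover have "dag Z = - X + imult Y" using XY by (simp add: dag_add dag_imult dag_lie imult_minus)
  ultimately show ?thesis by (rule that)
qed

text \<open>On every decomposition X + i Y the map \<open>dag\<close> acts as \<open>star\<close>
  prescribes, so the description has exactly one solution.\<close>

lemma star_eq_dag: assumes "Z \<in> clie" shows "star G Z = dag Z"
proof -
  obtain X Y where XY: "X \<in> lie" "Y \<in> lie" "Z = X + imult Y" "dag Z = - X + imult Y" using clieE[OF assms] .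
  show ?thesis
    unfolding star_def
  proof (rule the_equality)
    show "\<exists>X\<in>lie. \<exists>Y\<in>lie. Z = X + imult Y \<and> dag Z = - X + imult Y" using XY by blast
    fix W assume "\<exists>X\<in>lie. \<exists>Y\<in>lie. Z = X + imult Y \<and> W = - X + imult Y"
    then obtain X' Y' where "X' \<in> lie" "Y' \<in> lie" "Z = X' + imult Y'" "W = - X' + imult Y'" by blast
    then show "W = dag Z" by (simp add: dag_add dag_imult dag_lie imult_minus)
  qed
qed

lemma subspace_clie: "subspace clie"
proof (rule subspaceI)
  show "0 \<in> clie" using clieI[of 0 0] subspace_0[OF subspace_lie] by simp
  fix Z W c assume "Z \<in> clie"
  then obtain X Y where XY: "X \<in> lie" "Y \<in> lie" "Z = X + imult Y" using clieE by blast
  show "c *\<^sub>R Z \<in> clie"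
    using clieI[of "c *\<^sub>R X" "c *\<^sub>R Y"] XY subspace_scale[OF subspace_lie] by (simp add: imult_scaleR scaleR_add_right)
  assume "W \<in> clie"
  then obtain X' Y' where "X' \<in> lie" "Y' \<in> lie" "W = X' + imult Y'" using clieE by blast
  then show "Z + W \<in> clie"
    using clieI[of "X + X'" "Y + Y'"] XY subspace_add[OF subspace_lie] by (simp add: imult_add algebra_simps)
qed

lemma clie_dag: assumes "Z \<in> clie" shows "dag Z \<in> clie"
proof -
  obtain X Y where "X \<in> lie" "Y \<in> lie" "dag Z = - X + imult Y" using clieE[OF assms] by metis
  then show ?thesis using clieI[of "- X" Y] subspace_neg[OF subspace_lie] by simp
qed

lemma lie_subset_clie: "X \<in> lie \<Longrightarrow> X \<in> clie"
  using clieI[of X 0] subspace_0[OF subspace_lie] by simp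

lemma clie_skew: assumes "Z \<in> clie" "dag Z = - Z" shows "Z \<in> lie"
proof -
  obtain X Y where XY: "X \<in> lie" "Y \<in> lie" "Z = X + imult Y" "dag Z = - X + imult Y" using clieE[OF assms(1)] .
  then have "imult Y = - imult Y" using assms(2) by (simp only: add_left_cancel minus_add_distrib)
  then have "imult Y = 0" by (simp add: vec_eq_iff)
  then show ?thesis using XY by simp
qed

lemma subspace_herm: "subspace herm"
  using subspace_clie unfolding herm_def subspace_def by (auto simp: dag_add dag_scaleR)

lemma herm_part: "Z \<in> clie \<Longrightarrow> (1/2) *\<^sub>R (Z + dag Z) \<in> herm"
  using subspace_scale[OF subspace_clie subspace_add[OF subspace_clie _ clie_dag]]
  by (simp add: herm_def dag_simps add.commute)

lemma hermD: "A \<in> herm \<Longrightarrow> A \<in> clie" "A \<in> herm \<Longrightarrow> dag A = A" by (auto simp: herm_def)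

lemma clie_bracket: assumes "X \<in> clie" "Y \<in> clie" shows "bracket X Y \<in> clie"
proof -
  obtain A B where 1: "A \<in> lie" "B \<in> lie" "X = A + imult B" using clieE[OF assms(1)] .
  obtain C D where 2: "C \<in> lie" "D \<in> lie" "Y = C + imult D" using clieE[OF assms(2)] .
  have "bracket X Y = (bracket A C - bracket B D) + imult (bracket A D + bracket B C)"
    by (simp add: 1 2 bracket_def mmul_simps imult_mult_left imult_mult_right imult_add imult_diff algebra_simps)
  also have "\<dots> \<in> clie"
    by (intro clieI subspace_add[OF subspace_lie] subspace_diff[OF subspace_lie] lie_algebra_bracket[OF G] 1 2)
  finally show ?thesis .
qed

lemma clie_Ad: assumes g: "g \<in> G" and Z: "Z \<in> clie" shows "g ** Z ** dag g \<in> clie"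
proof -
  obtain X Y where XY: "X \<in> lie" "Y \<in> lie" "Z = X + imult Y" using clieE[OF Z] .
  have "g ** X ** dag g \<in> lie" "g ** Y ** dag g \<in> lie"
    using lie_algebra_Ad[OF grp g] XY matrix_inv_G[OF g] by metis+
  then have "g ** X ** dag g + imult (g ** Y ** dag g) \<in> clie" by (rule clieI)
  then show ?thesis by (simp add: XY(3) mmul_simps imult_mult_left imult_mult_right)
qed

text \<open>The curve c t = exp (- t Z) W exp (t Z) solves c' = [c, Z]. This linear field maps
  \<open>clie\<close> to itself, so viability keeps the curve there.\<close>

lemma clie_mexp_Ad: assumes Z: "Z \<in> clie" and W: "W \<in> clie" shows "mexp (- Z) ** W ** mexp Z \<in> clie"
proof -
  define c where "c t = mexp (- (t *\<^sub>R Z)) ** W ** mexp (t *\<^sub>R Z)" for t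
  have d: "(c has_vector_derivative bracket (c t) Z) (at t within S)" for t S
    using has_vector_derivative_mmul[OF has_vector_derivative_mmul_const(1)[OF mexp_has_vector_derivative_left[of "- Z" t S], of W]
      mexp_has_vector_derivative_right[of Z t S]]
    unfolding c_def[abs_def] by (simp add: bracket_def mmul_simps)
  obtain L where L: "L \<ge> 1" "\<And>(A :: 'a cmat) (B :: 'a cmat). norm (A ** B) \<le> L * norm A * norm B"
    using mmul_norm_bound by blast
  have "c 1 \<in> clie"
  proof (rule subspace_viability[OF subspace_clie, where \<gamma>=c and r=1 and L="2 * L * norm Z", OF _ _ d])
    fix t :: real and x assume x: "x \<in> clie"
    have "bracket x Z - bracket (c t) Z = (x - c t) ** Z - Z ** (x - c t)" by (simp add: bracket_def mmul_simps)
    then have "norm (bracket x Z - bracket (c t) Z) \<le> norm ((x - c t) ** Z) + norm (Z ** (x - c t))"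
      by (simp add: norm_triangle_ineq4)
    also have "\<dots> \<le> L * norm (x - c t) * norm Z + L * norm Z * norm (x - c t)" by (intro add_mono L)
    finally have "norm (bracket x Z - bracket (c t) Z) \<le> 2 * L * norm Z * dist x (c t)" by (simp add: dist_norm)
    then show "\<exists>w\<in>clie. norm (w - bracket (c t) Z) \<le> 2 * L * norm Z * dist x (c t)"
      using clie_bracket[OF x Z] by blast
  qed (use W in \<open>auto simp: c_def\<close>)
  then show ?thesis by (simp add: c_def)
qed

lemma dexp_clie: assumes A: "A \<in> clie" and B: "B \<in> clie" shows "dexp A B 1 \<in> clie"
proof (rule subspace_viability[OF subspace_clie, where \<gamma>="dexp A B" and r=1 and L=0, OF _ _ dexp_has_vector_derivative])
  fix t x
  have "mexp (- (t *\<^sub>R A)) ** B ** mexp (t *\<^sub>R A) \<in> clie"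
    by (rule clie_mexp_Ad[OF subspace_scale[OF subspace_clie A] B])
  then show "\<exists>w\<in>clie. norm (w - mexp (- (t *\<^sub>R A)) ** B ** mexp (t *\<^sub>R A)) \<le> 0 * dist x (dexp A B t)" by force
qed (use subspace_0[OF subspace_clie] in auto)

text \<open>The Hermitian part of the differential of the exponential is positive definite on \<open>herm\<close>: for
  \<open>E = exp (t A / 2)\<close> one has \<open>\<langle>E\<^sup>-\<^sup>2 B E\<^sup>2, B\<rangle> = \<langle>E\<^sup>-\<^sup>1 B E, E\<^sup>-\<^sup>1 B E\<rangle>\<close>.\<close>

lemma dexp_pos: assumes A: "dag A = A" and B: "dag B = B" "B \<noteq> 0" shows "0 < ip (dexp A B 1) B"
proof -
  define f where "f t = ip (dexp A B t) B" for t
  define f' where "f' t = ip (mexp (- (t *\<^sub>R A)) ** B ** mexp (t *\<^sub>R A)) B" for t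
  have f: "(f has_vector_derivative f' t) (at t within {0..1})" if "t \<in> {0..1}" for t
    unfolding f_def[abs_def] f'_def
    using ip_has_vector_derivative[OF dexp_has_vector_derivative[OF that, of A B] has_vector_derivative_const[of B]] by (simp add: ip.zero_right)
  have pos: "0 < f' t" for t
  proof -
    define E where "E = mexp ((t/2) *\<^sub>R A)"
    define D where "D = mexp (- ((t/2) *\<^sub>R A))"
    have EE: "mexp (t *\<^sub>R A) = E ** E" using mexp_add_scaleR[of "t/2" "t/2" A] by (simp add: E_def)
    have DD: "mexp (- (t *\<^sub>R A)) = D ** D" using mexp_add_scaleR[of "t/2" "t/2" "- A"] by (simp add: D_def)
    have dE: "dag E = E" "dag D = D" by (simp_all add: E_def D_def dag_mexp dag_simps A)
    have ED: "X ** E ** D = X" "X ** D ** E = X" for X by (simp_all add: E_def D_def)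
    have DE: "D ** E = mat 1" by (simp add: E_def D_def)
    have "f' t = ip (D ** (D ** B ** E) ** E) B" by (simp add: f'_def EE DD matrix_mul_assoc)
    also have "\<dots> = ip (D ** B ** E) (D ** (B ** E))"
      by (subst ip_cycle(2)) (subst ip_cycle(1), simp add: dE matrix_mul_assoc)
    finally have eq: "f' t = ip (D ** B ** E) (D ** B ** E)" by (simp add: matrix_mul_assoc)
    have "D ** B ** E \<noteq> 0"
    proof
      assume "D ** B ** E = 0"
      then have "E ** (D ** B ** E) ** D = 0" by (simp add: mmul.zero_left mmul.zero_right)
      then have "E ** D ** B = 0" by (simp add: matrix_mul_assoc ED)
      then show False using B(2) by (simp add: E_def D_def)
    qed
    then show ?thesis unfolding eq by (rule ip_pos)
  qed
  have "\<exists>u\<in>{0..1}. f 1 - f 0 = (\<lambda>h. h *\<^sub>R f' u) (1 - 0)"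
    by (rule mvt_very_simple) (use f in \<open>auto simp: has_vector_derivative_def\<close>)
  then show ?thesis using pos by (auto simp: f_def ip.zero_left)
qed

text \<open>The Hermitian part T of \<open>dexp\<close> maps \<open>herm\<close> to itself. By
  \<open>dexp_pos\<close> the inner product of T B and B is positive for B \<noteq> 0, so T is
  injective, hence surjective by dimension.\<close>

lemma dexp_herm_surj:
  assumes A: "A \<in> herm" and H: "H \<in> herm"
  obtains B where "B \<in> herm" "(1/2) *\<^sub>R (dexp A B 1 + dag (dexp A B 1)) = H"
proof -
  define T where "T B = (1/2) *\<^sub>R (dexp A B 1 + dag (dexp A B 1))" for B
  have lin: "linear T"
    unfolding T_def by (rule linearI) (simp_all add: linear_add[OF linear_dexp] linear_scale[OF linear_dexp] dag_simps algebra_simps)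
  have T_herm: "T B \<in> herm" if "B \<in> herm" for B
    unfolding T_def by (intro herm_part dexp_clie hermD A that)
  have "B = 0" if B: "B \<in> herm" "T B = 0" for B
  proof (rule ccontr)
    assume "B \<noteq> 0"
    have "ip (dag (dexp A B 1)) B = ip (dexp A B 1) B"
      using ip_dag[of "dexp A B 1" B] hermD(2)[OF B(1)] by simp
    then have "ip (T B) B = ip (dexp A B 1) B" by (simp add: T_def ip_simps)
    then show False using dexp_pos[OF hermD(2)[OF A] hermD(2)[OF B(1)] \<open>B \<noteq> 0\<close>] B(2) by (simp add: ip.zero_left)
  qed
  then have inj: "inj_on T herm"
    by (subst linear_injective_on_subspace_0[OF lin subspace_herm]) simp
  have "dim (T ` herm) = dim herm"
    by (rule dim_image_eq[OF lin]) (simp add: inj span_eq_iff[THEN iffD2, OF subspace_herm])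
  then have "T ` herm = herm"
    using T_herm by (intro subspace_dim_equal linear_subspace_image lin subspace_herm) auto
  then obtain B where "B \<in> herm" "T B = H" using H by (metis imageE)
  then show ?thesis using that by (simp add: T_def)
qed

end

section \<open>Frames and the polar decomposition\<close>

lemma frame_unique:
  fixes g h :: "real \<Rightarrow> 'n::finite cmat"
  assumes \<xi>: "continuous_on {0..1} \<xi>"
    and g: "\<And>t. t \<in> {0..1} \<Longrightarrow> (g has_vector_derivative g t ** \<xi> t) (at t within {0..1})"
    and h: "\<And>t. t \<in> {0..1} \<Longrightarrow> (h has_vector_derivative h t ** \<xi> t) (at t within {0..1})"
    and "g 0 = h 0" "t \<in> {0..1}"
  shows "g t = h t"
proof -
  obtain K where K: "K \<ge> 1" "\<And>(A :: 'n cmat) (B :: 'n cmat). norm (A ** B) \<le> K * norm A * norm B"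
    using mmul_norm_bound by blast
  have "bounded (\<xi> ` {0..1})" by (intro compact_imp_bounded compact_continuous_image \<xi>) auto
  then obtain M where M: "M > 0" "\<And>t. t \<in> {0..1} \<Longrightarrow> norm (\<xi> t) \<le> M" unfolding bounded_pos by blast
  have "g t - h t = 0"
  proof (rule linear_ode_zero[where a=0 and b=1 and z="\<lambda>t. g t - h t" and w="\<lambda>t. (g t - h t) ** \<xi> t" and L="K * M"])
    fix s :: real assume s: "s \<in> {0..1}"
    show "((\<lambda>t. g t - h t) has_vector_derivative (g s - h s) ** \<xi> s) (at s within {0..1})"
      using has_vector_derivative_diff[OF g[OF s] h[OF s]] by (simp add: mmul_simps)
    have "norm ((g s - h s) ** \<xi> s) \<le> K * norm (g s - h s) * norm (\<xi> s)" by (rule K)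
    also have "\<dots> \<le> K * norm (g s - h s) * M" using K(1) M(2)[OF s] by (intro mult_left_mono) auto
    finally show "norm ((g s - h s) ** \<xi> s) \<le> K * M * norm (g s - h s)" by (simp add: mult_ac)
  qed (use assms in auto)
  then show ?thesis by simp
qed

text \<open>The future inverse d is produced as a solution of the dual equation, and
  \<open>frame_inverse\<close> identifies it since g d has derivative 0. The pair (g, d) is also
  what the viability argument needs.\<close>

lemma frame_exists:
  fixes \<xi> :: "real \<Rightarrow> 'n::finite cmat"
  assumes \<xi>: "continuous_on {0..1} \<xi>"
  obtains g d where "g 0 = mat 1" "d 0 = mat 1"
    "\<And>t. t \<in> {0..1} \<Longrightarrow> (g has_vector_derivative g t ** \<xi> t) (at t within {0..1})"
    "\<And>t. t \<in> {0..1} \<Longrightarrow> (d has_vector_derivative - (\<xi> t ** d t)) (at t within {0..1})"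
proof -
  obtain K where K: "K \<ge> 1" "\<And>(A :: 'n cmat) (B :: 'n cmat). norm (A ** B) \<le> K * norm A * norm B"
    using mmul_norm_bound by blast
  have "bounded (\<xi> ` {0..1})" by (intro compact_imp_bounded compact_continuous_image \<xi>) auto
  then obtain M where M: "M > 0" "\<And>t. t \<in> {0..1} \<Longrightarrow> norm (\<xi> t) \<le> M" unfolding bounded_pos by blast
  have \<xi>': "continuous_on ({0..1} \<times> UNIV) (\<lambda>x. \<xi> (fst x))"
    by (rule continuous_on_compose2[OF \<xi>]) (auto intro!: continuous_intros)
  have "\<exists>g. g 0 = mat 1 \<and> (\<forall>t\<in>{0..1}. (g has_vector_derivative g t ** \<xi> t) (at t within {0..1}))"
  proof (rule picard_global[where L="K * M"])
    show "continuous_on ({0..1} \<times> UNIV) (\<lambda>(t, x :: 'n cmat). x ** \<xi> t)"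
      unfolding split_beta by (intro continuous_intros \<xi>')
    fix t :: real and x y :: "'n cmat" assume t: "t \<in> {0..1}"
    have "norm ((x - y) ** \<xi> t) \<le> K * norm (x - y) * norm (\<xi> t)" by (rule K)
    also have "\<dots> \<le> K * norm (x - y) * M" using K(1) M(2)[OF t] by (intro mult_left_mono) auto
    finally show "norm (x ** \<xi> t - y ** \<xi> t) \<le> K * M * norm (x - y)" by (simp add: mult_ac mmul_simps)
  qed
  moreover have "\<exists>d. d 0 = mat 1 \<and> (\<forall>t\<in>{0..1}. (d has_vector_derivative - (\<xi> t ** d t)) (at t within {0..1}))"
  proof (rule picard_global[where L="K * M"])
    show "continuous_on ({0..1} \<times> UNIV) (\<lambda>(t, x :: 'n cmat). - (\<xi> t ** x))"
      unfolding split_beta by (intro continuous_intros \<xi>')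
    fix t :: real and x y :: "'n cmat" assume t: "t \<in> {0..1}"
    have "norm (\<xi> t ** (x - y)) \<le> K * norm (\<xi> t) * norm (x - y)" by (rule K)
    also have "\<dots> \<le> K * M * norm (x - y)" using K(1) M(2)[OF t] by (intro mult_right_mono mult_left_mono) auto
    finally show "norm (- (\<xi> t ** x) - - (\<xi> t ** y)) \<le> K * M * norm (x - y)"
      by (simp add: mmul_simps norm_minus_commute)
  qed
  ultimately show ?thesis using that by blast
qed

lemma frame_inverse:
  fixes g d :: "real \<Rightarrow> 'n::finite cmat"
  assumes g: "\<And>t. t \<in> {0..1} \<Longrightarrow> (g has_vector_derivative g t ** \<xi> t) (at t within {0..1})"
    and d: "\<And>t. t \<in> {0..1} \<Longrightarrow> (d has_vector_derivative - (\<xi> t ** d t)) (at t within {0..1})"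
    and "g 0 ** d 0 = mat 1" and t: "t \<in> {0..1}"
  shows "g t ** d t = mat 1"
proof -
  have "g t ** d t = g 0 ** d 0"
  proof (rule has_vector_derivative_zero_eq[where z="\<lambda>t. g t ** d t" and a=0 and b=1, OF _ t])
    fix s :: real assume s: "s \<in> {0..1}"
    show "((\<lambda>t. g t ** d t) has_vector_derivative 0) (at s within {0..1})"
      using has_vector_derivative_mmul[OF g[OF s] d[OF s]] by (simp add: mmul_simps)
  qed
  then show ?thesis using assms(3) by simp
qed

context unitary_group
begin

section \<open>Polar decomposition of the complexification\<close>

definition polar :: "'a cmat set" where
  "polar = {mexp A ** k | A k. A \<in> herm \<and> k \<in> G}"

text \<open>Graph of the inversion over \<open>polar\<close>; unlike \<open>polar\<close> it is closed in the space of all matrices.\<close>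

definition polar_graph :: "('a cmat \<times> 'a cmat) set" where
  "polar_graph = {(mexp A ** k, dag k ** mexp (- A)) | A k. A \<in> herm \<and> k \<in> G}"

lemma herm_bound:
  obtains b where "b > 0" "\<And>A. A \<in> herm \<Longrightarrow> b * (norm A)\<^sup>2 \<le> ip (mexp A) (mexp A) + ip (mexp (- A)) (mexp (- A))"
proof -
  obtain c C where c: "c > 0" "\<And>A. c * (norm A)\<^sup>2 \<le> ip A A" using ip_norm_bounds by metis
  have "c * (norm A)\<^sup>2 \<le> ip (mexp A) (mexp A) + ip (mexp (- A)) (mexp (- A))" if "A \<in> herm" for A
    using mexp_hermitian_growth[OF hermD(2)[OF that]] c(2)[of A] ip_nonneg[of "mat 1"] ip_nonneg[of A] by linarith
  then show ?thesis using that c(1) by blast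
qed

text \<open>In a convergent sequence both exp A k and its inverse are bounded; unitary factors do
  not change \<open>ip\<close>, so exp A and exp (- A) are bounded, and with them A. The sequence
  thus lies in the continuous image of a compact part of \<open>herm\<close> times G.\<close>

lemma closed_polar_graph: "closed polar_graph"
  unfolding closed_sequential_limits
proof (intro allI impI, elim conjE)
  fix x l assume x: "\<forall>n. x n \<in> polar_graph" and lim: "x \<longlonglongrightarrow> l"
  obtain c C where C: "C > 0" "\<And>A. ip A A \<le> C * (norm A)\<^sup>2" using ip_norm_bounds by metis
  obtain b where b: "b > 0" "\<And>A. A \<in> herm \<Longrightarrow> b * (norm A)\<^sup>2 \<le> ip (mexp A) (mexp A) + ip (mexp (- A)) (mexp (- A))"
    by (rule herm_bound) blast
  obtain R where R: "R > 0" "\<And>n. norm (x n) \<le> R"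
    using convergent_imp_bounded[OF lim] unfolding bounded_pos by blast
  define S where "S = (herm \<inter> cball 0 (sqrt (2 * C * R\<^sup>2 / b))) \<times> G"
  define F where "F = (\<lambda>y. (mexp (fst y) ** snd y, dag (snd y) ** mexp (- fst y)))"
  have "compact S"
    unfolding S_def by (intro compact_Times cmp closed_Int_compact closed_subspace subspace_herm compact_cball)
  then have "compact (F ` S)"
    unfolding F_def by (intro compact_continuous_image continuous_intros)
  moreover have "x n \<in> F ` S" for n
  proof -
    obtain A k where Ak: "A \<in> herm" "k \<in> G" "x n = (mexp A ** k, dag k ** mexp (- A))"
      using x unfolding polar_graph_def by blast
    have "ip (mexp A) (mexp A) = ip (fst (x n)) (fst (x n))" using Ak by (simp add: ip_unitary)
    also have "\<dots> \<le> C * (norm (fst (x n)))\<^sup>2" by (rule C)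
    also have "\<dots> \<le> C * R\<^sup>2" using C(1) R(2)[of n] norm_fst_le[of "fst (x n)" "snd (x n)"] by (intro mult_left_mono power_mono) auto
    finally have 1: "ip (mexp A) (mexp A) \<le> C * R\<^sup>2" .
    have "ip (mexp (- A)) (mexp (- A)) = ip (snd (x n)) (snd (x n))" using Ak dag_G by (simp add: ip_unitary)
    also have "\<dots> \<le> C * (norm (snd (x n)))\<^sup>2" by (rule C)
    also have "\<dots> \<le> C * R\<^sup>2" using C(1) R(2)[of n] norm_snd_le[of "snd (x n)" "fst (x n)"] by (intro mult_left_mono power_mono) auto
    finally have "b * (norm A)\<^sup>2 \<le> 2 * C * R\<^sup>2" using 1 b(2)[OF Ak(1)] by simp
    then have "(norm A)\<^sup>2 \<le> 2 * C * R\<^sup>2 / b" using b(1) by (simp add: field_simps)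
    then have "norm A \<le> sqrt (2 * C * R\<^sup>2 / b)" by (rule real_le_rsqrt)
    then have "(A, k) \<in> S" using Ak by (simp add: S_def)
    moreover have "x n = F (A, k)" using Ak by (simp add: F_def)
    ultimately show ?thesis by blast
  qed
  ultimately have "l \<in> F ` S" using closed_sequentially[OF compact_imp_closed] lim by blast
  then show "l \<in> polar_graph" unfolding F_def S_def polar_graph_def by fastforce
qed

text \<open>At \<open>exp A k\<close> the velocity \<open>exp A k \<xi>\<close> is realized by \<open>exp (A + h B) exp (h \<eta>) k\<close>: the Hermitian
  part of \<open>k \<xi> k\<^sup>-\<^sup>1\<close> determines \<open>B\<close>, and then \<open>\<eta>\<close> is the remaining skew part.\<close>

lemma polar_tangent:
  assumes A: "A \<in> herm" and k: "k \<in> G" and \<xi>: "\<xi> \<in> clie"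
  obtains B \<eta> where "B \<in> herm" "\<eta> \<in> lie" "dexp A B 1 + \<eta> = k ** \<xi> ** dag k"
proof -
  define \<zeta> where "\<zeta> = k ** \<xi> ** dag k"
  have \<zeta>: "\<zeta> \<in> clie" unfolding \<zeta>_def by (rule clie_Ad[OF k \<xi>])
  obtain B where B: "B \<in> herm" "(1/2) *\<^sub>R (dexp A B 1 + dag (dexp A B 1)) = (1/2) *\<^sub>R (\<zeta> + dag \<zeta>)"
    by (rule dexp_herm_surj[OF A herm_part[OF \<zeta>]]) blast
  define \<eta> where "\<eta> = \<zeta> - dexp A B 1"
  have "dexp A B 1 + dag (dexp A B 1) = \<zeta> + dag \<zeta>" using B(2) by simp
  then have "dag \<eta> = - \<eta>" by (simp add: \<eta>_def dag_simps algebra_simps)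
  moreover have "\<eta> \<in> clie"
    unfolding \<eta>_def by (intro subspace_diff[OF subspace_clie] \<zeta> dexp_clie hermD A B)
  ultimately have "\<eta> \<in> lie" by (intro clie_skew)
  then show ?thesis using that[of B \<eta>] B(1) by (simp add: \<eta>_def \<zeta>_def)
qed

text \<open>The field (m, m') to (m \<xi>, - \<xi> m') is linear, hence Lipschitz uniformly in t. At
  a point of the graph \<open>polar_tangent\<close> provides a curve inside the graph with this
  velocity.\<close>

lemma polar_graph_viable:
  assumes \<xi>: "\<And>t. t \<in> {0..1} \<Longrightarrow> \<xi> t \<in> clie" "continuous_on {0..1} \<xi>"
    and g: "\<And>t. t \<in> {0..1} \<Longrightarrow> (g has_vector_derivative g t ** \<xi> t) (at t within {0..1})"
    and d: "\<And>t. t \<in> {0..1} \<Longrightarrow> (d has_vector_derivative - (\<xi> t ** d t)) (at t within {0..1})"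
    and start: "(g 0, d 0) \<in> polar_graph" and t: "t \<in> {0..1}"
  shows "(g t, d t) \<in> polar_graph"
proof -
  obtain K where K: "K \<ge> 1" "\<And>(A :: 'a cmat) (B :: 'a cmat). norm (A ** B) \<le> K * norm A * norm B"
    using mmul_norm_bound by blast
  have "bounded (\<xi> ` {0..1})" by (intro compact_imp_bounded compact_continuous_image \<xi>) auto
  then obtain M where M: "M > 0" "\<And>t. t \<in> {0..1} \<Longrightarrow> norm (\<xi> t) \<le> M" unfolding bounded_pos by blast
  show ?thesis
  proof (rule nagumo_viability[OF closed_polar_graph, where \<gamma>="\<lambda>t. (g t, d t)" and r=1 and L="K * M + K * M"
        and v="\<lambda>t. (g t ** \<xi> t, - (\<xi> t ** d t))", OF start _ _ _ t])
    fix s :: real assume s: "s \<in> {0..1}"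
    show "((\<lambda>t. (g t, d t)) has_vector_derivative (g s ** \<xi> s, - (\<xi> s ** d s))) (at s within {0..1})"
      by (rule has_vector_derivative_Pair[OF g[OF s] d[OF s]])
  next
    fix s :: real and x assume s: "s \<in> {0..<1}" and x: "x \<in> polar_graph"
    then have s1: "s \<in> {0..1}" by simp
    obtain A k where Ak: "A \<in> herm" "k \<in> G" "x = (mexp A ** k, dag k ** mexp (- A))"
      using x unfolding polar_graph_def by blast
    define m m' where "m = mexp A ** k" and "m' = dag k ** mexp (- A)"
    have mm': "m ** m' = mat 1" "m' ** m = mat 1"
      using Ak(2) by (simp_all add: m_def m'_def matrix_mul_assoc unitary_cancel unitary')
    obtain B \<eta> where B: "B \<in> herm" "\<eta> \<in> lie" "dexp A B 1 + \<eta> = k ** \<xi> s ** dag k"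
      by (rule polar_tangent[OF Ak(1,2) \<xi>(1)[OF s1]]) blast
    define c where "c h = mexp (A + h *\<^sub>R B) ** (mexp (h *\<^sub>R \<eta>) ** k)" for h
    define c' where "c' h = (dag k ** mexp (h *\<^sub>R (- \<eta>))) ** mexp (- A + h *\<^sub>R (- B))" for h
    have cd: "(c has_vector_derivative m ** \<xi> s) (at 0)"
    proof -
      have "(c has_vector_derivative mexp A ** (\<eta> ** k) + mexp A ** dexp A B 1 ** k) (at 0)"
        using has_vector_derivative_mmul[OF mexp_line_has_vector_derivative[of A B]
            has_vector_derivative_mmul_const(1)[OF mexp_has_vector_derivative_left[of \<eta> 0 UNIV], of k]]
        unfolding c_def[abs_def] by simp
      moreover have "mexp A ** (\<eta> ** k) + mexp A ** dexp A B 1 ** k = mexp A ** (dexp A B 1 + \<eta>) ** k"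
        by (simp add: mmul_simps)
      ultimately show ?thesis using Ak(2) by (simp add: B(3) m_def matrix_mul_assoc unitary_cancel)
    qed
    \<comment> \<open>Differentiability of c' suffices: differentiating
      \<open>c h ** c' h = mat 1\<close> at 0 forces the velocity w'.\<close>
    obtain w' where w': "(c' has_vector_derivative w') (at 0)"
      using has_vector_derivative_mmul[OF has_vector_derivative_mmul_const(2)[OF mexp_has_vector_derivative_left[of "- \<eta>" 0 UNIV], of "dag k"]
          mexp_line_has_vector_derivative[of "- A" "- B"]]
      unfolding c'_def[abs_def] by blast
    have cc': "c h ** c' h = mat 1" for h
      using Ak(2) mexp_minus_right[of "A + h *\<^sub>R B"] by (simp add: c_def c'_def matrix_mul_assoc unitary_cancel)
    have c0: "c 0 = m" "c' 0 = m'" by (simp_all add: c_def c'_def m_def m'_def)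
    have "((\<lambda>h. c h ** c' h) has_vector_derivative m ** w' + m ** \<xi> s ** m') (at 0)"
      using has_vector_derivative_mmul[OF cd w'] by (simp add: c0)
    moreover have "((\<lambda>h. c h ** c' h) has_vector_derivative 0) (at 0)" by (simp add: cc')
    ultimately have "m ** w' + m ** \<xi> s ** m' = 0" using vector_derivative_unique_at by blast
    then have "m' ** (m ** w' + m ** \<xi> s ** m') = 0" by (simp add: mmul.zero_right)
    then have w'_eq: "w' = - (\<xi> s ** m')" by (simp add: mmul_simps mm' eq_neg_iff_add_eq_0)
    have in_graph: "(c h, c' h) \<in> polar_graph" for h
    proof -
      have "A + h *\<^sub>R B \<in> herm" by (intro subspace_add[OF subspace_herm] subspace_scale[OF subspace_herm] Ak B)
      moreover have u: "mexp (h *\<^sub>R \<eta>) \<in> G" by (rule lie_algebra_mexp(1)[OF B(2)])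
      moreover have "c' h = dag (mexp (h *\<^sub>R \<eta>) ** k) ** mexp (- (A + h *\<^sub>R B))"
        using dag_lie[OF B(2)] by (simp add: c'_def dag_simps dag_mexp)
      ultimately show ?thesis unfolding polar_graph_def c_def using G_mult[OF u Ak(2)] by blast
    qed
    show "\<exists>c w. c 0 = x \<and> (\<forall>h\<ge>0. c h \<in> polar_graph) \<and> (c has_vector_derivative w) (at 0 within {0..}) \<and>
        norm (w - (g s ** \<xi> s, - (\<xi> s ** d s))) \<le> (K * M + K * M) * dist x (g s, d s)"
    proof (intro exI conjI allI impI)
      show "(c 0, c' 0) = x" using c0 Ak(3) by (simp add: m_def m'_def)
      show "(c h, c' h) \<in> polar_graph" for h by (rule in_graph)
      show "((\<lambda>h. (c h, c' h)) has_vector_derivative (m ** \<xi> s, - (\<xi> s ** m'))) (at 0 within {0..})"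
        by (rule has_vector_derivative_Pair[OF has_vector_derivative_at_within[OF cd] has_vector_derivative_at_within[OF w'[unfolded w'_eq]]])
      have n1: "norm (m - g s) \<le> dist x (g s, d s)" "norm (m' - d s) \<le> dist x (g s, d s)"
        using norm_fst_le[of "m - g s" "m' - d s"] norm_snd_le[of "m' - d s" "m - g s"] Ak(3) by (simp_all add: dist_norm m_def m'_def)
      have "norm ((m ** \<xi> s, - (\<xi> s ** m')) - (g s ** \<xi> s, - (\<xi> s ** d s))) = norm ((m - g s) ** \<xi> s, - (\<xi> s ** (m' - d s)))"
        by (simp add: mmul_simps)
      also have "\<dots> \<le> norm ((m - g s) ** \<xi> s) + norm (\<xi> s ** (m' - d s))"
        using norm_Pair_le[of "(m - g s) ** \<xi> s" "- (\<xi> s ** (m' - d s))"] by simp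
      also have "\<dots> \<le> K * norm (m - g s) * norm (\<xi> s) + K * norm (\<xi> s) * norm (m' - d s)" by (intro add_mono K)
      also have "\<dots> \<le> K * dist x (g s, d s) * M + K * M * dist x (g s, d s)"
        using K(1) M n1 s1 by (intro add_mono mult_mono mult_nonneg_nonneg) auto
      finally show "norm ((m ** \<xi> s, - (\<xi> s ** m')) - (g s ** \<xi> s, - (\<xi> s ** d s))) \<le> (K * M + K * M) * dist x (g s, d s)"
        by (simp add: algebra_simps)
    qed
  qed simp
qed

lemma polarI: "A \<in> herm \<Longrightarrow> k \<in> G \<Longrightarrow> mexp A ** k \<in> polar" by (auto simp: polar_def)

lemma polar_graph_fst: "(m, m') \<in> polar_graph \<Longrightarrow> m \<in> polar" by (auto simp: polar_graph_def polar_def)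

lemma zero_herm: "0 \<in> herm" using subspace_0[OF subspace_herm] .

lemma G_subset_polar: "k \<in> G \<Longrightarrow> k \<in> polar" using polarI[OF zero_herm, of k] by simp

text \<open>Viability with the constant field Z. This carries the group property: it absorbs a
  further exponential factor without any formula for the product of two Hermitian
  exponentials.\<close>

lemma polar_mexp: assumes m: "m \<in> polar" and Z: "Z \<in> clie" shows "m ** mexp Z \<in> polar"
proof -
  obtain A k where Ak: "A \<in> herm" "k \<in> G" "m = mexp A ** k" using m by (auto simp: polar_def)
  define m' where "m' = dag k ** mexp (- A)"
  have "(m ** mexp (1 *\<^sub>R Z), mexp (1 *\<^sub>R (- Z)) ** m') \<in> polar_graph"
  proof (rule polar_graph_viable[where \<xi>="\<lambda>_. Z" and g="\<lambda>t. m ** mexp (t *\<^sub>R Z)" and d="\<lambda>t. mexp (t *\<^sub>R (- Z)) ** m'" and t=1])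
    fix t
    show "((\<lambda>t. m ** mexp (t *\<^sub>R Z)) has_vector_derivative m ** mexp (t *\<^sub>R Z) ** Z) (at t within {0..1})"
      using has_vector_derivative_mmul_const(2)[OF mexp_has_vector_derivative_right[of Z t "{0..1}"], of m] by (simp add: matrix_mul_assoc)
    show "((\<lambda>t. mexp (t *\<^sub>R (- Z)) ** m') has_vector_derivative - (Z ** (mexp (t *\<^sub>R (- Z)) ** m'))) (at t within {0..1})"
      using has_vector_derivative_mmul_const(1)[OF mexp_has_vector_derivative_left[of "- Z" t "{0..1}"], of m'] by (simp add: mmul_simps)
  qed (use Z Ak in \<open>auto simp: polar_graph_def m'_def\<close>)
  then show ?thesis using polar_graph_fst by simp
qed

lemma matrix_group_polar: "matrix_group polar"
  unfolding matrix_group_def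
proof (intro conjI ballI)
  fix m assume "m \<in> polar"
  then obtain A k where Ak: "A \<in> herm" "k \<in> G" "m = mexp A ** k" by (auto simp: polar_def)
  show "invertible m" using Ak by (simp add: invertible_mult G_invertible)
  have "m ** (dag k ** mexp (- A)) = mat 1" using Ak by (simp add: matrix_mul_assoc unitary_cancel)
  then have inv: "matrix_inv m = dag k ** mexp (- A)" by (rule matrix_inv_eqI)
  show "matrix_inv m \<in> polar"
    unfolding inv by (rule polar_mexp[OF G_subset_polar[OF dag_G[OF Ak(2)]]])
      (intro subspace_neg[OF subspace_clie] hermD Ak)
  show "m ** m2 \<in> polar" if m2: "m2 \<in> polar" for m2
  proof -
    obtain B l where Bl: "B \<in> herm" "l \<in> G" "m2 = mexp B ** l" using m2 by (auto simp: polar_def)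
    have "m ** mexp B \<in> polar" by (rule polar_mexp[OF \<open>m \<in> polar\<close> hermD(1)[OF Bl(1)]])
    then obtain C j where "C \<in> herm" "j \<in> G" "m ** mexp B = mexp C ** j" by (auto simp: polar_def)
    then have "m ** m2 = mexp C ** (j ** l)" "C \<in> herm" "j ** l \<in> G"
      using Bl G_mult by (simp_all add: matrix_mul_assoc)
    then show ?thesis using polarI by simp
  qed
qed (rule G_subset_polar[OF G_one])

theorem complexification_polar: "complexification G = polar"
proof
  show "complexification G \<subseteq> polar"
    unfolding complexification_def
  proof (rule hull_minimal[where S=matrix_group])
    show "G \<union> mexp ` clie \<subseteq> polar"
      using G_subset_polar polar_mexp[OF G_subset_polar[OF G_one]] by auto
  qed (rule matrix_group_polar)
  show "polar \<subseteq> complexification G"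
  proof
    fix m assume "m \<in> polar"
    then obtain A k where Ak: "A \<in> herm" "k \<in> G" "m = mexp A ** k" by (auto simp: polar_def)
    show "m \<in> complexification G"
      unfolding complexification_def hull_def
    proof (rule InterI)
      fix H assume "H \<in> {T. matrix_group T \<and> G \<union> mexp ` clie \<subseteq> T}"
      then have H: "matrix_group H" "k \<in> H" "mexp A \<in> H" using Ak(2) hermD(1)[OF Ak(1)] by auto
      then show "m \<in> H" unfolding Ak(3) matrix_group_def by blast
    qed
  qed
qed

text \<open>For m = exp A k the product \<open>m ** dag m\<close> is exp A exp A; if it is 1 then A
  = 0 and m = k.\<close>

lemma polar_unitary: assumes "m \<in> polar" "m ** dag m = mat 1" shows "m \<in> G"
proof -
  obtain A k where Ak: "A \<in> herm" "k \<in> G" "m = mexp A ** k" using assms(1) by (auto simp: polar_def)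
  have "mexp A ** mexp A = m ** dag m"
    using Ak by (simp add: dag_simps dag_mexp hermD(2) matrix_mul_assoc unitary_cancel)
  then have "A = 0" using assms(2) by (intro mexp_hermitian_involution hermD(2) Ak) simp
  then show ?thesis using Ak by simp
qed

lemma frame_polar:
  assumes \<xi>: "\<And>t. t \<in> {0..1} \<Longrightarrow> \<xi> t \<in> clie" "continuous_on {0..1} \<xi>"
    and g: "\<And>t. t \<in> {0..1} \<Longrightarrow> (g has_vector_derivative g t ** \<xi> t) (at t within {0..1})"
    and "g 0 = mat 1" and t: "t \<in> {0..1}"
  shows "g t \<in> polar"
proof -
  obtain g' d where g': "g' 0 = mat 1" "d 0 = mat 1"
    "\<And>t. t \<in> {0..1} \<Longrightarrow> (g' has_vector_derivative g' t ** \<xi> t) (at t within {0..1})"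
    "\<And>t. t \<in> {0..1} \<Longrightarrow> (d has_vector_derivative - (\<xi> t ** d t)) (at t within {0..1})"
    by (rule frame_exists[OF \<xi>(2)]) blast
  have "mexp 0 ** mat 1 = (mat 1 :: 'a cmat)" "dag (mat 1) ** mexp (- 0) = mat 1" by simp_all
  then have "(g 0, d 0) \<in> polar_graph"
    unfolding polar_graph_def using g'(2) assms(4) zero_herm G_one by force
  then show ?thesis using polar_graph_viable[OF \<xi> g g'(4) _ t] polar_graph_fst by blast
qed

end

section \<open>Convexity along solutions\<close>

context adjoint_form
begin

text \<open>The mixed terms of the two squares agree by cyclicity. It is applied to the pair of
  \<alpha> and to the pairs of \<beta>; for the latter \<open>h ** a = b ** h\<close> removes the
  first square.\<close>

lemma commutator_identity:
  "ip (h ** a - b ** h) (h ** a - b ** h) - ip (h ** dag a - dag b ** h) (h ** dag a - dag b ** h)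
   = ip (h ** bracket a (dag a) - bracket b (dag b) ** h) h"
proof -
  have 1: "ip (h ** a ** dag a) h = ip (h ** a) (h ** a)" "ip (h ** dag a ** a) h = ip (h ** dag a) (h ** dag a)"
    by (simp_all add: ip_cycle(2))
  have 2: "ip (b ** dag b ** h) h = ip (dag b ** h) (dag b ** h)" "ip (dag b ** b ** h) h = ip (b ** h) (b ** h)"
    by (simp_all add: matrix_mul_assoc[symmetric] ip_cycle(1)[of b "dag b ** h"] ip_cycle(1)[of "dag b" "b ** h"])
  have "ip (h ** a) (b ** h) = ip (dag b ** h) (h ** dag a)"
  proof -
    have "ip (h ** a) (b ** h) = ip h (b ** h ** dag a)" by (rule ip_cycle(2))
    also have "\<dots> = ip (b ** (h ** dag a)) h" by (subst ip_commute) (simp add: matrix_mul_assoc)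
    also have "\<dots> = ip (h ** dag a) (dag b ** h)" by (rule ip_cycle(1))
    finally show ?thesis by (simp add: ip_commute)
  qed
  then show ?thesis
    unfolding bracket_def
    by (simp add: mmul_simps ip_simps 1 2 ip_commute[of "b ** h" "h ** a"] ip_commute[of "h ** dag a" "dag b ** h"])
qed

text \<open>The real Nahm equation with \<open>dag\<close> in place of \<open>star G\<close>, solved
  for the derivative so that differentiability is part of it.\<close>

definition real_eq :: "(real \<Rightarrow> 'n cmat) \<Rightarrow> (3 \<Rightarrow> real \<Rightarrow> 'n cmat) \<Rightarrow> bool" where
  "real_eq \<alpha> \<beta> \<longleftrightarrow> (\<forall>t\<in>{0..1}. ((\<lambda>t. \<alpha> t + dag (\<alpha> t)) has_vector_derivative
     - (2 *\<^sub>R (bracket (\<alpha> t) (dag (\<alpha> t)) + (\<Sum>i\<in>UNIV. bracket (\<beta> i t) (dag (\<beta> i t)))))) (at t within {0..1}))"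

text \<open>The second derivative of \<open>norm\<^sup>2 h\<close> is \<open>4 |h S\<^sub>1 - S\<^sub>2 h|\<^sup>2 + 4 \<Sum> |h \<beta>\<^sub>1\<^sup>* - \<beta>\<^sub>2\<^sup>* h|\<^sup>2\<close> where \<open>S\<^sub>j = \<alpha>\<^sub>j + \<alpha>\<^sub>j\<^sup>*\<close>.\<close>

lemma transition_convex:
  assumes r1: "real_eq \<alpha>1 \<beta>1" and r2: "real_eq \<alpha>2 \<beta>2"
    and h: "\<And>t. t \<in> {0..1} \<Longrightarrow> (h has_vector_derivative 2 *\<^sub>R (h t ** \<alpha>1 t - \<alpha>2 t ** h t)) (at t within {0..1})"
    and \<beta>: "\<And>t i. t \<in> {0..1} \<Longrightarrow> h t ** \<beta>1 i t = \<beta>2 i t ** h t"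
    and t: "t \<in> {0..1}"
  shows "ip (h t) (h t) \<le> max (ip (h 0) (h 0)) (ip (h 1) (h 1))"
proof -
  define S1 S2 where "S1 t = \<alpha>1 t + dag (\<alpha>1 t)" and "S2 t = \<alpha>2 t + dag (\<alpha>2 t)" for t
  define S1' S2' where
    "S1' t = - (2 *\<^sub>R (bracket (\<alpha>1 t) (dag (\<alpha>1 t)) + (\<Sum>i\<in>UNIV. bracket (\<beta>1 i t) (dag (\<beta>1 i t)))))" and
    "S2' t = - (2 *\<^sub>R (bracket (\<alpha>2 t) (dag (\<alpha>2 t)) + (\<Sum>i\<in>UNIV. bracket (\<beta>2 i t) (dag (\<beta>2 i t)))))" for t
  have S1: "(S1 has_vector_derivative S1' t) (at t within {0..1})" and S2: "(S2 has_vector_derivative S2' t) (at t within {0..1})"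
    if "t \<in> {0..1}" for t
    using r1 r2 that by (auto simp: real_eq_def S1_def[abs_def] S2_def[abs_def] S1'_def S2'_def)
  define h' where "h' t = 2 *\<^sub>R (h t ** \<alpha>1 t - \<alpha>2 t ** h t)" for t
  define w where "w t = h t ** S1 t - S2 t ** h t" for t
  have h_der: "(h has_vector_derivative h' t) (at t within {0..1})" if "t \<in> {0..1}" for t
    using h[OF that] by (simp add: h'_def)
  have w_der: "(w has_vector_derivative (h t ** S1' t + h' t ** S1 t) - (S2 t ** h' t + S2' t ** h t)) (at t within {0..1})"
    if "t \<in> {0..1}" for t
    unfolding w_def[abs_def]
    by (intro has_vector_derivative_diff has_vector_derivative_mmul h_der S1 S2 that)
  have self: "dag (S1 t) = S1 t" "dag (S2 t) = S2 t" for t by (simp_all add: S1_def S2_def dag_add add.commute)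
  \<comment> \<open>Re trace does not distinguish \<alpha> from its adjoint here, so h' may be
    replaced by \<open>w\<close>, in which only the Hermitian parts S occur; the real equation
    governs exactly these.\<close>
  have f1: "2 * ip (h' t) (h t) = 2 * ip (w t) (h t)" for t
  proof -
    have "ip (h t ** dag (\<alpha>1 t)) (h t) = ip (h t ** \<alpha>1 t) (h t)"
      using ip_cycle(2)[of "h t" "\<alpha>1 t" "h t"] ip_commute by metis
    moreover have "ip (dag (\<alpha>2 t) ** h t) (h t) = ip (\<alpha>2 t ** h t) (h t)"
      using ip_cycle(1)[of "\<alpha>2 t" "h t" "h t"] ip_commute by metis
    ultimately show ?thesis by (simp add: h'_def w_def S1_def S2_def mmul_simps ip_simps)
  qed
  show ?thesis
  proof (rule convex_le_endpoints[where f="\<lambda>t. ip (h t) (h t)" and f'="\<lambda>t. 2 * ip (w t) (h t)"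
        and f''="\<lambda>t. 4 * ip (w t) (w t) + 4 * (\<Sum>i\<in>UNIV. ip (h t ** dag (\<beta>1 i t) - dag (\<beta>2 i t) ** h t) (h t ** dag (\<beta>1 i t) - dag (\<beta>2 i t) ** h t))", OF _ _ _ t])
    fix t :: real assume t: "t \<in> {0..1}"
    show "((\<lambda>t. ip (h t) (h t)) has_vector_derivative 2 * ip (w t) (h t)) (at t within {0..1})"
      using ip_has_vector_derivative[OF h_der[OF t] h_der[OF t]] f1[of t] ip_commute[of "h t" "h' t"] by simp
    show "0 \<le> 4 * ip (w t) (w t) + 4 * (\<Sum>i\<in>UNIV. ip (h t ** dag (\<beta>1 i t) - dag (\<beta>2 i t) ** h t) (h t ** dag (\<beta>1 i t) - dag (\<beta>2 i t) ** h t))"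
      by (intro add_nonneg_nonneg mult_nonneg_nonneg sum_nonneg ip_nonneg) auto
    define w' where "w' = (h t ** S1' t + h' t ** S1 t) - (S2 t ** h' t + S2' t ** h t)"
    have "((\<lambda>t. 2 * ip (w t) (h t)) has_vector_derivative 2 * (ip w' (h t) + ip (w t) (h' t))) (at t within {0..1})"
      unfolding w'_def
      by (rule bounded_linear.has_vector_derivative[OF bounded_linear_mult_right ip_has_vector_derivative[OF w_der[OF t] h_der[OF t]]])
    moreover have "2 * (ip w' (h t) + ip (w t) (h' t)) = 4 * ip (w t) (w t) + 4 * (\<Sum>i\<in>UNIV. ip (h t ** dag (\<beta>1 i t) - dag (\<beta>2 i t) ** h t) (h t ** dag (\<beta>1 i t) - dag (\<beta>2 i t) ** h t))"
    proof -
      \<comment> \<open>With h' = 2 x and w = x + y the \<alpha>-terms of the second derivative are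
        8 <x, x + y> - 4 (|x|^2 - |y|^2), which is 4 |x + y|^2.\<close>
      define x y where "x = h t ** \<alpha>1 t - \<alpha>2 t ** h t" and "y = h t ** dag (\<alpha>1 t) - dag (\<alpha>2 t) ** h t"
      have h'x: "h' t = 2 *\<^sub>R x" by (simp add: h'_def x_def)
      have wxy: "w t = x + y" by (simp add: w_def x_def y_def S1_def S2_def mmul_simps algebra_simps)
      have "ip (h' t ** S1 t) (h t) = ip (h' t) (h t ** S1 t)" by (simp add: ip_cycle(2) self)
      moreover have "ip (S2 t ** h' t) (h t) = ip (h' t) (S2 t ** h t)" by (simp add: ip_cycle(1) self)
      ultimately have "ip w' (h t) = ip (h' t) (w t) + ip (h t ** S1' t - S2' t ** h t) (h t)"
        by (simp add: w'_def w_def ip_simps)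
      moreover have "ip (h t ** S1' t - S2' t ** h t) (h t) = - 2 * (ip x x - ip y y)
          + 2 * (\<Sum>i\<in>UNIV. ip (h t ** dag (\<beta>1 i t) - dag (\<beta>2 i t) ** h t) (h t ** dag (\<beta>1 i t) - dag (\<beta>2 i t) ** h t))"
      proof -
        have b: "ip (h t ** bracket (\<beta>1 i t) (dag (\<beta>1 i t)) - bracket (\<beta>2 i t) (dag (\<beta>2 i t)) ** h t) (h t)
            = - ip (h t ** dag (\<beta>1 i t) - dag (\<beta>2 i t) ** h t) (h t ** dag (\<beta>1 i t) - dag (\<beta>2 i t) ** h t)" for i
          using commutator_identity[of "h t" "\<beta>1 i t" "\<beta>2 i t"] \<beta>[OF t, of i] by (simp add: ip.zero_left)
        have a: "ip (h t ** bracket (\<alpha>1 t) (dag (\<alpha>1 t)) - bracket (\<alpha>2 t) (dag (\<alpha>2 t)) ** h t) (h t) = ip x x - ip y y"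
          using commutator_identity[of "h t" "\<alpha>1 t" "\<alpha>2 t"] by (simp add: x_def y_def)
        have "h t ** S1' t - S2' t ** h t = (- 2) *\<^sub>R ((h t ** bracket (\<alpha>1 t) (dag (\<alpha>1 t)) - bracket (\<alpha>2 t) (dag (\<alpha>2 t)) ** h t)
            + (\<Sum>i\<in>UNIV. h t ** bracket (\<beta>1 i t) (dag (\<beta>1 i t)) - bracket (\<beta>2 i t) (dag (\<beta>2 i t)) ** h t))"
          by (simp add: S1'_def S2'_def mmul_simps mmul.sum_left mmul.sum_right sum_subtractf algebra_simps)
        then have "ip (h t ** S1' t - S2' t ** h t) (h t) = (- 2) * (ip (h t ** bracket (\<alpha>1 t) (dag (\<alpha>1 t)) - bracket (\<alpha>2 t) (dag (\<alpha>2 t)) ** h t) (h t)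
            + (\<Sum>i\<in>UNIV. ip (h t ** bracket (\<beta>1 i t) (dag (\<beta>1 i t)) - bracket (\<beta>2 i t) (dag (\<beta>2 i t)) ** h t) (h t)))"
          by (simp only: ip.scaleR_left ip.add_left ip.sum_left real_scaleR_def)
        then show ?thesis unfolding a b by (simp add: sum_negf algebra_simps)
      qed
      ultimately show ?thesis
        by (simp add: h'x wxy ip_simps ip_commute[of y x] algebra_simps)
    qed
    ultimately show "((\<lambda>t. 2 * ip (w t) (h t)) has_vector_derivative
        4 * ip (w t) (w t) + 4 * (\<Sum>i\<in>UNIV. ip (h t ** dag (\<beta>1 i t) - dag (\<beta>2 i t) ** h t) (h t ** dag (\<beta>1 i t) - dag (\<beta>2 i t) ** h t))) (at t within {0..1})"
      by (simp only:)
  qed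
qed

text \<open>Let n be the value of \<open>ip\<close> at 1. Convexity bounds |h|^2 and, for the
  inverse k, |k|^2 by n, while h and \<open>dag k\<close> have inner product Re trace (h k) = n.
  Hence |h - \<open>dag k\<close>|^2 <= n + n - 2 n.\<close>

theorem transition_unitary:
  assumes r1: "real_eq \<alpha>1 \<beta>1" and r2: "real_eq \<alpha>2 \<beta>2"
    and h: "\<And>t. t \<in> {0..1} \<Longrightarrow> (h has_vector_derivative 2 *\<^sub>R (h t ** \<alpha>1 t - \<alpha>2 t ** h t)) (at t within {0..1})"
    and k: "\<And>t. t \<in> {0..1} \<Longrightarrow> (k has_vector_derivative 2 *\<^sub>R (k t ** \<alpha>2 t - \<alpha>1 t ** k t)) (at t within {0..1})"
    and hk: "\<And>t. t \<in> {0..1} \<Longrightarrow> h t ** k t = mat 1"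
    and \<beta>: "\<And>t i. t \<in> {0..1} \<Longrightarrow> h t ** \<beta>1 i t = \<beta>2 i t ** h t"
    and ends: "h 0 ** dag (h 0) = mat 1" "h 1 ** dag (h 1) = mat 1" and t: "t \<in> {0..1}"
  shows "h t ** dag (h t) = mat 1"
proof -
  have kh: "k t ** h t = mat 1" if "t \<in> {0..1}" for t by (rule matrix_left_right_inverse1[OF hk[OF that]])
  have k\<beta>: "k t ** \<beta>2 i t = \<beta>1 i t ** k t" if t: "t \<in> {0..1}" for t i
  proof -
    have "k t ** (h t ** \<beta>1 i t) ** k t = k t ** (\<beta>2 i t ** h t) ** k t" by (simp add: \<beta>[OF t])
    moreover have "k t ** (h t ** \<beta>1 i t) ** k t = \<beta>1 i t ** k t" by (simp add: matrix_mul_assoc kh[OF t])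
    moreover have "k t ** (\<beta>2 i t ** h t) ** k t = k t ** \<beta>2 i t" by (simp add: matrix_mul_assoc[symmetric] hk[OF t])
    ultimately show ?thesis by simp
  qed
  have k_ends: "k 0 = dag (h 0)" "k 1 = dag (h 1)"
    using matrix_inv_eqI[OF ends(1)] matrix_inv_eqI[OF hk[of 0]] matrix_inv_eqI[OF ends(2)] matrix_inv_eqI[OF hk[of 1]] by auto
  have n: "ip (h 0) (h 0) = ip (mat 1) (mat 1)" "ip (h 1) (h 1) = ip (mat 1) (mat 1)"
    using ends by (simp_all add: ip_def)
  have "ip (h t) (h t) \<le> ip (mat 1) (mat 1)"
    using transition_convex[OF r1 r2 h \<beta> t] by (simp add: n)
  moreover have "ip (k t) (k t) \<le> ip (mat 1) (mat 1)"
    using transition_convex[OF r2 r1 k k\<beta> t] by (simp add: k_ends ip_dag n)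
  moreover have "ip (h t) (dag (k t)) = ip (mat 1) (mat 1)" by (simp add: ip_def hk[OF t])
  ultimately have "ip (h t - dag (k t)) (h t - dag (k t)) \<le> 0"
    by (simp add: ip_simps ip_dag ip_commute[of "dag (k t)"] del: ip_nonneg)
  then have "h t = dag (k t)" using ip_eq_0 by (metis eq_iff_diff_eq_0)
  then show ?thesis using hk[OF t] by simp
qed

section \<open>A priori bounds\<close>

text \<open>In the gauge in which \<open>\<alpha>\<close> is Hermitian the equations together with the frame form a quadratic
  initial value problem.\<close>

definition temporal :: "(real \<Rightarrow> 'n cmat) \<Rightarrow> (3 \<Rightarrow> real \<Rightarrow> 'n cmat) \<Rightarrow> (real \<Rightarrow> 'n cmat) \<Rightarrow> bool" where
  "temporal \<alpha> \<beta> g \<longleftrightarrow> (\<forall>t\<in>{0..1}. dag (\<alpha> t) = \<alpha> t \<and>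
     (\<alpha> has_vector_derivative - (\<Sum>i\<in>UNIV. bracket (\<beta> i t) (dag (\<beta> i t)))) (at t within {0..1}) \<and>
     (\<forall>i. (\<beta> i has_vector_derivative - (2 *\<^sub>R bracket (\<alpha> t) (\<beta> i t))) (at t within {0..1})) \<and>
     (g has_vector_derivative 2 *\<^sub>R (g t ** \<alpha> t)) (at t within {0..1}))"

lemma temporal_real_eq: assumes "temporal \<alpha> \<beta> g" shows "real_eq \<alpha> \<beta>"
  unfolding real_eq_def
proof
  fix t :: real assume t: "t \<in> {0..1}"
  have d: "dag (\<alpha> s) = \<alpha> s" if "s \<in> {0..1}" for s using assms that by (simp add: temporal_def)
  have a: "(\<alpha> has_vector_derivative - (\<Sum>i\<in>UNIV. bracket (\<beta> i t) (dag (\<beta> i t)))) (at t within {0..1})"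
    using assms t by (simp add: temporal_def)
  have "((\<lambda>t. \<alpha> t + dag (\<alpha> t)) has_vector_derivative
      - (2 *\<^sub>R (\<Sum>i\<in>UNIV. bracket (\<beta> i t) (dag (\<beta> i t))))) (at t within {0..1})"
  proof (rule has_vector_derivative_transform[OF t, where f="\<lambda>t. 2 *\<^sub>R \<alpha> t"])
    show "((\<lambda>t. 2 *\<^sub>R \<alpha> t) has_vector_derivative - (2 *\<^sub>R (\<Sum>i\<in>UNIV. bracket (\<beta> i t) (dag (\<beta> i t))))) (at t within {0..1})"
      using bounded_linear.has_vector_derivative[OF bounded_linear_scaleR_right a, of 2] by simp
  qed (simp add: d scaleR_2)
  then show "((\<lambda>t. \<alpha> t + dag (\<alpha> t)) has_vector_derivative
      - (2 *\<^sub>R (bracket (\<alpha> t) (dag (\<alpha> t)) + (\<Sum>i\<in>UNIV. bracket (\<beta> i t) (dag (\<beta> i t)))))) (at t within {0..1})"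
    by (simp add: d[OF t] bracket_def[of "\<alpha> t" "\<alpha> t"])
qed

lemma has_vector_derivative_bracket:
  assumes "(f has_vector_derivative f') (at t within S)" "(g has_vector_derivative g') (at t within S)"
  shows "((\<lambda>t. bracket (f t) (g t)) has_vector_derivative bracket f' (g t) + bracket (f t) g') (at t within S)"
  using has_vector_derivative_diff[OF has_vector_derivative_mmul[OF assms] has_vector_derivative_mmul[OF assms(2,1)]]
  by (simp add: bracket_def algebra_simps)

lemma bracket_ip: "ip (bracket a b) c = ip a (bracket c (dag b))" "dag a = a \<Longrightarrow> ip (bracket a b) c = ip b (bracket a c)"
  proof -
  show "ip (bracket a b) c = ip a (bracket c (dag b))"
    by (simp add: bracket_def ip_simps ip_cycle(2)[of a b] ip_cycle(1)[of b a])
  show "ip (bracket a b) c = ip b (bracket a c)" if "dag a = a"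
    using that by (simp add: bracket_def ip_simps ip_cycle(1)[of a b] ip_cycle(2)[of b a])
qed

text \<open>The second derivative is 4 |\<alpha>'|^2 + 4 times the sum of the |\<beta>'|^2: the
  terms containing \<alpha>' pair it with the sum of the brackets of \<beta> with their adjoints,
  and that sum is -\<alpha>'.\<close>

lemma temporal_beta_le_endpoints:
  assumes T: "temporal \<alpha> \<beta> g" and t: "t \<in> {0..1}"
  shows "(\<Sum>i\<in>UNIV. ip (\<beta> i t) (\<beta> i t)) \<le> max (\<Sum>i\<in>UNIV. ip (\<beta> i 0) (\<beta> i 0)) (\<Sum>i\<in>UNIV. ip (\<beta> i 1) (\<beta> i 1))"
proof -
  define \<alpha>' where "\<alpha>' t = - (\<Sum>i\<in>UNIV. bracket (\<beta> i t) (dag (\<beta> i t)))" for t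
  define \<beta>' where "\<beta>' i t = - (2 *\<^sub>R bracket (\<alpha> t) (\<beta> i t))" for i t
  have \<alpha>: "(\<alpha> has_vector_derivative \<alpha>' t) (at t within {0..1})" "dag (\<alpha> t) = \<alpha> t"
    and \<beta>: "(\<beta> i has_vector_derivative \<beta>' i t) (at t within {0..1})" if "t \<in> {0..1}" for i t
    using T that by (auto simp: temporal_def \<alpha>'_def \<beta>'_def)
  show ?thesis
  proof (rule convex_le_endpoints[where f="\<lambda>t. \<Sum>i\<in>UNIV. ip (\<beta> i t) (\<beta> i t)" and f'="\<lambda>t. \<Sum>i\<in>UNIV. - 4 * ip (bracket (\<alpha> t) (\<beta> i t)) (\<beta> i t)"
        and f''="\<lambda>t. 4 * ip (\<alpha>' t) (\<alpha>' t) + 4 * (\<Sum>i\<in>UNIV. ip (\<beta>' i t) (\<beta>' i t))", OF _ _ _ t])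
    fix t :: real assume t: "t \<in> {0..1}"
    show "0 \<le> 4 * ip (\<alpha>' t) (\<alpha>' t) + 4 * (\<Sum>i\<in>UNIV. ip (\<beta>' i t) (\<beta>' i t))"
      by (intro add_nonneg_nonneg mult_nonneg_nonneg sum_nonneg ip_nonneg) auto
    show "((\<lambda>t. \<Sum>i\<in>UNIV. ip (\<beta> i t) (\<beta> i t)) has_vector_derivative (\<Sum>i\<in>UNIV. - 4 * ip (bracket (\<alpha> t) (\<beta> i t)) (\<beta> i t))) (at t within {0..1})"
    proof (rule has_vector_derivative_sum)
      show "((\<lambda>t. ip (\<beta> i t) (\<beta> i t)) has_vector_derivative - 4 * ip (bracket (\<alpha> t) (\<beta> i t)) (\<beta> i t)) (at t within {0..1})" for i
        using ip_has_vector_derivative[OF \<beta>[OF t, of i] \<beta>[OF t, of i]]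
        by (simp add: \<beta>'_def ip_simps ip_commute[of "\<beta> i t"])
    qed
    have "((\<lambda>t. \<Sum>i\<in>UNIV. - 4 * ip (bracket (\<alpha> t) (\<beta> i t)) (\<beta> i t)) has_vector_derivative
        (\<Sum>i\<in>UNIV. - 4 * (ip (bracket (\<alpha>' t) (\<beta> i t) + bracket (\<alpha> t) (\<beta>' i t)) (\<beta> i t) + ip (bracket (\<alpha> t) (\<beta> i t)) (\<beta>' i t)))) (at t within {0..1})"
      by (intro has_vector_derivative_sum bounded_linear.has_vector_derivative[OF bounded_linear_mult_right]
           ip_has_vector_derivative has_vector_derivative_bracket \<alpha> \<beta> t)
    moreover have "(\<Sum>i\<in>UNIV. - 4 * (ip (bracket (\<alpha>' t) (\<beta> i t) + bracket (\<alpha> t) (\<beta>' i t)) (\<beta> i t) + ip (bracket (\<alpha> t) (\<beta> i t)) (\<beta>' i t)))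
       = 4 * ip (\<alpha>' t) (\<alpha>' t) + 4 * (\<Sum>i\<in>UNIV. ip (\<beta>' i t) (\<beta>' i t))"
    proof -
      have "- 4 * (ip (bracket (\<alpha>' t) (\<beta> i t) + bracket (\<alpha> t) (\<beta>' i t)) (\<beta> i t) + ip (bracket (\<alpha> t) (\<beta> i t)) (\<beta>' i t))
          = - 4 * ip (\<alpha>' t) (bracket (\<beta> i t) (dag (\<beta> i t))) + 4 * ip (\<beta>' i t) (\<beta>' i t)" for i
      proof -
        have 1: "ip (bracket (\<alpha>' t) (\<beta> i t)) (\<beta> i t) = ip (\<alpha>' t) (bracket (\<beta> i t) (dag (\<beta> i t)))" by (rule bracket_ip(1))
        have 2: "ip (bracket (\<alpha> t) (\<beta>' i t)) (\<beta> i t) = ip (\<beta>' i t) (bracket (\<alpha> t) (\<beta> i t))" by (rule bracket_ip(2)[OF \<alpha>(2)[OF t]])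
        have 3: "bracket (\<alpha> t) (\<beta> i t) = (- 1/2) *\<^sub>R \<beta>' i t" by (simp add: \<beta>'_def)
        show ?thesis unfolding ip.add_left 1 2 unfolding 3 by (simp add: ip_simps)
      qed
      then have "(\<Sum>i\<in>UNIV. - 4 * (ip (bracket (\<alpha>' t) (\<beta> i t) + bracket (\<alpha> t) (\<beta>' i t)) (\<beta> i t) + ip (bracket (\<alpha> t) (\<beta> i t)) (\<beta>' i t)))
          = - 4 * (\<Sum>i\<in>UNIV. ip (\<alpha>' t) (bracket (\<beta> i t) (dag (\<beta> i t)))) + 4 * (\<Sum>i\<in>UNIV. ip (\<beta>' i t) (\<beta>' i t))"
        by (simp only: sum.distrib sum_distrib_left)
      also have "(\<Sum>i\<in>UNIV. ip (\<alpha>' t) (bracket (\<beta> i t) (dag (\<beta> i t)))) = - ip (\<alpha>' t) (\<alpha>' t)"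
        unfolding ip.sum_right[symmetric] by (simp add: \<alpha>'_def ip_simps)
      finally show ?thesis by simp
    qed
    ultimately show "((\<lambda>t. \<Sum>i\<in>UNIV. - 4 * ip (bracket (\<alpha> t) (\<beta> i t)) (\<beta> i t)) has_vector_derivative
        4 * ip (\<alpha>' t) (\<alpha>' t) + 4 * (\<Sum>i\<in>UNIV. ip (\<beta>' i t) (\<beta>' i t))) (at t within {0..1})"
      by (simp only:)
  qed
qed

text \<open>The Rayleigh quotient of \<open>\<alpha>\<close> at a solution of \<open>v' = 2 \<alpha> v\<close> decreases at most at the rate of \<open>\<alpha>\<close>.\<close>

lemma rayleigh_growth:
  assumes \<alpha>: "\<And>t. t \<in> {0..1} \<Longrightarrow> (\<alpha> has_vector_derivative \<alpha>' t) (at t within {0..1})"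
    and self: "\<And>t. t \<in> {0..1} \<Longrightarrow> dag (\<alpha> t) = \<alpha> t"
    and C: "C \<ge> 0" "\<And>t x. t \<in> {0..1} \<Longrightarrow> - C * ip x x \<le> ip (\<alpha>' t ** x) x"
    and v: "\<And>t. t \<in> {0..1} \<Longrightarrow> (v has_vector_derivative 2 *\<^sub>R (\<alpha> t ** v t)) (at t within {0..1})"
    and v0: "\<And>t. t \<in> {0..1} \<Longrightarrow> v t \<noteq> 0"
  shows "ip (v 0) (v 0) * exp (4 * (ip (\<alpha> 0 ** v 0) (v 0) / ip (v 0) (v 0) - C)) \<le> ip (v 1) (v 1)"
proof -
  define N where "N t = ip (v t) (v t)" for t
  define A where "A t = ip (\<alpha> t ** v t) (v t)" for t
  define r where "r t = A t / N t" for t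
  have N_pos: "0 < N t" if "t \<in> {0..1}" for t unfolding N_def by (rule ip_pos[OF v0[OF that]])
  have N: "(N has_real_derivative 4 * A t) (at t within {0..1})" if t: "t \<in> {0..1}" for t
    unfolding has_real_derivative_iff_has_vector_derivative N_def[abs_def]
    using ip_has_vector_derivative[OF v[OF t] v[OF t]] by (simp add: A_def ip_simps ip_commute[of "v t"])
  have A: "(A has_real_derivative ip (\<alpha>' t ** v t) (v t) + 4 * ip (\<alpha> t ** v t) (\<alpha> t ** v t)) (at t within {0..1})" if t: "t \<in> {0..1}" for t
  proof -
    have "(A has_vector_derivative ip (\<alpha> t ** (2 *\<^sub>R (\<alpha> t ** v t)) + \<alpha>' t ** v t) (v t) + ip (\<alpha> t ** v t) (2 *\<^sub>R (\<alpha> t ** v t))) (at t within {0..1})"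
      unfolding A_def[abs_def] by (intro ip_has_vector_derivative has_vector_derivative_mmul \<alpha> v t)
    moreover have "ip (\<alpha> t ** (\<alpha> t ** v t)) (v t) = ip (\<alpha> t ** v t) (\<alpha> t ** v t)"
      by (simp add: ip_cycle(1)[of "\<alpha> t" "\<alpha> t ** v t"] self[OF t])
    ultimately show ?thesis
      unfolding has_real_derivative_iff_has_vector_derivative by (simp add: ip_simps mmul.scaleR_right add.commute)
  qed
  have r: "(r has_real_derivative ((ip (\<alpha>' t ** v t) (v t) + 4 * ip (\<alpha> t ** v t) (\<alpha> t ** v t)) * N t - A t * (4 * A t)) / (N t * N t)) (at t within {0..1})"
    if t: "t \<in> {0..1}" for t
    unfolding r_def[abs_def] by (rule DERIV_divide[OF A[OF t] N[OF t]]) (use N_pos[OF t] in simp)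
  have r_ge: "r 0 - C \<le> r t" if t: "t \<in> {0..1}" for t
  proof -
    have "r 0 + C * 0 \<le> r t + C * t"
    proof (rule nondecreasing_of_deriv[where f="\<lambda>t. r t + C * t" and a=0 and b=1
          and f'="\<lambda>t. ((ip (\<alpha>' t ** v t) (v t) + 4 * ip (\<alpha> t ** v t) (\<alpha> t ** v t)) * N t - A t * (4 * A t)) / (N t * N t) + C"])
      fix s :: real assume s: "s \<in> {0..1}"
      show "((\<lambda>t. r t + C * t) has_vector_derivative ((ip (\<alpha>' s ** v s) (v s) + 4 * ip (\<alpha> s ** v s) (\<alpha> s ** v s)) * N s - A s * (4 * A s)) / (N s * N s) + C) (at s within {0..1})"
        unfolding has_real_derivative_iff_has_vector_derivative[symmetric]
        by (rule derivative_eq_intros r[OF s] refl)+ simp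
      \<comment> \<open>Cauchy-Schwarz makes the quadratic part of r' nonnegative, so that r' >= -
        C.\<close>
      have "A s * A s \<le> ip (\<alpha> s ** v s) (\<alpha> s ** v s) * N s"
        using ip_cauchy[of "\<alpha> s ** v s" "v s"] by (simp add: A_def N_def power2_eq_square)
      moreover have "- C * N s * N s \<le> ip (\<alpha>' s ** v s) (v s) * N s"
        using C(2)[OF s, of "v s"] N_pos[OF s] unfolding N_def by (intro mult_right_mono) auto
      ultimately have "- C * (N s * N s) \<le> (ip (\<alpha>' s ** v s) (v s) + 4 * ip (\<alpha> s ** v s) (\<alpha> s ** v s)) * N s - A s * (4 * A s)"
        by (simp add: algebra_simps)
      then have "- C \<le> ((ip (\<alpha>' s ** v s) (v s) + 4 * ip (\<alpha> s ** v s) (\<alpha> s ** v s)) * N s - A s * (4 * A s)) / (N s * N s)"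
        using N_pos[OF s] by (subst pos_le_divide_eq) auto
      then show "0 \<le> ((ip (\<alpha>' s ** v s) (v s) + 4 * ip (\<alpha> s ** v s) (\<alpha> s ** v s)) * N s - A s * (4 * A s)) / (N s * N s) + C" by simp
    qed (use t in auto)
    moreover have "C * t \<le> C" using t C(1) by (simp add: mult_left_le)
    ultimately show ?thesis by simp
  qed
  \<comment> \<open>Since N' = 4 r N and r >= r 0 - C, the function N grows at least like exp (q
    t).\<close>
  define q where "q = 4 * (r 0 - C)"
  have "N 0 * exp (- q * 0) \<le> N 1 * exp (- q * 1)"
  proof (rule nondecreasing_of_deriv[where f="\<lambda>t. N t * exp (- q * t)" and a=0 and b=1 and f'="\<lambda>t. (4 * A t - q * N t) * exp (- q * t)"])
    fix s :: real assume s: "s \<in> {0..1}"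
    show "((\<lambda>t. N t * exp (- q * t)) has_vector_derivative (4 * A s - q * N s) * exp (- q * s)) (at s within {0..1})"
      unfolding has_real_derivative_iff_has_vector_derivative[symmetric]
      by (rule derivative_eq_intros N[OF s] refl)+ (simp add: algebra_simps)
    have "A s = r s * N s" using N_pos[OF s] by (simp add: r_def)
    then have "4 * A s - q * N s = 4 * (r s - (r 0 - C)) * N s" by (simp add: q_def algebra_simps)
    also have "\<dots> \<ge> 0" using r_ge[OF s] N_pos[OF s] by (intro mult_nonneg_nonneg) auto
    finally show "0 \<le> (4 * A s - q * N s) * exp (- q * s)" by simp
  qed auto
  then have "N 0 * exp q \<le> N 1 * exp (- q) * exp q" by (intro mult_right_mono) auto
  moreover have "exp (- q) * exp q = 1" by (simp add: exp_add[symmetric])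
  ultimately have "N 0 * exp q \<le> N 1" by (simp add: mult.assoc)
  then show ?thesis by (simp add: N_def q_def r_def A_def)
qed

text \<open>Polarization at X, Y = 1 + A / c and 1 - A / c: the difference of the two quadratic
  forms is 4 |A|^2 / c, whereas the hypothesis bounds it by c (|X|^2 + |Y|^2) = 2 c |1|^2 + 2 |A|^2
  / c. Half of the left side is absorbed.\<close>

lemma numerical_radius_bound:
  assumes A: "dag A = A" and c: "c > 0" and b: "\<And>x. \<bar>ip (A ** x) x\<bar> \<le> c * ip x x"
  shows "ip A A \<le> c\<^sup>2 * ip (mat 1) (mat 1)"
proof -
  define X Y where "X = mat 1 + (1/c) *\<^sub>R A" and "Y = mat 1 - (1/c) *\<^sub>R A"
  have AA: "ip (A ** A) (mat 1) = ip A A" using ip_cycle(1)[of A A "mat 1"] by (simp add: A)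
  define e where "e = 1 / c"
  have XY: "X = mat 1 + e *\<^sub>R A" "Y = mat 1 - e *\<^sub>R A" by (simp_all add: X_def Y_def e_def)
  have "ip (A ** X) X - ip (A ** Y) Y = 4 * (e * ip A A)"
    by (simp add: XY mmul_simps ip_simps AA ip_commute[of "mat 1" A]) (simp add: algebra_simps)
  moreover have "ip (A ** X) X - ip (A ** Y) Y \<le> c * (ip X X + ip Y Y)"
    using b[of X] b[of Y] by (simp add: abs_le_iff distrib_left)
  moreover have "ip X X + ip Y Y = 2 * ip (mat 1) (mat 1) + 2 * (e * (e * ip A A))"
    by (simp add: XY ip_simps ip_commute[of "mat 1" A]) (simp add: algebra_simps)
  moreover have "c * (2 * ip (mat 1) (mat 1) + 2 * (e * (e * ip A A))) = 2 * (c * ip (mat 1) (mat 1)) + 2 * (e * ip A A)"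
    using c by (simp add: e_def distrib_left)
  ultimately have "e * ip A A \<le> c * ip (mat 1) (mat 1)" by simp
  then have "c * (e * ip A A) \<le> c * (c * ip (mat 1) (mat 1))" using c by simp
  then show ?thesis using c by (simp add: e_def power2_eq_square)
qed

end

section \<open>The boundary value problem\<close>

lemma norm_vec3_le: "norm (x :: 'a::real_inner^3) \<le> (\<Sum>i\<in>UNIV. norm (x $ i))"
  unfolding norm_vec_def by (rule L2_set_le_sum) simp

text \<open>From m^-1 - l^-1 = m^-1 (l - m) l^-1: once m is close to l, half of |m^-1| can be
  absorbed, which bounds the inverses by 2 |l^-1|; then the same identity gives convergence.\<close>

lemma tendsto_matrix_inv:
  fixes m :: "nat \<Rightarrow> 'n::finite cmat"
  assumes m: "m \<longlonglongrightarrow> l" and inv: "\<And>n. invertible (m n)" "invertible l"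
  shows "(\<lambda>n. matrix_inv (m n)) \<longlonglongrightarrow> matrix_inv l"
proof -
  obtain K where K: "K \<ge> 1" "\<And>(A :: 'n cmat) (B :: 'n cmat). norm (A ** B) \<le> K * norm A * norm B"
    using mmul_norm_bound by blast
  define c where "c = norm (matrix_inv l)"
  have diff: "matrix_inv (m n) - matrix_inv l = matrix_inv (m n) ** (l - m n) ** matrix_inv l" for n
    by (simp add: mmul_simps matrix_inv_mult[OF inv(1)]) (simp add: matrix_mul_assoc[symmetric] matrix_inv_mult[OF inv(2)])
  have bound: "norm (matrix_inv (m n) - matrix_inv l) \<le> (K * K * c * norm (matrix_inv (m n))) * norm (m n - l)" for n
  proof -
    have "norm (matrix_inv (m n) - matrix_inv l) \<le> K * (K * norm (matrix_inv (m n)) * norm (l - m n)) * c"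
      unfolding diff c_def by (intro order_trans[OF K(2)] mult_right_mono mult_left_mono K(2)) (use K(1) in auto)
    then show ?thesis by (simp add: norm_minus_commute mult_ac)
  qed
  have dist0: "(\<lambda>n. norm (m n - l)) \<longlonglongrightarrow> 0" using m by (intro tendsto_norm_zero LIM_zero)
  then have "(\<lambda>n. K * K * c * norm (m n - l)) \<longlonglongrightarrow> 0" by (rule tendsto_mult_right_zero)
  then have "eventually (\<lambda>n. K * K * c * norm (m n - l) < 1/2) sequentially" by (rule order_tendstoD(2)) simp
  then have "eventually (\<lambda>n. norm (matrix_inv (m n) - matrix_inv l) \<le> (K * K * c * (2 * c)) * norm (m n - l)) sequentially"
  proof eventually_elim
    case (elim n)
    have "norm (matrix_inv (m n)) \<le> norm (matrix_inv (m n) - matrix_inv l) + c"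
      unfolding c_def using norm_triangle_sub[of "matrix_inv (m n)" "matrix_inv l"] by simp
    also have "\<dots> \<le> (1/2) * norm (matrix_inv (m n)) + c"
      using bound[of n] mult_right_mono[OF less_imp_le[OF elim], of "norm (matrix_inv (m n))"] by (simp add: mult_ac)
    finally have "norm (matrix_inv (m n)) \<le> 2 * c" by simp
    then have "(K * K * c * norm (matrix_inv (m n))) * norm (m n - l) \<le> (K * K * c * (2 * c)) * norm (m n - l)"
      using K(1) by (intro mult_right_mono mult_left_mono) (auto simp: c_def)
    then show ?case using bound[of n] by linarith
  qed
  then have "(\<lambda>n. matrix_inv (m n) - matrix_inv l) \<longlonglongrightarrow> 0"
    by (rule Lim_null_comparison) (rule tendsto_mult_right_zero[OF dist0])
  then show ?thesis by (rule LIM_zero_cancel)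
qed

context adjoint_form
begin

text \<open>A priori bound: \<open>\<Sum> |\<beta>\<^sub>i|\<^sup>2\<close> is convex, hence bounded by its boundary values; this bounds
  \<open>\<alpha>'\<close>, and a large \<open>\<alpha> 0\<close> would then force \<open>g 1\<close> or its inverse to be large.\<close>

theorem temporal_bound:
  obtains B where "\<And>\<alpha> \<beta> g d t i. temporal \<alpha> \<beta> g \<Longrightarrow>
     (\<And>t. t \<in> {0..1} \<Longrightarrow> (d has_vector_derivative - (2 *\<^sub>R (\<alpha> t ** d t))) (at t within {0..1})) \<Longrightarrow>
     g 0 = mat 1 \<Longrightarrow> d 0 = mat 1 \<Longrightarrow> (\<And>t. t \<in> {0..1} \<Longrightarrow> g t ** d t = mat 1) \<Longrightarrow> (\<And>i. \<beta> i 1 = d 1 ** \<beta> i 0 ** g 1) \<Longrightarrow>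
     (\<And>i. norm (\<beta> i 0) \<le> R) \<Longrightarrow> norm (g 1) \<le> R \<Longrightarrow> norm (d 1) \<le> R \<Longrightarrow>
     t \<in> {0..1} \<Longrightarrow> norm (\<alpha> t) \<le> B \<and> norm (\<beta> i t) \<le> B \<and> norm (g t) \<le> B"
proof -
  obtain K where K: "K \<ge> 1" "\<And>(A :: 'n cmat) (B :: 'n cmat). norm (A ** B) \<le> K * norm A * norm B"
    using mmul_norm_bound by blast
  obtain c C where cC: "c > 0" "C > 0" "\<And>A. c * (norm A)\<^sup>2 \<le> ip A A" "\<And>A. ip A A \<le> C * (norm A)\<^sup>2"
    using ip_norm_bounds by metis
  obtain Ki where Ki: "Ki > 0" "\<And>A B. norm (ip A B) \<le> norm A * norm B * Ki" using ip.pos_bounded by blast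
  obtain Kd where Kd: "Kd > 0" "\<And>A. norm (dag A) \<le> norm A * Kd" using bounded_linear.pos_bounded[OF bounded_linear_dag] by blast
  define n where "n = ip (mat 1) (mat 1)"
  \<comment> \<open>Bounds for the three squared norms of \<beta> at time 0 and at time 1, where
    \<beta> is the conjugate \<open>d 1 ** \<beta> i 0 ** g 1\<close>; their sum dominates the
    maximum. The constants \<beta>m and a1 then bound \<beta> and \<alpha>'.\<close>
  define b1 where "b1 = 3 * (C * R\<^sup>2) + 3 * (C * (K * (K * R * R) * R)\<^sup>2)"
  define \<beta>m where "\<beta>m = sqrt (b1 / c)"
  define a1 where "a1 = 3 * (2 * K * Kd * \<beta>m\<^sup>2)"
  \<comment> \<open>C1 bounds the quadratic form of \<alpha>' relative to \<open>ip\<close>. D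
    bounds the growth of |v|^2 from time 0 to 1 for v = \<open>dag\<close> g X and v = d X,
    increased by 1 to make it at least 1.\<close>
  define C1 where "C1 = Ki * K * a1 / c"
  define D where "D = 1 + C * (K * (Kd * R))\<^sup>2 / c + C * (K * R)\<^sup>2 / c"
  define c1 where "c1 = C1 + D"
  define a0 where "a0 = sqrt (c1\<^sup>2 * n / c)"
  define am where "am = a0 + a1"
  define gm where "gm = norm (mat 1 :: 'n cmat) * exp (2 * K * am)"
  have norm_of_ip: "norm A \<le> sqrt (x / c)" if "ip A A \<le> x" for A x
  proof -
    have "(norm A)\<^sup>2 \<le> x / c" using cC(1) cC(3)[of A] that by (simp add: field_simps)
    then show ?thesis by (rule real_le_rsqrt)
  qed
  have main: "norm (\<alpha> t) \<le> am \<and> norm (\<beta> i t) \<le> \<beta>m \<and> norm (g t) \<le> gm"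
    if T: "temporal \<alpha> \<beta> g"
      and d: "\<And>t. t \<in> {0..1} \<Longrightarrow> (d has_vector_derivative - (2 *\<^sub>R (\<alpha> t ** d t))) (at t within {0..1})"
      and g0: "g 0 = mat 1" and d0: "d 0 = mat 1" and gd: "\<And>t. t \<in> {0..1} \<Longrightarrow> g t ** d t = mat 1"
      and \<beta>1: "\<And>i. \<beta> i 1 = d 1 ** \<beta> i 0 ** g 1"
      and R: "\<And>i. norm (\<beta> i 0) \<le> R" "norm (g 1) \<le> R" "norm (d 1) \<le> R" and t: "t \<in> {0..1}"
    for \<alpha> \<beta> g d t i
  proof -
    have R0: "R \<ge> 0" using order_trans[OF norm_ge_zero R(2)] .
    have \<alpha>: "(\<alpha> has_vector_derivative - (\<Sum>i\<in>UNIV. bracket (\<beta> i t) (dag (\<beta> i t)))) (at t within {0..1})" "dag (\<alpha> t) = \<alpha> t"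
      and g: "(g has_vector_derivative 2 *\<^sub>R (g t ** \<alpha> t)) (at t within {0..1})" if "t \<in> {0..1}" for t
      using T that by (auto simp: temporal_def)
    have \<beta>b: "norm (\<beta> i t) \<le> \<beta>m" if t: "t \<in> {0..1}" for i t
    proof -
      have "ip (\<beta> i 0) (\<beta> i 0) \<le> C * R\<^sup>2" for i
        using cC(2) R(1)[of i] by (intro order_trans[OF cC(4)] mult_left_mono power_mono) auto
      then have "(\<Sum>i\<in>(UNIV :: 3 set). ip (\<beta> i 0) (\<beta> i 0)) \<le> (\<Sum>i\<in>(UNIV :: 3 set). C * R\<^sup>2)" by (rule sum_mono)
      then have e0: "(\<Sum>i\<in>(UNIV :: 3 set). ip (\<beta> i 0) (\<beta> i 0)) \<le> 3 * (C * R\<^sup>2)" by simp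
      have "norm (\<beta> i 1) \<le> K * (K * R * R) * R" for i
        unfolding \<beta>1 using K(1) R R0
        by (intro order_trans[OF K(2)] mult_mono mult_left_mono order_trans[OF K(2)] mult_nonneg_nonneg) auto
      then have "ip (\<beta> i 1) (\<beta> i 1) \<le> C * (K * (K * R * R) * R)\<^sup>2" for i
        using cC(2) by (intro order_trans[OF cC(4)] mult_left_mono power_mono) auto
      then have "(\<Sum>i\<in>(UNIV :: 3 set). ip (\<beta> i 1) (\<beta> i 1)) \<le> (\<Sum>i\<in>(UNIV :: 3 set). C * (K * (K * R * R) * R)\<^sup>2)" by (rule sum_mono)
      then have e1: "(\<Sum>i\<in>(UNIV :: 3 set). ip (\<beta> i 1) (\<beta> i 1)) \<le> 3 * (C * (K * (K * R * R) * R)\<^sup>2)" by simp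
      have "ip (\<beta> i t) (\<beta> i t) \<le> (\<Sum>i\<in>UNIV. ip (\<beta> i t) (\<beta> i t))"
        by (rule member_le_sum) auto
      also have "\<dots> \<le> max (3 * (C * R\<^sup>2)) (3 * (C * (K * (K * R * R) * R)\<^sup>2))"
        using temporal_beta_le_endpoints[OF T t] e0 e1 by linarith
      also have "\<dots> \<le> b1"
        unfolding b1_def using cC(2) by simp
      finally show ?thesis unfolding \<beta>m_def by (rule norm_of_ip)
    qed
    have \<beta>m0: "\<beta>m \<ge> 0" using order_trans[OF norm_ge_zero \<beta>b[OF t, of 1]] .
    have a1_0: "a1 \<ge> 0" using K(1) Kd(1) by (simp add: a1_def)
    have \<alpha>': "norm (- (\<Sum>i\<in>(UNIV :: 3 set). bracket (\<beta> i t) (dag (\<beta> i t)))) \<le> a1" if t: "t \<in> {0..1}" for t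
    proof -
      have "norm (bracket (\<beta> i t) (dag (\<beta> i t))) \<le> 2 * K * Kd * \<beta>m\<^sup>2" for i
      proof -
        have db: "norm (dag (\<beta> i t)) \<le> \<beta>m * Kd"
          using Kd(1) \<beta>b[OF t, of i] by (intro order_trans[OF Kd(2)] mult_right_mono) auto
        have "norm (bracket (\<beta> i t) (dag (\<beta> i t))) \<le> norm (\<beta> i t ** dag (\<beta> i t)) + norm (dag (\<beta> i t) ** \<beta> i t)"
          unfolding bracket_def by (rule norm_triangle_ineq4)
        also have "\<dots> \<le> K * \<beta>m * (\<beta>m * Kd) + K * (\<beta>m * Kd) * \<beta>m"
          using K(1) \<beta>m0 Kd(1) \<beta>b[OF t, of i] db
          by (intro add_mono order_trans[OF K(2)] mult_mono mult_nonneg_nonneg) auto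
        finally show ?thesis by (simp add: power2_eq_square mult_ac)
      qed
      then have "(\<Sum>i\<in>(UNIV :: 3 set). norm (bracket (\<beta> i t) (dag (\<beta> i t)))) \<le> (\<Sum>i\<in>(UNIV :: 3 set). 2 * K * Kd * \<beta>m\<^sup>2)"
        by (rule sum_mono)
      then show ?thesis using norm_sum[of "\<lambda>i. bracket (\<beta> i t) (dag (\<beta> i t))" UNIV] by (simp add: a1_def)
    qed
    have ip_bound: "norm (ip (X ** x) x) \<le> C1 * ip x x" if X: "norm X \<le> a1" for X x
    proof -
      have "norm (ip (X ** x) x) \<le> (K * norm X * norm x) * norm x * Ki"
        using Ki(1) by (intro order_trans[OF Ki(2)] mult_right_mono K) auto
      also have "\<dots> \<le> (K * a1 * norm x) * norm x * Ki"
        using Ki(1) K(1) X by (intro mult_right_mono mult_left_mono) auto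
      also have "\<dots> = (Ki * K * a1 / c) * (c * (norm x)\<^sup>2)" using cC(1) by (simp add: power2_eq_square)
      also have "\<dots> \<le> (Ki * K * a1 / c) * ip x x"
        using cC(1) Ki(1) K(1) a1_0 by (intro mult_left_mono cC) auto
      finally show ?thesis by (simp add: C1_def)
    qed
    have C1_0: "C1 \<ge> 0" using cC(1) Ki(1) K(1) a1_0 by (simp add: C1_def)
    have D1: "D \<ge> 1" using cC by (simp add: D_def)
    have dg: "d t ** g t = mat 1" if "t \<in> {0..1}" for t by (rule matrix_left_right_inverse1[OF gd[OF that]])
    have scale: "ip (Y ** X) (Y ** X) \<le> C * (K * y)\<^sup>2 / c * ip X X" if Y: "norm Y \<le> y" for X Y y
    proof -
      have y: "y \<ge> 0" using order_trans[OF norm_ge_zero Y] .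
      have "norm (Y ** X) \<le> K * y * norm X"
        using K(1) Y by (intro order_trans[OF K(2)] mult_right_mono mult_left_mono) auto
      then have "ip (Y ** X) (Y ** X) \<le> C * (K * y * norm X)\<^sup>2"
        using cC(2) by (intro order_trans[OF cC(4)] mult_left_mono power_mono) auto
      also have "\<dots> = C * (K * y)\<^sup>2 / c * (c * (norm X)\<^sup>2)" using cC(1) by (simp add: power_mult_distrib)
      also have "\<dots> \<le> C * (K * y)\<^sup>2 / c * ip X X" using cC by (intro mult_left_mono) auto
      finally show ?thesis .
    qed
    \<comment> \<open>With r the Rayleigh quotient, 1 + 4 (r - C1) <= exp (4 (r - C1)) <= D, and
      this gives r <= C1 + D.\<close>
    have concl: "ip (A ** X) X \<le> c1 * ip X X"
      if e: "ip X X * exp (4 * (ip (A ** X) X / ip X X - C1)) \<le> y * ip X X" and y: "y \<le> D" and X: "X \<noteq> 0" for A X y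
    proof -
      have pos: "0 < ip X X" by (rule ip_pos[OF X])
      have "ip X X * exp (4 * (ip (A ** X) X / ip X X - C1)) \<le> ip X X * D"
        using e y pos by (smt (verit) mult.commute mult_left_mono)
      then have "exp (4 * (ip (A ** X) X / ip X X - C1)) \<le> D" using pos by simp
      then have "1 + 4 * (ip (A ** X) X / ip X X - C1) \<le> D"
        using exp_ge_add_one_self order_trans by blast
      moreover have "r \<le> c1" if "1 + 4 * (r - C1) \<le> D" for r proof -
        have "4 * r \<le> D - 1 + 4 * C1" using that by (simp add: algebra_simps)
        then have "4 * r \<le> 4 * (C1 + D)" using D1 by (simp add: algebra_simps)
        then show ?thesis by (simp add: c1_def)
      qed
      ultimately have "ip (A ** X) X / ip X X \<le> c1" by blast
      then show ?thesis using pos by (simp add: pos_divide_le_eq)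
    qed
    \<comment> \<open>As \<alpha> is Hermitian, \<open>dag\<close> g X solves v' = 2 \<alpha> v, so
      a large upper value of \<alpha> 0 would show up in g 1.\<close>
    have up: "ip (\<alpha> 0 ** X) X \<le> c1 * ip X X" if X: "X \<noteq> 0" for X
    proof -
      define v where "v t = dag (g t) ** X" for t
      have e: "ip (v 0) (v 0) * exp (4 * (ip (\<alpha> 0 ** v 0) (v 0) / ip (v 0) (v 0) - C1)) \<le> ip (v 1) (v 1)"
      proof (rule rayleigh_growth[OF \<alpha> C1_0])
        fix t :: real assume t: "t \<in> {0..1}"
        show "- C1 * ip x x \<le> ip (- (\<Sum>i\<in>UNIV. bracket (\<beta> i t) (dag (\<beta> i t))) ** x) x" for x
          using ip_bound[OF \<alpha>'[OF t], of x] by (simp add: abs_le_iff del: mmul.minus_left)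
        show "(v has_vector_derivative 2 *\<^sub>R (\<alpha> t ** v t)) (at t within {0..1})"
          using has_vector_derivative_mmul_const(1)[OF has_vector_derivative_dag[OF g[OF t]], of X]
          unfolding v_def[abs_def] by (simp add: dag_simps \<alpha>(2)[OF t] mmul_simps)
        show "v t \<noteq> 0"
        proof
          assume "v t = 0"
          then have "dag (d t) ** (dag (g t) ** X) = 0" by (simp add: v_def mmul.zero_right)
          then have "dag (g t ** d t) ** X = 0" by (simp add: dag_mult matrix_mul_assoc)
          then show False using X gd[OF t] by simp
        qed
      qed
      have "norm (dag (g 1)) \<le> Kd * R" using Kd(1) R(2) by (intro order_trans[OF Kd(2)]) (simp add: mult.commute)
      from scale[OF this, of X] have "ip (v 1) (v 1) \<le> C * (K * (Kd * R))\<^sup>2 / c * ip X X" by (simp add: v_def)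
      then have "ip X X * exp (4 * (ip (\<alpha> 0 ** X) X / ip X X - C1)) \<le> C * (K * (Kd * R))\<^sup>2 / c * ip X X"
        using e by (simp add: v_def g0)
      then show ?thesis by (rule concl) (use cC X in \<open>auto simp: D_def\<close>)
    qed
    \<comment> \<open>The inverse frame gives a solution d X for -\<alpha>, which controls the lower
      values through d 1.\<close>
    have down: "ip ((- \<alpha> 0) ** X) X \<le> c1 * ip X X" if X: "X \<noteq> 0" for X
    proof -
      define v where "v t = d t ** X" for t
      have e: "ip (v 0) (v 0) * exp (4 * (ip ((- \<alpha> 0) ** v 0) (v 0) / ip (v 0) (v 0) - C1)) \<le> ip (v 1) (v 1)"
      proof (rule rayleigh_growth[where \<alpha>="\<lambda>t. - \<alpha> t" and \<alpha>'="\<lambda>t. - (- (\<Sum>i\<in>UNIV. bracket (\<beta> i t) (dag (\<beta> i t))))", OF has_vector_derivative_minus[OF \<alpha>(1)] _ C1_0])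
        fix t :: real assume t: "t \<in> {0..1}"
        show "dag (- \<alpha> t) = - \<alpha> t" by (simp add: dag_simps \<alpha>(2)[OF t])
        have nb: "norm (- (- (\<Sum>i\<in>(UNIV :: 3 set). bracket (\<beta> i t) (dag (\<beta> i t))))) \<le> a1" using \<alpha>'[OF t] by simp
        show "- C1 * ip x x \<le> ip (- (- (\<Sum>i\<in>UNIV. bracket (\<beta> i t) (dag (\<beta> i t)))) ** x) x" for x
          using ip_bound[OF nb, of x] by (simp add: abs_le_iff minus_le_iff)
        show "(v has_vector_derivative 2 *\<^sub>R (- \<alpha> t ** v t)) (at t within {0..1})"
          using has_vector_derivative_mmul_const(1)[OF d[OF t], of X]
          unfolding v_def[abs_def] by (simp add: mmul_simps)
        show "v t \<noteq> 0"
        proof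
          assume "v t = 0"
          then have "g t ** (d t ** X) = 0" by (simp add: v_def mmul.zero_right)
          then show False using X gd[OF t] by (simp add: matrix_mul_assoc)
        qed
      qed
      from scale[OF R(3), of X] have "ip (v 1) (v 1) \<le> C * (K * R)\<^sup>2 / c * ip X X" by (simp add: v_def)
      then have "ip X X * exp (4 * (ip ((- \<alpha> 0) ** X) X / ip X X - C1)) \<le> C * (K * R)\<^sup>2 / c * ip X X"
        using e by (simp add: v_def d0)
      then show ?thesis by (rule concl) (use cC X in \<open>auto simp: D_def\<close>)
    qed
    have "\<bar>ip (\<alpha> 0 ** X) X\<bar> \<le> c1 * ip X X" for X
      using up[of X] down[of X] by (cases "X = 0") (auto simp: ip.zero_right mmul.minus_left ip.minus_left abs_le_iff)
    then have "ip (\<alpha> 0) (\<alpha> 0) \<le> c1\<^sup>2 * n"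
      unfolding n_def by (intro numerical_radius_bound \<alpha>(2)) (use D1 C1_0 in \<open>auto simp: c1_def\<close>)
    then have A0: "norm (\<alpha> 0) \<le> a0" unfolding a0_def by (rule norm_of_ip)
    have \<alpha>b: "norm (\<alpha> t) \<le> am" if t: "t \<in> {0..1}" for t
    proof -
      have "norm (\<alpha> t - \<alpha> 0) \<le> a1 * (t - 0)"
        by (rule norm_diff_le_deriv_bound[OF \<alpha>(1) \<alpha>' t])
      also have "\<dots> \<le> a1" using t a1_0 by (simp add: mult_left_le)
      finally show ?thesis using A0 norm_triangle_sub[of "\<alpha> t" "\<alpha> 0"] by (simp add: am_def)
    qed
    have "norm (g t) \<le> norm (g 0) * exp (2 * K * am * (t - 0))"
    proof (rule gronwall[OF g _ t])
      fix s :: real assume s: "s \<in> {0..1}"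
      have "norm (g s ** \<alpha> s) \<le> K * norm (g s) * am"
        using K(1) \<alpha>b[OF s] by (intro order_trans[OF K(2)] mult_left_mono) auto
      then show "norm (2 *\<^sub>R (g s ** \<alpha> s)) \<le> 2 * K * am * norm (g s)" by (simp add: mult_ac)
    qed
    also have "\<dots> \<le> gm"
    proof -
      have "am \<ge> 0" using order_trans[OF norm_ge_zero \<alpha>b[OF t]] .
      then have "2 * K * am * (t - 0) \<le> 2 * K * am" using t K(1) by (simp add: mult_left_le)
      then show ?thesis by (simp add: gm_def g0 mult_left_mono)
    qed
    finally show ?thesis using \<alpha>b[OF t] \<beta>b[OF t] by blast
  qed
  show ?thesis
  proof (rule that[of "max am (max \<beta>m gm)"])
    fix \<alpha> \<beta> g d t i
    assume a: "temporal \<alpha> \<beta> g"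
      "\<And>t. t \<in> {0..1} \<Longrightarrow> (d has_vector_derivative - (2 *\<^sub>R (\<alpha> t ** d t))) (at t within {0..1})"
      "g 0 = mat 1" "d 0 = mat 1" "\<And>t. t \<in> {0..1} \<Longrightarrow> g t ** d t = mat 1"
      "\<And>i. \<beta> i 1 = d 1 ** \<beta> i 0 ** g 1"
      "\<And>i. norm (\<beta> i 0) \<le> R" "norm (g 1) \<le> R" "norm (d 1) \<le> R" "t \<in> {0..1::real}"
    show "norm (\<alpha> t) \<le> max am (max \<beta>m gm) \<and> norm (\<beta> i t) \<le> max am (max \<beta>m gm) \<and> norm (g t) \<le> max am (max \<beta>m gm)"
      using main[OF a(1) a(2) a(3) a(4) a(5) a(6) a(7) a(8) a(9) a(10), of i] by auto
  qed
qed

end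

context unitary_group
begin

section \<open>Hermitian gauge: the initial value problem and its uniqueness\<close>

text \<open>The field for (\<alpha>, \<beta>, g), polarized to a real bilinear map; its diagonal is
  the system in \<open>temporal\<close>. Including the frame makes the endpoint a value of the
  solution.\<close>

definition nahm_quad :: "'a cmat \<times> ('a cmat^3) \<times> 'a cmat \<Rightarrow> 'a cmat \<times> ('a cmat^3) \<times> 'a cmat \<Rightarrow> 'a cmat \<times> ('a cmat^3) \<times> 'a cmat" where
  "nahm_quad z w = (- (\<Sum>i\<in>UNIV. bracket (fst (snd z) $ i) (dag (fst (snd w) $ i))),
     (\<chi> i. - (2 *\<^sub>R bracket (fst z) (fst (snd w) $ i))), 2 *\<^sub>R (snd (snd z) ** fst w))"

lemma bounded_bilinear_nahm_quad: "bounded_bilinear nahm_quad"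
proof -
  have "bilinear nahm_quad"
    unfolding bilinear_def nahm_quad_def
    by (intro conjI allI linearI)
      (simp_all add: vec_eq_iff bracket_def mmul_simps dag_simps sum.distrib sum_subtractf scaleR_sum_right algebra_simps)
  then show ?thesis by (simp add: bilinear_conv_bounded_bilinear)
qed

definition al where "al z t = fst (z t)" for z :: "real \<Rightarrow> 'a cmat \<times> ('a cmat^3) \<times> 'a cmat"
definition be where "be z i t = fst (snd (z t)) $ i" for z :: "real \<Rightarrow> 'a cmat \<times> ('a cmat^3) \<times> 'a cmat"
definition fr where "fr z t = snd (snd (z t))" for z :: "real \<Rightarrow> 'a cmat \<times> ('a cmat^3) \<times> 'a cmat"

definition shot :: "'a cmat \<Rightarrow> 'a cmat^3 \<Rightarrow> (real \<Rightarrow> 'a cmat \<times> ('a cmat^3) \<times> 'a cmat) \<Rightarrow> bool" where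
  "shot A \<tau> z \<longleftrightarrow> A \<in> herm \<and> (\<forall>i. \<tau> $ i \<in> clie) \<and> quad_sol nahm_quad (A, \<tau>, mat 1) z"

lemma bracket_dag_herm: "X \<in> clie \<Longrightarrow> bracket X (dag X) \<in> herm"
  by (simp add: herm_def clie_bracket clie_dag) (simp add: bracket_def dag_simps)

text \<open>The field maps the subspace with \<alpha> in \<open>herm\<close> and \<beta> in
  \<open>clie\<close> to itself, since [X, \<open>dag X\<close>] is Hermitian. Viability then keeps
  solutions in it.\<close>

lemma shot_values:
  assumes z: "shot A \<tau> z" and t: "t \<in> {0..1}"
  shows "al z t \<in> herm" "be z i t \<in> clie"
proof -
  have A: "A \<in> herm" and \<tau>: "\<And>i. \<tau> $ i \<in> clie" and q: "quad_sol nahm_quad (A, \<tau>, mat 1) z"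
    using z by (auto simp: shot_def)
  define K :: "('a cmat \<times> ('a cmat^3) \<times> 'a cmat) set" where "K = {x. fst x \<in> herm \<and> (\<forall>i. fst (snd x) $ i \<in> clie)}"
  have K: "subspace K"
    using subspace_herm subspace_clie unfolding subspace_def K_def by auto
  obtain R where R: "R > 0" "\<And>t. t \<in> {0..1} \<Longrightarrow> norm (z t) \<le> R" by (rule quad_sol_bounded[OF q]) blast
  \<comment> \<open>The radius R + 1 also covers the points of K within distance 1 of the
    solution.\<close>
  obtain L where L: "L \<ge> 0" "\<And>x y. norm x \<le> R + 1 \<Longrightarrow> norm y \<le> R + 1 \<Longrightarrow> norm (nahm_quad x x - nahm_quad y y) \<le> L * norm (x - y)"
    using quad_lipschitz[OF bounded_bilinear_nahm_quad, of "R + 1"] by blast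
  have "z t \<in> K"
  proof (rule subspace_viability[OF K, where r=1 and L=L and v="\<lambda>t. nahm_quad (z t) (z t)", OF _ _ _ _ t])
    show "z 0 \<in> K" using q A \<tau> by (simp add: quad_sol_def K_def)
    show "(z has_vector_derivative nahm_quad (z t) (z t)) (at t within {0..1})" if "t \<in> {0..1}" for t
      using q that by (simp add: quad_sol_def)
    fix s :: real and x assume s: "s \<in> {0..<1}" and x: "x \<in> K" and d: "dist x (z s) \<le> 1"
    have "norm x \<le> norm (z s) + dist x (z s)" using norm_triangle_sub[of x "z s"] by (simp add: dist_norm)
    then have "norm x \<le> R + 1" "norm (z s) \<le> R + 1" using R(2)[of s] s d by auto
    from L(2)[OF this] have "norm (nahm_quad x x - nahm_quad (z s) (z s)) \<le> L * dist x (z s)" by (simp add: dist_norm)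
    moreover have "nahm_quad x x \<in> K"
    proof -
      have "fst (nahm_quad x x) \<in> herm"
        using x unfolding nahm_quad_def K_def
        by (auto intro!: subspace_neg[OF subspace_herm] subspace_sum[OF subspace_herm] bracket_dag_herm)
      moreover have "fst (snd (nahm_quad x x)) $ i \<in> clie" for i
      proof -
        have "fst x \<in> clie" "fst (snd x) $ i \<in> clie" using x hermD(1) by (auto simp: K_def)
        then show ?thesis
          unfolding nahm_quad_def
          by (simp add: subspace_neg[OF subspace_clie] subspace_scale[OF subspace_clie] clie_bracket)
      qed
      ultimately show ?thesis by (simp add: K_def)
    qed
    ultimately show "\<exists>w\<in>K. norm (w - nahm_quad (z s) (z s)) \<le> L * dist x (z s)" by blast
  qed simp
  then show "al z t \<in> herm" "be z i t \<in> clie" by (auto simp: K_def al_def be_def)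
qed

lemma shot_temporal:
  assumes z: "shot A \<tau> z"
  shows "temporal (al z) (be z) (fr z)"
  unfolding temporal_def
proof (intro ballI conjI allI)
  fix t :: real assume t: "t \<in> {0..1}"
  have d: "(z has_vector_derivative nahm_quad (z t) (z t)) (at t within {0..1})"
    using z t by (simp add: shot_def quad_sol_def)
  show "dag (al z t) = al z t" using shot_values(1)[OF z t] hermD by blast
  show "(al z has_vector_derivative - (\<Sum>i\<in>UNIV. bracket (be z i t) (dag (be z i t)))) (at t within {0..1})"
    using bounded_linear.has_vector_derivative[OF bounded_linear_fst d]
    by (simp add: al_def[abs_def] be_def nahm_quad_def)
  have d2: "((\<lambda>t. snd (z t)) has_vector_derivative snd (nahm_quad (z t) (z t))) (at t within {0..1})"
    by (rule bounded_linear.has_vector_derivative[OF bounded_linear_snd d])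
  show "(be z i has_vector_derivative - (2 *\<^sub>R bracket (al z t) (be z i t))) (at t within {0..1})" for i
    using bounded_linear.has_vector_derivative[OF bounded_linear_vec_nth bounded_linear.has_vector_derivative[OF bounded_linear_fst d2], of i]
    by (simp add: al_def be_def[abs_def] nahm_quad_def)
  show "(fr z has_vector_derivative 2 *\<^sub>R (fr z t ** al z t)) (at t within {0..1})"
    using bounded_linear.has_vector_derivative[OF bounded_linear_snd d2]
    by (simp add: al_def fr_def[abs_def] nahm_quad_def)
qed

lemma shot_start: "shot A \<tau> z \<Longrightarrow> al z 0 = A" "shot A \<tau> z \<Longrightarrow> be z i 0 = \<tau> $ i" "shot A \<tau> z \<Longrightarrow> fr z 0 = mat 1"
  by (simp_all add: shot_def quad_sol_def al_def be_def fr_def)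

lemma shot_derivatives:
  assumes z: "shot A \<tau> z" and t: "t \<in> {0..1}"
  shows "(al z has_vector_derivative - (\<Sum>i\<in>UNIV. bracket (be z i t) (dag (be z i t)))) (at t within {0..1})"
    "(be z i has_vector_derivative - (2 *\<^sub>R bracket (al z t) (be z i t))) (at t within {0..1})"
    "(fr z has_vector_derivative 2 *\<^sub>R (fr z t ** al z t)) (at t within {0..1})"
    "dag (al z t) = al z t"
  using shot_temporal[OF z] t unfolding temporal_def by auto

text \<open>The frame is built to undo the bracket with \<alpha>: g \<beta> d has derivative 0 and
  keeps its initial value \<tau>.\<close>

lemma shot_frame:
  assumes z: "shot A \<tau> z"
  obtains d where "d 0 = mat 1" "\<And>t. t \<in> {0..1} \<Longrightarrow> (d has_vector_derivative - (2 *\<^sub>R (al z t ** d t))) (at t within {0..1})"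
    "\<And>t. t \<in> {0..1} \<Longrightarrow> fr z t ** d t = mat 1" "\<And>t. t \<in> {0..1} \<Longrightarrow> d t ** fr z t = mat 1"
    "\<And>t i. t \<in> {0..1} \<Longrightarrow> be z i t = d t ** \<tau> $ i ** fr z t"
    "\<And>t. t \<in> {0..1} \<Longrightarrow> fr z t \<in> polar"
proof -
  define \<xi> where "\<xi> t = 2 *\<^sub>R al z t" for t
  have al_cont: "continuous_on {0..1} (al z)"
    by (rule has_vector_derivative_imp_continuous_on[OF shot_derivatives(1)[OF z]])
  have \<xi>: "continuous_on {0..1} \<xi>" unfolding \<xi>_def by (intro continuous_intros al_cont)
  have g: "(fr z has_vector_derivative fr z t ** \<xi> t) (at t within {0..1})" if "t \<in> {0..1}" for t
    using shot_derivatives(3)[OF z that] by (simp add: \<xi>_def mmul.scaleR_right)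
  obtain g' d where gd: "g' 0 = mat 1" "d 0 = mat 1"
    "\<And>t. t \<in> {0..1} \<Longrightarrow> (g' has_vector_derivative g' t ** \<xi> t) (at t within {0..1})"
    "\<And>t. t \<in> {0..1} \<Longrightarrow> (d has_vector_derivative - (\<xi> t ** d t)) (at t within {0..1})"
    by (rule frame_exists[OF \<xi>]) blast
  have inv: "fr z t ** d t = mat 1" if "t \<in> {0..1}" for t
    by (rule frame_inverse[OF g gd(4) _ that]) (simp_all add: gd shot_start[OF z])
  have inv': "d t ** fr z t = mat 1" if "t \<in> {0..1}" for t by (rule matrix_left_right_inverse1[OF inv[OF that]])
  have const: "fr z t ** be z i t ** d t = \<tau> $ i" if t: "t \<in> {0..1}" for t i
  proof -
    have "fr z t ** be z i t ** d t = fr z 0 ** be z i 0 ** d 0"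
    proof (rule has_vector_derivative_zero_eq[where z="\<lambda>t. fr z t ** be z i t ** d t" and a=0 and b=1, OF _ t])
      fix s :: real assume s: "s \<in> {0..1}"
      show "((\<lambda>t. fr z t ** be z i t ** d t) has_vector_derivative 0) (at s within {0..1})"
        using has_vector_derivative_mmul[OF has_vector_derivative_mmul[OF g[OF s] shot_derivatives(2)[OF z s]] gd(4)[OF s], of i]
        by (simp add: \<xi>_def bracket_def mmul_simps algebra_simps)
    qed
    then show ?thesis by (simp add: shot_start[OF z] gd)
  qed
  show ?thesis
  proof (rule that[of d])
    show "(d has_vector_derivative - (2 *\<^sub>R (al z t ** d t))) (at t within {0..1})" if "t \<in> {0..1}" for t
      using gd(4)[OF that] by (simp add: \<xi>_def mmul.scaleR_left)
    show "be z i t = d t ** \<tau> $ i ** fr z t" if t: "t \<in> {0..1}" for t i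
    proof -
      have "d t ** \<tau> $ i ** fr z t = (d t ** fr z t) ** be z i t ** (d t ** fr z t)"
        by (simp add: const[OF t, symmetric] matrix_mul_assoc)
      then show ?thesis by (simp add: inv'[OF t])
    qed
    show "fr z t \<in> polar" if "t \<in> {0..1}" for t
      by (rule frame_polar[OF _ \<xi> g _ that])
        (use shot_values(1)[OF z] hermD(1) subspace_scale[OF subspace_clie] in \<open>auto simp: \<xi>_def shot_start[OF z]\<close>)
  qed (use gd inv inv' in auto)
qed

text \<open>The hypothesis fixes only the positive part of the endpoint, so h is known to be unitary
  at time 1, not to be 1. Unitarity at all times still suffices: the derivative of h
  \<open>dag h\<close> at 0 is 4 (A - B), because A and B are Hermitian.\<close>

lemma shot_injective:
  assumes z: "shot A \<tau> z" and w: "shot B \<tau> w" and eq: "fr z 1 ** dag (fr z 1) = fr w 1 ** dag (fr w 1)"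
  shows "A = B"
proof -
  obtain dz where dz: "dz 0 = mat 1" "\<And>t. t \<in> {0..1} \<Longrightarrow> (dz has_vector_derivative - (2 *\<^sub>R (al z t ** dz t))) (at t within {0..1})"
    "\<And>t. t \<in> {0..1} \<Longrightarrow> fr z t ** dz t = mat 1" "\<And>t. t \<in> {0..1} \<Longrightarrow> dz t ** fr z t = mat 1"
    "\<And>t i. t \<in> {0..1} \<Longrightarrow> be z i t = dz t ** \<tau> $ i ** fr z t" by (rule shot_frame[OF z]) blast
  obtain dw where dw: "dw 0 = mat 1" "\<And>t. t \<in> {0..1} \<Longrightarrow> (dw has_vector_derivative - (2 *\<^sub>R (al w t ** dw t))) (at t within {0..1})"
    "\<And>t. t \<in> {0..1} \<Longrightarrow> fr w t ** dw t = mat 1" "\<And>t. t \<in> {0..1} \<Longrightarrow> dw t ** fr w t = mat 1"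
    "\<And>t i. t \<in> {0..1} \<Longrightarrow> be w i t = dw t ** \<tau> $ i ** fr w t" by (rule shot_frame[OF w]) blast
  define h k where "h t = dw t ** fr z t" and "k t = dz t ** fr w t" for t
  have h: "(h has_vector_derivative 2 *\<^sub>R (h t ** al z t - al w t ** h t)) (at t within {0..1})" if "t \<in> {0..1}" for t
    using has_vector_derivative_mmul[OF dw(2)[OF that] shot_derivatives(3)[OF z that]]
    unfolding h_def[abs_def] by (simp add: mmul_simps scaleR_diff_right)
  have k: "(k has_vector_derivative 2 *\<^sub>R (k t ** al w t - al z t ** k t)) (at t within {0..1})" if "t \<in> {0..1}" for t
    using has_vector_derivative_mmul[OF dz(2)[OF that] shot_derivatives(3)[OF w that]]
    unfolding k_def[abs_def] by (simp add: mmul_simps scaleR_diff_right)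
  have hk: "h t ** k t = mat 1" if t: "t \<in> {0..1}" for t
  proof -
    have "h t ** k t = dw t ** (fr z t ** dz t) ** fr w t" by (simp add: h_def k_def matrix_mul_assoc)
    then show ?thesis by (simp add: dz(3)[OF t] dw(4)[OF t])
  qed
  have \<beta>: "h t ** be z i t = be w i t ** h t" if t: "t \<in> {0..1}" for t i
  proof -
    have "h t ** be z i t = dw t ** (fr z t ** dz t) ** \<tau> $ i ** fr z t" by (simp add: h_def dz(5)[OF t] matrix_mul_assoc)
    moreover have "be w i t ** h t = dw t ** \<tau> $ i ** (fr w t ** dw t) ** fr z t" by (simp add: h_def dw(5)[OF t] matrix_mul_assoc)
    ultimately show ?thesis by (simp add: dz(3)[OF t] dw(3)[OF t])
  qed
  have h0: "h 0 = mat 1" by (simp add: h_def dw(1) shot_start(3)[OF z])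
  have h1: "h 1 ** dag (h 1) = mat 1"
  proof -
    have "h 1 ** dag (h 1) = dw 1 ** (fr z 1 ** dag (fr z 1)) ** dag (dw 1)" by (simp add: h_def dag_mult matrix_mul_assoc)
    also have "\<dots> = (dw 1 ** fr w 1) ** dag (dw 1 ** fr w 1)" by (simp add: eq dag_mult matrix_mul_assoc)
    finally show ?thesis by (simp add: dw(4))
  qed
  have unit: "h t ** dag (h t) = mat 1" if "t \<in> {0..1}" for t
    by (rule transition_unitary[OF temporal_real_eq[OF shot_temporal[OF z]] temporal_real_eq[OF shot_temporal[OF w]] h k hk \<beta> _ h1 that])
      (simp_all add: h0)
  have "((\<lambda>t. h t ** dag (h t)) has_vector_derivative 4 *\<^sub>R (A - B)) (at 0 within {0..1})"
  proof -
    have "(h has_vector_derivative 2 *\<^sub>R (A - B)) (at 0 within {0..1})"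
      using h[of 0] by (simp add: h0 shot_start(1)[OF z] shot_start(1)[OF w])
    from has_vector_derivative_mmul[OF this has_vector_derivative_dag[OF this]]
    have "((\<lambda>t. h t ** dag (h t)) has_vector_derivative dag (2 *\<^sub>R (A - B)) + 2 *\<^sub>R (A - B)) (at 0 within {0..1})"
      by (simp add: h0)
    moreover have "dag (2 *\<^sub>R (A - B)) = 2 *\<^sub>R (A - B)"
      using z w by (simp add: dag_simps shot_def herm_def)
    ultimately show ?thesis by (simp add: scaleR_2[symmetric] del: scaleR_diff_right)
  qed
  from vector_derivative_unit[OF this]
  have 1: "vector_derivative (\<lambda>t. h t ** dag (h t)) (at 0 within {0..1}) = 4 *\<^sub>R (A - B)" by simp
  have "((\<lambda>t. h t ** dag (h t)) has_vector_derivative 0) (at 0 within {0..1})"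
    by (rule has_vector_derivative_transform[OF _ _ has_vector_derivative_const[of "mat 1"]]) (use unit in auto)
  from vector_derivative_unit[OF this] 1 have "4 *\<^sub>R (A - B) = 0" by simp
  then show ?thesis by simp
qed

text \<open>Geodesics are the solutions with \<open>\<tau> = 0\<close>, so the exponential is injective on \<open>herm\<close>.\<close>

lemma mexp_square_inj:
  assumes A: "A \<in> herm" and B: "B \<in> herm" and eq: "mexp A ** mexp A = mexp B ** mexp B"
  shows "A = B"
proof -
  \<comment> \<open>For \<tau> = 0 the field \<alpha> = X / 2 is constant and the frame is exp (t
    X).\<close>
  define z where "z X t = ((1/2) *\<^sub>R X, 0 :: 'a cmat^3, mexp (t *\<^sub>R X))" for X :: "'a cmat" and t :: real
  have sol: "shot ((1/2) *\<^sub>R X) 0 (z X)" if "X \<in> herm" for X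
    unfolding shot_def quad_sol_def
  proof (intro conjI allI ballI)
    show "(1/2) *\<^sub>R X \<in> herm" by (rule subspace_scale[OF subspace_herm that])
    show "(0 :: 'a cmat^3) $ i \<in> clie" for i using subspace_0[OF subspace_clie] by simp
    show "z X 0 = ((1/2) *\<^sub>R X, 0, mat 1)" by (simp add: z_def)
    fix t :: real
    have "(z X has_vector_derivative (0, 0, mexp (t *\<^sub>R X) ** X)) (at t within {0..1})"
      unfolding z_def[abs_def]
      by (intro has_vector_derivative_Pair has_vector_derivative_const mexp_has_vector_derivative_right)
    moreover have "nahm_quad (z X t) (z X t) = (0, 0, mexp (t *\<^sub>R X) ** X)"
      by (simp add: nahm_quad_def z_def bracket_def mmul.zero_left mmul.zero_right vec_eq_iff mmul.scaleR_right)
    ultimately show "(z X has_vector_derivative nahm_quad (z X t) (z X t)) (at t within {0..1})" by simp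
  qed
  have fz: "fr (z X) 1 ** dag (fr (z X) 1) = mexp X ** mexp X" if "X \<in> herm" for X
    by (simp add: fr_def z_def dag_mexp hermD(2)[OF that])
  have "(1/2) *\<^sub>R A = (1/2) *\<^sub>R B"
    by (rule shot_injective[OF sol[OF A] sol[OF B]]) (simp add: fz A B eq)
  then show ?thesis by simp
qed

section \<open>The logarithm of positive elements\<close>

text \<open>Half the logarithm: for m = exp B k with B in \<open>herm\<close> and k in G,
  \<open>plog (m ** dag m)\<close> is B, the Hermitian factor in the polar decomposition.\<close>

definition plog :: "'a cmat \<Rightarrow> 'a cmat" where
  "plog = inv_into herm (\<lambda>B. mexp B ** mexp B)"

lemma plog_mexp: "B \<in> herm \<Longrightarrow> plog (mexp B ** mexp B) = B"
  unfolding plog_def by (rule inv_into_f_f[OF inj_onI]) (rule mexp_square_inj)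

lemma polar_plog:
  assumes "m \<in> polar"
  shows "plog (m ** dag m) \<in> herm" "mexp (plog (m ** dag m)) ** mexp (plog (m ** dag m)) = m ** dag m"
    "\<exists>k\<in>G. m = mexp (plog (m ** dag m)) ** k"
proof -
  obtain B k where Bk: "B \<in> herm" "k \<in> G" "m = mexp B ** k" using assms by (auto simp: polar_def)
  then have mm: "m ** dag m = mexp B ** mexp B"
    by (simp add: dag_simps dag_mexp hermD(2) matrix_mul_assoc unitary_cancel)
  show "plog (m ** dag m) \<in> herm" "mexp (plog (m ** dag m)) ** mexp (plog (m ** dag m)) = m ** dag m"
    "\<exists>k\<in>G. m = mexp (plog (m ** dag m)) ** k"
    unfolding mm plog_mexp[OF Bk(1)] using Bk by blast+
qed

text \<open>Bounds on m and its inverse place all logarithms in one ball of \<open>herm\<close>,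
  where the injective continuous map B to exp B exp B has a continuous inverse by
  compactness.\<close>

lemma tendsto_plog:
  assumes m: "\<And>n. m n \<in> polar" "l \<in> polar" and lim: "m \<longlonglongrightarrow> l"
  shows "(\<lambda>n. plog (m n ** dag (m n))) \<longlonglongrightarrow> plog (l ** dag l)"
proof -
  have inv: "invertible x" if "x \<in> polar" for x using matrix_group_polar that by (simp add: matrix_group_def)
  have inv_lim: "(\<lambda>n. matrix_inv (m n)) \<longlonglongrightarrow> matrix_inv l" by (rule tendsto_matrix_inv[OF lim inv[OF m(1)] inv[OF m(2)]])
  obtain c C where C: "C > 0" "\<And>A. ip A A \<le> C * (norm A)\<^sup>2" using ip_norm_bounds by metis
  obtain b where b: "b > 0" "\<And>A. A \<in> herm \<Longrightarrow> b * (norm A)\<^sup>2 \<le> ip (mexp A) (mexp A) + ip (mexp (- A)) (mexp (- A))"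
    by (rule herm_bound) blast
  obtain R1 where R1: "R1 > 0" "\<And>n. norm (m n) \<le> R1" using convergent_imp_bounded[OF lim] unfolding bounded_pos by blast
  obtain R2 where R2: "R2 > 0" "\<And>n. norm (matrix_inv (m n)) \<le> R2" using convergent_imp_bounded[OF inv_lim] unfolding bounded_pos by blast
  define R where "R = max (sqrt ((C * R1\<^sup>2 + C * R2\<^sup>2) / b)) (norm (plog (l ** dag l)))"
  have bound: "norm (plog (m n ** dag (m n))) \<le> R" for n
  proof -
    obtain k where k: "k \<in> G" "m n = mexp (plog (m n ** dag (m n))) ** k" using polar_plog(3)[OF m(1)] by blast
    define B where "B = plog (m n ** dag (m n))"
    have B: "B \<in> herm" using polar_plog(1)[OF m(1)] by (simp add: B_def)
    have mB: "m n = mexp B ** k" using k(2) by (simp add: B_def)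
    have "matrix_inv (m n) = dag k ** mexp (- B)"
      by (rule matrix_inv_eqI) (simp add: mB matrix_mul_assoc unitary_cancel k(1))
    then have "ip (mexp (- B)) (mexp (- B)) = ip (matrix_inv (m n)) (matrix_inv (m n))"
      using dag_G[OF k(1)] by (simp add: ip_unitary)
    also have "\<dots> \<le> C * R2\<^sup>2" using C(1) R2(2)[of n] by (intro order_trans[OF C(2)] mult_left_mono power_mono) auto
    finally have 1: "ip (mexp (- B)) (mexp (- B)) \<le> C * R2\<^sup>2" .
    have "ip (mexp B) (mexp B) = ip (m n) (m n)" using k(1) by (simp add: mB ip_unitary)
    also have "\<dots> \<le> C * R1\<^sup>2" using C(1) R1(2)[of n] by (intro order_trans[OF C(2)] mult_left_mono power_mono) auto
    finally have "b * (norm B)\<^sup>2 \<le> C * R1\<^sup>2 + C * R2\<^sup>2" using b(2)[OF B] 1 by simp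
    then have "(norm B)\<^sup>2 \<le> (C * R1\<^sup>2 + C * R2\<^sup>2) / b" using b(1) by (simp add: field_simps)
    then have "norm B \<le> sqrt ((C * R1\<^sup>2 + C * R2\<^sup>2) / b)" by (rule real_le_rsqrt)
    then show ?thesis by (simp add: R_def B_def)
  qed
  define S where "S = herm \<inter> cball 0 R"
  define E where "E = (\<lambda>B :: 'a cmat. mexp B ** mexp B)"
  have "compact S" unfolding S_def by (intro closed_Int_compact closed_subspace subspace_herm compact_cball)
  moreover have "continuous_on S E" unfolding E_def by (intro continuous_intros)
  moreover have "\<forall>x\<in>S. plog (E x) = x" by (simp add: S_def E_def plog_mexp)
  ultimately have cont: "continuous_on (E ` S) plog" by (intro continuous_on_inv)
  show ?thesis
  proof (rule continuous_on_tendsto_compose[OF cont])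
    show "(\<lambda>n. m n ** dag (m n)) \<longlonglongrightarrow> l ** dag l"
      by (intro mmul.tendsto lim bounded_linear.tendsto[OF bounded_linear_dag])
    show "l ** dag l \<in> E ` S"
      using polar_plog(1,2)[OF m(2)] by (intro image_eqI[of _ _ "plog (l ** dag l)"]) (auto simp: E_def S_def R_def)
    show "eventually (\<lambda>n. m n ** dag (m n) \<in> E ` S) sequentially"
      using polar_plog(1,2)[OF m(1)] bound
      by (intro always_eventually allI image_eqI[of _ _ "plog (m _ ** dag (m _))"]) (auto simp: E_def S_def)
  qed
qed

end

context unitary_group
begin

text \<open>Shooting: as \<open>(s, A)\<close> varies, the endpoint of the solution with initial data \<open>A\<close>, \<open>s \<tau>\<close> gives an
  injective continuous map to \<open>\<real> \<times> herm\<close> whose image is open by invariance of domain and closed by the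
  a priori bound. The parameter \<open>s\<close> ensures that its domain is not empty.\<close>

theorem shooting:
  assumes \<tau>: "\<And>i. \<tau> $ i \<in> clie" and m: "m \<in> polar"
  obtains A z k where "shot A \<tau> z" "k \<in> G" "fr z 1 ** k = m"
proof -
  define V where "V = (UNIV :: real set) \<times> herm"
  have V: "subspace V" unfolding V_def by (intro subspace_Times subspace_UNIV subspace_herm)
  define init where "init x = (snd x, fst x *\<^sub>R \<tau>, mat 1 :: 'a cmat)" for x :: "real \<times> 'a cmat"
  have init_cont: "continuous_on UNIV init" unfolding init_def by (intro continuous_intros)
  define sol where "sol x z \<longleftrightarrow> shot (snd x) (fst x *\<^sub>R \<tau>) z" for x z
  have sol_iff: "sol x z \<longleftrightarrow> x \<in> V \<and> quad_sol nahm_quad (init x) z" for x z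
    using \<tau> subspace_scale[OF subspace_clie] by (auto simp: sol_def shot_def V_def init_def mem_Times_iff)
  \<comment> \<open>The parameters whose solution survives to time 1; the set is open because
    survival is stable under small changes of the data.\<close>
  define U where "U = {x. \<exists>z. sol x z}"
  define Z where "Z x = (SOME z. sol x z)" for x
  have Z: "sol x (Z x)" if "x \<in> U" for x using that unfolding U_def Z_def by (metis (mono_tags) mem_Collect_eq someI_ex)
  have Z_eq: "Z x t = z t" if "sol x z" "t \<in> {0..1}" for x z t
  proof -
    have "sol x (Z x)" using that(1) by (intro Z) (auto simp: U_def)
    then show ?thesis using that by (intro quad_sol_unique[OF bounded_bilinear_nahm_quad]) (auto simp: sol_iff)
  qed
  define F where "F x = fr (Z x) 1" for x
  have F_polar: "F x \<in> polar" if "x \<in> U" for x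
  proof -
    have "shot (snd x) (fst x *\<^sub>R \<tau>) (Z x)" using Z[OF that] by (simp add: sol_def)
    then show ?thesis unfolding F_def by (rule shot_frame) simp
  qed
  \<comment> \<open>The endpoint map records the parameter s and the Hermitian factor of the frame
    at 1. Dropping the unitary factor makes V both source and target.\<close>
  define \<Phi> where "\<Phi> x = (fst x, plog (F x ** dag (F x)))" for x
  have UV: "U \<subseteq> V" by (auto simp: U_def sol_iff)
  have F_lim: "(\<lambda>n. F (x n)) \<longlonglongrightarrow> F y" if x: "\<And>n. x n \<in> U" and y: "y \<in> U" and lim: "x \<longlonglongrightarrow> y" for x y
  proof -
    have "(\<lambda>n. Z (x n) 1) \<longlonglongrightarrow> Z y 1"
    proof (rule tendstoI)
      fix e :: real assume "e > 0"
      have "quad_sol nahm_quad (init y) (Z y)" using Z[OF y] by (simp add: sol_iff)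
      from quad_sol_open[OF bounded_bilinear_nahm_quad this \<open>e > 0\<close>]
      obtain d where d: "d > 0" "\<And>p. norm (p - init y) < d \<Longrightarrow> \<exists>w. quad_sol nahm_quad p w \<and> (\<forall>t\<in>{0..1}. norm (w t - Z y t) < e)"
        by blast
      have "(\<lambda>n. init (x n)) \<longlonglongrightarrow> init y"
        by (rule continuous_on_tendsto_compose[OF init_cont lim]) auto
      then have "eventually (\<lambda>n. norm (init (x n) - init y) < d) sequentially"
        using d(1) unfolding tendsto_iff dist_norm by blast
      then show "eventually (\<lambda>n. dist (Z (x n) 1) (Z y 1) < e) sequentially"
      proof eventually_elim
        case (elim n)
        obtain w where w: "quad_sol nahm_quad (init (x n)) w" "\<forall>t\<in>{0..1}. norm (w t - Z y t) < e" using d(2)[OF elim] by blast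
        have "sol (x n) w" using w(1) x UV by (auto simp: sol_iff)
        from Z_eq[OF this, of 1] show ?case using w(2) by (simp add: dist_norm)
      qed
    qed
    then show ?thesis unfolding F_def fr_def by (intro tendsto_snd)
  qed
  have \<Phi>_lim: "(\<lambda>n. \<Phi> (x n)) \<longlonglongrightarrow> \<Phi> y" if x: "\<And>n. x n \<in> U" and y: "y \<in> U" and lim: "x \<longlonglongrightarrow> y" for x y
    unfolding \<Phi>_def
    by (rule tendsto_Pair[OF tendsto_fst[OF lim] tendsto_plog[OF F_polar[OF x] F_polar[OF y] F_lim[OF x y lim]]])
  have open_U: "openin (top_of_set V) U"
    unfolding openin_euclidean_subtopology_iff
  proof (intro conjI ballI UV)
    fix x assume x: "x \<in> U"
    have "quad_sol nahm_quad (init x) (Z x)" using Z[OF x] by (simp add: sol_iff)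
    from quad_sol_open[OF bounded_bilinear_nahm_quad this zero_less_one]
    obtain d where d: "d > 0" "\<And>p. norm (p - init x) < d \<Longrightarrow> \<exists>w. quad_sol nahm_quad p w \<and> (\<forall>t\<in>{0..1}. norm (w t - Z x t) < 1)"
      by blast
    have "isCont init x" using init_cont continuous_on_eq_continuous_at[OF open_UNIV, of init] by blast
    then obtain e where "e > 0" "\<And>y. dist y x < e \<Longrightarrow> norm (init y - init x) < d"
      using d(1) unfolding continuous_at_eps_delta dist_norm by blast
    moreover have "y \<in> U" if "y \<in> V" "norm (init y - init x) < d" for y
      using d(2)[OF that(2)] that(1) by (auto simp: U_def sol_iff)
    ultimately show "\<exists>e>0. \<forall>y\<in>V. dist y x < e \<longrightarrow> y \<in> U" by blast
  qed
  have inj: "inj_on \<Phi> U"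
  proof (rule inj_onI)
    fix x y assume x: "x \<in> U" and y: "y \<in> U" and eq: "\<Phi> x = \<Phi> y"
    have f: "fst x = fst y" and p: "plog (F x ** dag (F x)) = plog (F y ** dag (F y))"
      using eq unfolding \<Phi>_def prod.inject by (rule conjunct1, rule conjunct2)
    have mm: "F x ** dag (F x) = F y ** dag (F y)"
      using polar_plog(2)[OF F_polar[OF x], unfolded p] polar_plog(2)[OF F_polar[OF y]] by (rule trans[OF sym])
    have sx: "shot (snd x) (fst x *\<^sub>R \<tau>) (Z x)" and sy: "shot (snd y) (fst x *\<^sub>R \<tau>) (Z y)"
      using Z[OF x] Z[OF y] f by (auto simp: sol_def)
    have "snd x = snd y" by (rule shot_injective[OF sx sy]) (use mm in \<open>simp add: F_def\<close>)
    then show "x = y" using f by (simp add: prod_eq_iff)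
  qed
  have \<Phi>V: "\<Phi> x \<in> V" if "x \<in> U" for x
    using polar_plog(1)[OF F_polar[OF that]] by (simp add: \<Phi>_def V_def)
  have \<Phi>_cont: "continuous_on U \<Phi>"
    unfolding continuous_on_sequentially using \<Phi>_lim by (auto simp: o_def)
  have "openin (top_of_set V) (\<Phi> ` U)"
    by (rule invariance_of_domain_subspaces[OF open_U V V _ \<Phi>_cont _ inj]) (use \<Phi>V in auto)
  moreover have "closedin (top_of_set V) (\<Phi> ` U)"
  proof -
    have "closed (\<Phi> ` U)"
      unfolding closed_sequential_limits
    proof (intro allI impI, elim conjE)
      fix y l assume y: "\<forall>n. y n \<in> \<Phi> ` U" and lim: "y \<longlonglongrightarrow> l"
      then have "\<forall>n. \<exists>x. x \<in> U \<and> y n = \<Phi> x" by blast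
      then obtain x where x: "\<And>n. x n \<in> U" "\<And>n. y n = \<Phi> (x n)" by metis
      have shots: "shot (snd (x n)) (fst (x n) *\<^sub>R \<tau>) (Z (x n))" for n using Z[OF x(1)] by (simp add: sol_def)
      have fx: "fst (y n) = fst (x n)" "snd (y n) = plog (F (x n) ** dag (F (x n)))" for n
        by (simp_all add: x(2) \<Phi>_def)
      obtain Y where Y: "Y > 0" "\<And>n. norm (y n) \<le> Y" using convergent_imp_bounded[OF lim] unfolding bounded_pos by blast
      have Y1: "\<bar>fst (x n)\<bar> \<le> Y" for n
        using norm_fst_le[of "fst (y n)" "snd (y n)", unfolded prod.collapse] Y(2)[of n] unfolding fx(1) real_norm_def by (rule order_trans)
      have Y2: "norm (snd (y n)) \<le> Y" for n
        using norm_snd_le[of "snd (y n)" "fst (y n)", unfolded prod.collapse] Y(2)[of n] by (rule order_trans)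
      obtain K where K: "K \<ge> 1" "\<And>(A :: 'a cmat) (B :: 'a cmat). norm (A ** B) \<le> K * norm A * norm B"
        using mmul_norm_bound by blast
      obtain Kd where Kd: "Kd > 0" "\<And>A. norm (dag A) \<le> norm A * Kd" using bounded_linear.pos_bounded[OF bounded_linear_dag] by blast
      have "bounded (mexp ` cball (0 :: 'a cmat) Y)"
        by (intro compact_imp_bounded compact_continuous_image continuous_on_mexp compact_cball)
      then obtain E where E': "E > 0" "\<forall>B \<in> mexp ` cball (0 :: 'a cmat) Y. norm B \<le> E" unfolding bounded_pos by blast
      have E: "E > 0" "\<And>B :: 'a cmat. norm B \<le> Y \<Longrightarrow> norm (mexp B) \<le> E" using E' by auto
      obtain M where M: "M > 0" "\<And>g. g \<in> G \<Longrightarrow> norm g \<le> M" using compact_imp_bounded[OF cmp] unfolding bounded_pos by blast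
      \<comment> \<open>Convergence in the target bounds the Hermitian factor of the endpoint,
        compactness of G the unitary one, and |s| <= Y the data s \<tau>: all that the a priori
        bound asks for.\<close>
      define R where "R = max (K * E * M) (max (K * M * E) (Y * norm \<tau>))"
      have Fb: "norm (F (x n)) \<le> R" "norm (matrix_inv (F (x n))) \<le> R" for n
      proof -
        obtain k where k: "k \<in> G" "F (x n) = mexp (snd (y n)) ** k"
          using polar_plog(3)[OF F_polar[OF x(1)]] fx(2) by metis
        have "norm (F (x n)) \<le> K * E * M"
          unfolding k(2) using K(1) E M(2)[OF k(1)] Y2[of n]
          by (intro order_trans[OF K(2)] mult_mono mult_left_mono mult_nonneg_nonneg) auto
        then show "norm (F (x n)) \<le> R" by (simp add: R_def)
        have "matrix_inv (F (x n)) = dag k ** mexp (- snd (y n))"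
          by (rule matrix_inv_eqI) (simp add: k matrix_mul_assoc unitary_cancel)
        moreover have "norm (dag k ** mexp (- snd (y n))) \<le> K * M * E"
          using K(1) E M(1) M(2)[OF dag_G[OF k(1)]] Y2[of n]
          by (intro order_trans[OF K(2)] mult_mono mult_left_mono mult_nonneg_nonneg) auto
        ultimately show "norm (matrix_inv (F (x n))) \<le> R" by (simp add: R_def)
      qed
      obtain B where B: "\<And>\<alpha> \<beta> g d t i. temporal \<alpha> \<beta> g \<Longrightarrow>
         (\<And>t. t \<in> {0..1} \<Longrightarrow> (d has_vector_derivative - (2 *\<^sub>R (\<alpha> t ** d t))) (at t within {0..1})) \<Longrightarrow>
         g 0 = mat 1 \<Longrightarrow> d 0 = mat 1 \<Longrightarrow> (\<And>t. t \<in> {0..1} \<Longrightarrow> g t ** d t = mat 1) \<Longrightarrow> (\<And>i. \<beta> i 1 = d 1 ** \<beta> i 0 ** g 1) \<Longrightarrow>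
         (\<And>i. norm (\<beta> i 0) \<le> R) \<Longrightarrow> norm (g 1) \<le> R \<Longrightarrow> norm (d 1) \<le> R \<Longrightarrow>
         t \<in> {0..1} \<Longrightarrow> norm (\<alpha> t) \<le> B \<and> norm (\<beta> i t) \<le> B \<and> norm (g t) \<le> B"
        by (rule temporal_bound[of R]) blast
      have bnd: "norm (al (Z (x n)) t) \<le> B \<and> norm (be (Z (x n)) i t) \<le> B \<and> norm (fr (Z (x n)) t) \<le> B" if t: "t \<in> {0..1}" for n t i
      proof -
        obtain d where d: "d 0 = mat 1" "\<And>t. t \<in> {0..1} \<Longrightarrow> (d has_vector_derivative - (2 *\<^sub>R (al (Z (x n)) t ** d t))) (at t within {0..1})"
          "\<And>t. t \<in> {0..1} \<Longrightarrow> fr (Z (x n)) t ** d t = mat 1"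
          "\<And>t i. t \<in> {0..1} \<Longrightarrow> be (Z (x n)) i t = d t ** (fst (x n) *\<^sub>R \<tau>) $ i ** fr (Z (x n)) t"
          by (rule shot_frame[OF shots[of n]]) blast
        have d1: "d 1 = matrix_inv (F (x n))" using d(3)[of 1] by (simp add: F_def matrix_inv_eqI)
        have "norm (be (Z (x n)) i 0) \<le> R" for i
        proof -
          have "norm (be (Z (x n)) i 0) = \<bar>fst (x n)\<bar> * norm (\<tau> $ i)" by (simp add: shot_start(2)[OF shots])
          also have "\<dots> \<le> Y * norm \<tau>" using Y1[of n] Y(1) by (intro mult_mono Finite_Cartesian_Product.norm_nth_le) auto
          finally show ?thesis by (simp add: R_def)
        qed
        then show ?thesis
          using Fb[of n] shot_start[OF shots[of n]] d t
          by (intro B[OF shot_temporal[OF shots[of n]] d(2)]) (auto simp: d1[symmetric] F_def[symmetric])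
      qed
      have Zb: "norm (Z (x n) t) \<le> B + (3 * B + B)" if t: "t \<in> {0..1}" for n t
      proof -
        obtain a b g where z: "Z (x n) t = (a, b, g)" by (metis prod_cases3)
        have a: "norm a \<le> B" and g: "norm g \<le> B" and b: "norm (b $ i) \<le> B" for i
          using bnd[OF t, of n] by (simp_all add: z al_def be_def fr_def)
        have "norm b \<le> (\<Sum>i\<in>UNIV. norm (b $ i))" by (rule norm_vec3_le)
        also have "\<dots> \<le> (\<Sum>i\<in>(UNIV :: 3 set). B)" by (rule sum_mono) (rule b)
        finally have "norm b \<le> 3 * B" by simp
        then show ?thesis
          unfolding z using a g by (intro order_trans[OF norm_Pair_le] add_mono) auto
      qed
      have "\<forall>n. x n \<in> cball 0 (Y + B)"
      proof
        fix n
        have "norm (snd (x n)) \<le> B" using bnd[of 0 n 1] shot_start(1)[OF shots[of n]] by simp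
        moreover have "norm (x n) \<le> norm (fst (x n)) + norm (snd (x n))" using norm_Pair_le[of "fst (x n)" "snd (x n)"] by simp
        ultimately show "x n \<in> cball 0 (Y + B)" using Y1[of n] by simp
      qed
      then obtain x0 \<sigma> where x0: "strict_mono (\<sigma> :: nat \<Rightarrow> nat)" "(x \<circ> \<sigma>) \<longlonglongrightarrow> x0"
        by (rule seq_compactE[OF compact_imp_seq_compact[OF compact_cball]])
      have il: "(\<lambda>n. init ((x \<circ> \<sigma>) n)) \<longlonglongrightarrow> init x0"
        by (rule continuous_on_tendsto_compose[OF init_cont x0(2)]) auto
      obtain w where w: "quad_sol nahm_quad (init x0) w"
      proof (rule quad_sol_closed[OF bounded_bilinear_nahm_quad _ _ il])
        show "quad_sol nahm_quad (init ((x \<circ> \<sigma>) n)) (Z ((x \<circ> \<sigma>) n))" for n using Z[OF x(1)] by (simp add: sol_iff)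
        show "norm (Z ((x \<circ> \<sigma>) n) t) \<le> B + (3 * B + B)" if "t \<in> {0..1}" for n t using Zb[OF that] by simp
      qed (rule that)
      have "x0 \<in> V" by (rule closed_sequentially[OF closed_subspace[OF V] _ x0(2)]) (use x(1) UV in auto)
      then have x0U: "x0 \<in> U" using w by (auto simp: U_def sol_iff)
      have "(\<lambda>n. \<Phi> ((x \<circ> \<sigma>) n)) \<longlonglongrightarrow> \<Phi> x0" by (rule \<Phi>_lim[OF _ x0U x0(2)]) (simp add: x(1))
      moreover have "(\<lambda>n. \<Phi> ((x \<circ> \<sigma>) n)) \<longlonglongrightarrow> l"
        using LIMSEQ_subseq_LIMSEQ[OF lim x0(1)] by (simp add: o_def x(2))
      ultimately have "l = \<Phi> x0" by (rule LIMSEQ_unique[symmetric])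
      then show "l \<in> \<Phi> ` U" using x0U by blast
    qed
    then show ?thesis using \<Phi>V by (intro closed_subset) auto
  qed
  \<comment> \<open>The constant solution with \<alpha> = 0, \<beta> = 0 and frame 1; by
    connectedness of V a nonempty open and closed image is everything.\<close>
  moreover have "(0, 0) \<in> U"
  proof -
    have "nahm_quad (init (0, 0)) (init (0, 0)) = 0"
      by (simp add: init_def nahm_quad_def bracket_def mmul.zero_left mmul.zero_right vec_eq_iff prod_eq_iff)
    then have "quad_sol nahm_quad (init (0, 0)) (\<lambda>_. init (0, 0))" by (simp add: quad_sol_def)
    moreover have "(0, 0) \<in> V" by (simp add: V_def zero_herm)
    ultimately show ?thesis unfolding U_def mem_Collect_eq sol_iff by (intro exI conjI)
  qed
  moreover have "connected V" by (intro convex_connected subspace_imp_convex V)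
  ultimately have img: "\<Phi> ` U = V" unfolding connected_clopen by blast
  have "(1, plog (m ** dag m)) \<in> V" using polar_plog(1)[OF m] by (simp add: V_def)
  then obtain x where x: "x \<in> U" "\<Phi> x = (1, plog (m ** dag m))" unfolding img[symmetric] by (metis imageE)
  have x1: "fst x = 1" and p: "plog (F x ** dag (F x)) = plog (m ** dag m)"
    using x(2) unfolding \<Phi>_def prod.inject by (rule conjunct1, rule conjunct2)
  have sh: "shot (snd x) \<tau> (Z x)" using Z[OF x(1)] by (simp add: sol_def x1)
  have mm: "F x ** dag (F x) = m ** dag m"
    using polar_plog(2)[OF F_polar[OF x(1)], unfolded p] polar_plog(2)[OF m] by (rule trans[OF sym])
  have inv: "invertible (F x)" and Fi: "matrix_inv (F x) \<in> polar" using matrix_group_polar F_polar[OF x(1)] by (auto simp: matrix_group_def)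
  \<comment> \<open>F x and m have the same positive part, so their quotient is unitary and lies in
    \<open>polar\<close>, hence in G.\<close>
  define k where "k = matrix_inv (F x) ** m"
  have "k \<in> polar" using matrix_group_polar Fi m by (auto simp: matrix_group_def k_def)
  moreover have "k ** dag k = mat 1"
  proof -
    have "k ** dag k = matrix_inv (F x) ** (m ** dag m) ** dag (matrix_inv (F x))" by (simp add: k_def dag_mult matrix_mul_assoc)
    also have "\<dots> = (matrix_inv (F x) ** F x) ** dag (matrix_inv (F x) ** F x)" by (simp add: mm[symmetric] dag_mult matrix_mul_assoc)
    finally show ?thesis by (simp add: matrix_inv_mult[OF inv])
  qed
  ultimately have "k \<in> G" by (rule polar_unitary)
  moreover have "fr (Z x) 1 ** k = m" unfolding F_def[symmetric] k_def by (simp add: matrix_mul_assoc matrix_inv_mult[OF inv])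
  ultimately show ?thesis using that sh by blast
qed

end

section \<open>The correspondence\<close>

context unitary_group
begin

lemma star_real_derivative:
  assumes \<alpha>: "\<And>t. t \<in> {0..1} \<Longrightarrow> \<alpha> t \<in> clie" and t: "t \<in> {0..1}"
  shows "((\<lambda>s. \<alpha> s + star G (\<alpha> s)) has_vector_derivative D) (at t within {0..1})
    \<longleftrightarrow> ((\<lambda>s. \<alpha> s + dag (\<alpha> s)) has_vector_derivative D) (at t within {0..1})"
proof
  assume "((\<lambda>s. \<alpha> s + star G (\<alpha> s)) has_vector_derivative D) (at t within {0..1})"
  then show "((\<lambda>s. \<alpha> s + dag (\<alpha> s)) has_vector_derivative D) (at t within {0..1})"
    by (rule has_vector_derivative_transform[OF t, rotated]) (simp add: star_eq_dag[OF \<alpha>])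
next
  assume "((\<lambda>s. \<alpha> s + dag (\<alpha> s)) has_vector_derivative D) (at t within {0..1})"
  then show "((\<lambda>s. \<alpha> s + star G (\<alpha> s)) has_vector_derivative D) (at t within {0..1})"
    by (rule has_vector_derivative_transform[OF t, rotated]) (simp add: star_eq_dag[OF \<alpha>])
qed

lemma vector_derivative_add_eq_0_iff:
  assumes f: "(f has_vector_derivative f') (at t within {0..1})" and t: "t \<in> {0..1::real}"
  shows "vector_derivative f (at t within {0..1}) + c = 0 \<longleftrightarrow> (f has_vector_derivative - c) (at t within {0..1})"
proof
  assume "vector_derivative f (at t within {0..1}) + c = 0"
  then have "f' = - c" unfolding vector_derivative_unit[OF f t] by (rule eq_neg_iff_add_eq_0[THEN iffD2])
  then show "(f has_vector_derivative - c) (at t within {0..1})" using f by simp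
next
  assume "(f has_vector_derivative - c) (at t within {0..1})"
  from vector_derivative_unit[OF this t] show "vector_derivative f (at t within {0..1}) + c = 0" by simp
qed

text \<open>\<open>vector_derivative\<close> is a total function, so an equation for it speaks of a
  derivative only once differentiability is known. The smoothness conjuncts supply this, and
  membership in \<open>clie\<close> lets \<open>dag\<close> replace \<open>star G\<close>.\<close>

lemma nahm_solutions_iff:
  "(\<alpha>, \<beta>) \<in> nahm_solutions G \<longleftrightarrow>
     (\<forall>t\<in>{0..1}. \<alpha> t \<in> clie) \<and> smooth_unit \<alpha> \<and> (\<forall>i. (\<forall>t\<in>{0..1}. \<beta> i t \<in> clie) \<and> smooth_unit (\<beta> i)) \<and>
     (\<forall>i. \<forall>t\<in>{0..1}. (\<beta> i has_vector_derivative - (2 *\<^sub>R bracket (\<alpha> t) (\<beta> i t))) (at t within {0..1})) \<and>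
     (\<forall>i j. \<forall>t\<in>{0..1}. bracket (\<beta> i t) (\<beta> j t) = 0) \<and> real_eq \<alpha> \<beta>"
  (is "?L \<longleftrightarrow> ?V \<and> ?S \<and> ?B \<and> ?E \<and> ?C \<and> _")
proof -
  have "vector_derivative (\<beta> i) (at t within {0..1}) + 2 *\<^sub>R bracket (\<alpha> t) (\<beta> i t) = 0
      \<longleftrightarrow> (\<beta> i has_vector_derivative - (2 *\<^sub>R bracket (\<alpha> t) (\<beta> i t))) (at t within {0..1})"
    if B: ?B and t: "t \<in> {0..1}" for i t
  proof -
    have "smooth_unit (\<beta> i)" using B by simp
    then obtain f' where "\<And>t. t \<in> {0..1} \<Longrightarrow> (\<beta> i has_vector_derivative f' t) (at t within {0..1})"
      by (rule smooth_unit_derivative) blast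
    from this[OF t] show ?thesis by (rule vector_derivative_add_eq_0_iff[OF _ t])
  qed
  then have 1: "(\<forall>i. \<forall>t\<in>{0..1}. vector_derivative (\<beta> i) (at t within {0..1}) + 2 *\<^sub>R bracket (\<alpha> t) (\<beta> i t) = 0) \<longleftrightarrow> ?E"
    if ?B using that by simp
  have "vector_derivative (\<lambda>s. \<alpha> s + star G (\<alpha> s)) (at t within {0..1})
        + 2 *\<^sub>R (bracket (\<alpha> t) (star G (\<alpha> t)) + (\<Sum>i\<in>UNIV. bracket (\<beta> i t) (star G (\<beta> i t)))) = 0
      \<longleftrightarrow> ((\<lambda>t. \<alpha> t + dag (\<alpha> t)) has_vector_derivative
         - (2 *\<^sub>R (bracket (\<alpha> t) (dag (\<alpha> t)) + (\<Sum>i\<in>UNIV. bracket (\<beta> i t) (dag (\<beta> i t)))))) (at t within {0..1})"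
    if V: ?V and S: ?S and B: ?B and t: "t \<in> {0..1}" for t
  proof -
    have sd: "((\<lambda>s. \<alpha> s + star G (\<alpha> s)) has_vector_derivative D) (at t within {0..1})
        \<longleftrightarrow> ((\<lambda>s. \<alpha> s + dag (\<alpha> s)) has_vector_derivative D) (at t within {0..1})" for D
      by (rule star_real_derivative[OF _ t]) (rule V[rule_format])
    obtain f' where "\<And>t. t \<in> {0..1} \<Longrightarrow> (\<alpha> has_vector_derivative f' t) (at t within {0..1})"
      by (rule smooth_unit_derivative[OF S]) blast
    note f' = this[OF t]
    from has_vector_derivative_add[OF f' has_vector_derivative_dag[OF f']]
    have d: "((\<lambda>s. \<alpha> s + star G (\<alpha> s)) has_vector_derivative f' t + dag (f' t)) (at t within {0..1})"
      by (rule sd[THEN iffD2])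
    have st: "star G (\<alpha> t) = dag (\<alpha> t)" "\<And>i. star G (\<beta> i t) = dag (\<beta> i t)"
      using V B t by (simp_all add: star_eq_dag)
    show ?thesis
      unfolding vector_derivative_add_eq_0_iff[OF d t] st sd ..
  qed
  then have 2: "(\<forall>t\<in>{0..1}. vector_derivative (\<lambda>s. \<alpha> s + star G (\<alpha> s)) (at t within {0..1})
        + 2 *\<^sub>R (bracket (\<alpha> t) (star G (\<alpha> t)) + (\<Sum>i\<in>UNIV. bracket (\<beta> i t) (star G (\<beta> i t)))) = 0)
      \<longleftrightarrow> real_eq \<alpha> \<beta>" if ?V ?S ?B
    unfolding real_eq_def using that by (intro ball_cong refl)
  show ?thesis
    unfolding nahm_solutions_def mem_Collect_eq prod.case
    by (intro conj_cong refl 1 2)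
qed

lemma smooth_unit_imp_continuous: "smooth_unit f \<Longrightarrow> continuous_on {0..1} f"
  unfolding smooth_unit_def using Ck_unit_0 by blast

section \<open>Frames and endpoints of general solutions\<close>

definition frame :: "(real \<Rightarrow> 'a cmat) \<Rightarrow> (real \<Rightarrow> 'a cmat) \<Rightarrow> (real \<Rightarrow> 'a cmat) \<Rightarrow> bool" where
  "frame \<alpha> g d \<longleftrightarrow> g 0 = mat 1 \<and> d 0 = mat 1 \<and>
     (\<forall>t\<in>{0..1}. (g has_vector_derivative 2 *\<^sub>R (g t ** \<alpha> t)) (at t within {0..1}) \<and>
       (d has_vector_derivative - (2 *\<^sub>R (\<alpha> t ** d t))) (at t within {0..1}) \<and>
       g t ** d t = mat 1 \<and> d t ** g t = mat 1 \<and> matrix_inv (g t) = d t \<and> g t \<in> polar)"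

lemma frameD:
  assumes "frame \<alpha> g d" "t \<in> {0..1}"
  shows "(g has_vector_derivative 2 *\<^sub>R (g t ** \<alpha> t)) (at t within {0..1})"
    "(d has_vector_derivative - (2 *\<^sub>R (\<alpha> t ** d t))) (at t within {0..1})"
    "g t ** d t = mat 1" "d t ** g t = mat 1" "matrix_inv (g t) = d t" "g t \<in> polar"
  using assms by (auto simp: frame_def)

lemma frame_ends: "frame \<alpha> g d \<Longrightarrow> g 0 = mat 1" "frame \<alpha> g d \<Longrightarrow> d 0 = mat 1" by (auto simp: frame_def)

lemma obtain_frame:
  assumes \<alpha>: "\<And>t. t \<in> {0..1} \<Longrightarrow> \<alpha> t \<in> clie" "continuous_on {0..1} \<alpha>"
  obtains g d where "frame \<alpha> g d"
proof -
  define \<xi> where "\<xi> t = 2 *\<^sub>R \<alpha> t" for t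
  have \<xi>: "\<And>t. t \<in> {0..1} \<Longrightarrow> \<xi> t \<in> clie" "continuous_on {0..1} \<xi>"
    using \<alpha> subspace_scale[OF subspace_clie] by (auto simp: \<xi>_def intro!: continuous_intros)
  obtain g d where gd: "g 0 = mat 1" "d 0 = mat 1"
    "\<And>t. t \<in> {0..1} \<Longrightarrow> (g has_vector_derivative g t ** \<xi> t) (at t within {0..1})"
    "\<And>t. t \<in> {0..1} \<Longrightarrow> (d has_vector_derivative - (\<xi> t ** d t)) (at t within {0..1})"
    by (rule frame_exists[OF \<xi>(2)]) blast
  have "frame \<alpha> g d"
    unfolding frame_def
  proof (intro conjI ballI gd)
    fix t :: real assume t: "t \<in> {0..1}"
    show gd1: "g t ** d t = mat 1" by (rule frame_inverse[OF gd(3,4) _ t]) (simp_all add: gd)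
    show "d t ** g t = mat 1" by (rule matrix_left_right_inverse1[OF gd1])
    show "matrix_inv (g t) = d t" by (rule matrix_inv_eqI[OF gd1])
    show "g t \<in> polar" by (rule frame_polar[OF \<xi> gd(3) gd(1) t])
    show "(g has_vector_derivative 2 *\<^sub>R (g t ** \<alpha> t)) (at t within {0..1})"
      using gd(3)[OF t] by (simp add: \<xi>_def mmul.scaleR_right)
    show "(d has_vector_derivative - (2 *\<^sub>R (\<alpha> t ** d t))) (at t within {0..1})"
      using gd(4)[OF t] by (simp add: \<xi>_def mmul.scaleR_left)
  qed
  then show ?thesis by (rule that)
qed

lemma parallel_frame_iff:
  assumes \<alpha>: "continuous_on {0..1} \<alpha>" and f: "frame \<alpha> g d"
  shows "parallel_frame G \<alpha> h \<longleftrightarrow> (\<forall>t\<in>{0..1}. h t = g t)"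
proof
  assume h: "parallel_frame G \<alpha> h"
  show "\<forall>t\<in>{0..1}. h t = g t"
  proof
    fix t :: real assume t: "t \<in> {0..1}"
    show "h t = g t"
    proof (rule frame_unique[where \<xi>="\<lambda>t. 2 *\<^sub>R \<alpha> t", OF _ _ _ _ t])
      show "continuous_on {0..1} (\<lambda>t. 2 *\<^sub>R \<alpha> t)" by (intro continuous_intros \<alpha>)
      show "(h has_vector_derivative h s ** (2 *\<^sub>R \<alpha> s)) (at s within {0..1})" if "s \<in> {0..1}" for s
        using h that by (simp add: parallel_frame_def mmul.scaleR_right)
      show "(g has_vector_derivative g s ** (2 *\<^sub>R \<alpha> s)) (at s within {0..1})" if "s \<in> {0..1}" for s
        using frameD(1)[OF f that] by (simp add: mmul.scaleR_right)
      show "h 0 = g 0" using h frame_ends(1)[OF f] by (simp add: parallel_frame_def)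
    qed
  qed
next
  assume eq: "\<forall>t\<in>{0..1}. h t = g t"
  have "(h has_vector_derivative 2 *\<^sub>R (h t ** \<alpha> t)) (at t within {0..1})" if t: "t \<in> {0..1}" for t
  proof (rule has_vector_derivative_transform[OF t, where f=g])
    show "(g has_vector_derivative 2 *\<^sub>R (h t ** \<alpha> t)) (at t within {0..1})"
      using frameD(1)[OF f t] eq t by simp
  qed (use eq in auto)
  then show "parallel_frame G \<alpha> h"
    using eq frame_ends[OF f] frameD(6)[OF f] by (simp add: parallel_frame_def complexification_polar)
qed

text \<open>The Nahm equation for b says that g b d is constant; the other two forms move g or d to
  the other side, as needed for intertwining.\<close>

lemma frame_beta:
  assumes f: "frame \<alpha> g d"
    and \<beta>: "\<And>t. t \<in> {0..1} \<Longrightarrow> (b has_vector_derivative - (2 *\<^sub>R bracket (\<alpha> t) (b t))) (at t within {0..1})"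
    and t: "t \<in> {0..1}"
  shows "g t ** b t ** d t = b 0" "g t ** b t = b 0 ** g t" "b t ** d t = d t ** b 0"
proof -
  have "g t ** b t ** d t = g 0 ** b 0 ** d 0"
  proof (rule has_vector_derivative_zero_eq[where z="\<lambda>t. g t ** b t ** d t" and a=0 and b=1, OF _ t])
    fix s :: real assume s: "s \<in> {0..1}"
    show "((\<lambda>t. g t ** b t ** d t) has_vector_derivative 0) (at s within {0..1})"
      using has_vector_derivative_mmul[OF has_vector_derivative_mmul[OF frameD(1)[OF f s] \<beta>[OF s]] frameD(2)[OF f s]]
      by (simp add: bracket_def mmul_simps algebra_simps)
  qed
  then show 1: "g t ** b t ** d t = b 0" by (simp add: frame_ends[OF f])
  have "g t ** b t ** (d t ** g t) = b 0 ** g t" using 1 by (simp add: matrix_mul_assoc)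
  then show "g t ** b t = b 0 ** g t" by (simp add: frameD(4)[OF f t])
  have "(d t ** g t) ** b t ** d t = d t ** b 0" unfolding 1[symmetric] by (simp add: matrix_mul_assoc)
  then show "b t ** d t = d t ** b 0" by (simp add: frameD(4)[OF f t])
qed

text \<open>The values of \<beta> at time 0 represent the constant g \<beta> g^-1, as g is 1 there.
  For solutions the choice is harmless: parallel frames agree on the unit interval.\<close>

definition endpoint :: "'a config \<Rightarrow> 'a cmat \<times> (3 \<Rightarrow> 'a cmat)" where
  "endpoint = (\<lambda>(\<alpha>, \<beta>). ((SOME g. parallel_frame G \<alpha> g) 1, \<lambda>i. \<beta> i 0))"

lemma solution_frame:
  assumes s: "(\<alpha>, \<beta>) \<in> nahm_solutions G"
  obtains g d where "frame \<alpha> g d" "\<And>h. parallel_frame G \<alpha> h \<longleftrightarrow> (\<forall>t\<in>{0..1}. h t = g t)"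
    "endpoint (\<alpha>, \<beta>) = (g 1, \<lambda>i. \<beta> i 0)"
proof -
  have \<alpha>: "\<And>t. t \<in> {0..1} \<Longrightarrow> \<alpha> t \<in> clie" and c: "continuous_on {0..1} \<alpha>"
    using s smooth_unit_imp_continuous unfolding nahm_solutions_iff by blast+
  obtain g d where f: "frame \<alpha> g d" by (rule obtain_frame[OF \<alpha> c])
  note iff = parallel_frame_iff[OF c f]
  have "parallel_frame G \<alpha> (SOME g. parallel_frame G \<alpha> g)"
    by (rule someI[of _ g]) (simp add: iff)
  then have "(SOME g. parallel_frame G \<alpha> g) 1 = g 1" using iff by simp
  then show ?thesis using that[OF f iff] by (simp add: endpoint_def)
qed

lemma endpoint_eq:
  assumes s: "(\<alpha>, \<beta>) \<in> nahm_solutions G" and g: "parallel_frame G \<alpha> g" and t: "t \<in> {0..1}"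
  shows "endpoint (\<alpha>, \<beta>) = (g 1, \<lambda>i. g t ** \<beta> i t ** matrix_inv (g t))"
proof -
  obtain g' d where f: "frame \<alpha> g' d" "\<And>h. parallel_frame G \<alpha> h \<longleftrightarrow> (\<forall>t\<in>{0..1}. h t = g' t)"
    "endpoint (\<alpha>, \<beta>) = (g' 1, \<lambda>i. \<beta> i 0)" by (rule solution_frame[OF s]) blast
  have eq: "g t = g' t" if "t \<in> {0..1}" for t using g f(2) that by blast
  have "g t ** \<beta> i t ** matrix_inv (g t) = \<beta> i 0" for i
    using frame_beta(1)[OF f(1) _ t, of "\<beta> i"] s unfolding nahm_solutions_iff
    by (simp add: eq[OF t] frameD(5)[OF f(1) t])
  then show ?thesis using f(3) eq[of 1] by simp
qed

lemma dag_path_derivative: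
  assumes u: "\<And>t. t \<in> {0..1} \<Longrightarrow> u t \<in> G" and d: "(u has_vector_derivative u') (at t within {0..1})" and t: "t \<in> {0..1}"
  shows "dag u' = - (dag (u t) ** u' ** dag (u t))"
proof -
  have "((\<lambda>s. u s ** dag (u s)) has_vector_derivative u t ** dag u' + u' ** dag (u t)) (at t within {0..1})"
    by (rule has_vector_derivative_mmul[OF d has_vector_derivative_dag[OF d]])
  from vector_derivative_unit[OF this t]
  have 1: "vector_derivative (\<lambda>s. u s ** dag (u s)) (at t within {0..1}) = u t ** dag u' + u' ** dag (u t)" .
  have "((\<lambda>s. u s ** dag (u s)) has_vector_derivative 0) (at t within {0..1})"
    by (rule has_vector_derivative_transform[OF t _ has_vector_derivative_const[of "mat 1"]]) (use unitary u in auto)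
  from vector_derivative_unit[OF this t] 1 have "u t ** dag u' + u' ** dag (u t) = 0" by simp
  then have "dag (u t) ** (u t ** dag u' + u' ** dag (u t)) = 0" by (simp add: mmul.zero_right)
  then show ?thesis by (simp add: mmul_simps unitary'[OF u[OF t]] eq_neg_iff_add_eq_0)
qed

section \<open>Gauge orbits are the fibres of the endpoint map\<close>

text \<open>The transformed solution has frame g u^-1. The condition u = 1 at time 1 preserves its
  endpoint, and at time 0 it preserves the normalization of the frame and the values of
  \<beta>.\<close>

lemma gauge_endpoint:
  assumes A: "(\<alpha>, \<beta>) \<in> nahm_solutions G" and B: "(\<alpha>', \<beta>') \<in> nahm_solutions G"
    and u: "u \<in> based_gauge_group G" and eq: "config_eq (gauge_act u (\<alpha>, \<beta>)) (\<alpha>', \<beta>')"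
  shows "endpoint (\<alpha>, \<beta>) = endpoint (\<alpha>', \<beta>')"
proof -
  have uG: "\<And>t. t \<in> {0..1} \<Longrightarrow> u t \<in> G" and u2: "Ck_unit (Suc 1) u" and u01: "u 0 = mat 1" "u 1 = mat 1"
    using u by (auto simp: based_gauge_group_def numeral_2_eq_2)
  obtain u' where u': "\<And>t. t \<in> {0..1} \<Longrightarrow> (u has_vector_derivative u' t) (at t within {0..1})"
    using u2 unfolding Ck_unit_Suc by blast
  obtain g d where f: "frame \<alpha> g d" "endpoint (\<alpha>, \<beta>) = (g 1, \<lambda>i. \<beta> i 0)" by (rule solution_frame[OF A]) blast
  obtain g' d' where f': "frame \<alpha>' g' d'" "\<And>h. parallel_frame G \<alpha>' h \<longleftrightarrow> (\<forall>t\<in>{0..1}. h t = g' t)"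
    "endpoint (\<alpha>', \<beta>') = (g' 1, \<lambda>i. \<beta>' i 0)" by (rule solution_frame[OF B]) blast
  have \<alpha>': "\<alpha>' t = u t ** \<alpha> t ** dag (u t) - (1/2) *\<^sub>R (u' t ** dag (u t))"
    and \<beta>': "\<beta>' i t = u t ** \<beta> i t ** dag (u t)" if t: "t \<in> {0..1}" for t i
  proof -
    have "u t ** \<alpha> t ** matrix_inv (u t) - (1/2) *\<^sub>R (vector_derivative u (at t within {0..1}) ** matrix_inv (u t)) = \<alpha>' t"
      "u t ** \<beta> i t ** matrix_inv (u t) = \<beta>' i t"
      using eq t by (simp_all add: config_eq_def gauge_act_def)
    then show "\<alpha>' t = u t ** \<alpha> t ** dag (u t) - (1/2) *\<^sub>R (u' t ** dag (u t))" "\<beta>' i t = u t ** \<beta> i t ** dag (u t)"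
      unfolding vector_derivative_unit[OF u'[OF t] t] matrix_inv_G[OF uG[OF t]] by simp_all
  qed
  have "parallel_frame G \<alpha>' (\<lambda>t. g t ** dag (u t))"
    unfolding parallel_frame_def complexification_polar
  proof (intro conjI ballI)
    show "g 0 ** dag (u 0) = mat 1" by (simp add: u01 frame_ends[OF f(1)])
    fix t :: real assume t: "t \<in> {0..1}"
    show "g t ** dag (u t) \<in> polar"
      using matrix_group_polar frameD(6)[OF f(1) t] G_subset_polar[OF dag_G[OF uG[OF t]]] by (simp add: matrix_group_def)
    have "dag (u' t) = - (dag (u t) ** u' t ** dag (u t))" by (rule dag_path_derivative[OF uG u'[OF t] t])
    then show "((\<lambda>t. g t ** dag (u t)) has_vector_derivative 2 *\<^sub>R (g t ** dag (u t) ** \<alpha>' t)) (at t within {0..1})"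
      using has_vector_derivative_mmul[OF frameD(1)[OF f(1) t] has_vector_derivative_dag[OF u'[OF t]]]
      by (simp add: \<alpha>'[OF t] mmul_simps unitary_cancel[OF uG[OF t]] scaleR_diff_right)
  qed
  then have "g 1 ** dag (u 1) = g' 1" using f'(2) by simp
  moreover have "\<beta>' i 0 = \<beta> i 0" for i using \<beta>'[of 0] by (simp add: u01)
  ultimately show ?thesis by (simp add: f(2) f'(3) u01)
qed

text \<open>The transition h between the frames satisfies h' = 2 (h \<alpha> - \<alpha>' h). Read
  backwards this is the gauge formula for \<alpha>', and since the solutions are smooth it also
  makes h smooth, in particular an admissible \<open>C\<^sup>2\<close> gauge transformation.\<close>

lemma endpoint_gauge:
  assumes A: "(\<alpha>, \<beta>) \<in> nahm_solutions G" and B: "(\<alpha>', \<beta>') \<in> nahm_solutions G"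
    and eq: "endpoint (\<alpha>, \<beta>) = endpoint (\<alpha>', \<beta>')"
  shows "\<exists>u\<in>based_gauge_group G. config_eq (gauge_act u (\<alpha>, \<beta>)) (\<alpha>', \<beta>')"
proof -
  obtain g d where f: "frame \<alpha> g d" "endpoint (\<alpha>, \<beta>) = (g 1, \<lambda>i. \<beta> i 0)" by (rule solution_frame[OF A]) blast
  obtain g' d' where f': "frame \<alpha>' g' d'" "endpoint (\<alpha>', \<beta>') = (g' 1, \<lambda>i. \<beta>' i 0)" by (rule solution_frame[OF B]) blast
  have g1: "g 1 = g' 1" and b0: "\<And>i. \<beta> i 0 = \<beta>' i 0" using eq f(2) f'(2) by (auto dest: fun_cong)
  define h k where "h t = d' t ** g t" and "k t = d t ** g' t" for t
  define h' where "h' t = 2 *\<^sub>R (h t ** \<alpha> t - \<alpha>' t ** h t)" for t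
  have h: "(h has_vector_derivative h' t) (at t within {0..1})" if "t \<in> {0..1}" for t
    using has_vector_derivative_mmul[OF frameD(2)[OF f'(1) that] frameD(1)[OF f(1) that]]
    unfolding h'_def h_def[abs_def] by (simp add: mmul_simps scaleR_diff_right)
  have k: "(k has_vector_derivative 2 *\<^sub>R (k t ** \<alpha>' t - \<alpha> t ** k t)) (at t within {0..1})" if "t \<in> {0..1}" for t
    using has_vector_derivative_mmul[OF frameD(2)[OF f(1) that] frameD(1)[OF f'(1) that]]
    unfolding k_def[abs_def] by (simp add: mmul_simps scaleR_diff_right)
  have hk: "h t ** k t = mat 1" if t: "t \<in> {0..1}" for t
  proof -
    have "h t ** k t = d' t ** (g t ** d t) ** g' t" by (simp add: h_def k_def matrix_mul_assoc)
    then show ?thesis by (simp add: frameD(3)[OF f(1) t] frameD(4)[OF f'(1) t])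
  qed
  have \<beta>: "h t ** \<beta> i t = \<beta>' i t ** h t" if t: "t \<in> {0..1}" for t i
  proof -
    have "g t ** \<beta> i t = \<beta> i 0 ** g t"
      by (rule frame_beta(2)[OF f(1) _ t]) (use A nahm_solutions_iff in blast)
    moreover have "\<beta>' i t ** d' t = d' t ** \<beta>' i 0"
      by (rule frame_beta(3)[OF f'(1) _ t]) (use B nahm_solutions_iff in blast)
    ultimately show ?thesis
      unfolding h_def by (metis b0 matrix_mul_assoc)
  qed
  have h01: "h 0 = mat 1" "h 1 = mat 1"
    using frameD(4)[OF f'(1), of 1] by (simp_all add: h_def g1 frame_ends[OF f(1)] frame_ends[OF f'(1)])
  have unit: "h t ** dag (h t) = mat 1" if t: "t \<in> {0..1}" for t
    by (rule transition_unitary[OF _ _ h[unfolded h'_def] k hk \<beta> _ _ t])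
      (use A B h01 in \<open>auto simp: nahm_solutions_iff\<close>)
  have hG: "h t \<in> G" if t: "t \<in> {0..1}" for t
  proof (rule polar_unitary[OF _ unit[OF t]])
    have "matrix_inv (g' t) \<in> polar" using matrix_group_polar frameD(6)[OF f'(1) t] by (simp add: matrix_group_def)
    then show "h t \<in> polar"
      using matrix_group_polar frameD(6)[OF f(1) t] by (simp add: h_def frameD(5)[OF f'(1) t] matrix_group_def)
  qed
  have "smooth_unit h"
  proof (rule smooth_unitI[OF h])
    have "smooth_unit \<alpha>" "smooth_unit \<alpha>'" using A B by (auto simp: nahm_solutions_iff)
    then show "Ck_unit j h'" if "Ck_unit j h" for j
      unfolding h'_def using that by (intro Ck_unit_scaleR Ck_unit_diff Ck_unit_mmul) (auto simp: smooth_unit_def)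
  qed
  then have "h \<in> based_gauge_group G"
    using hG h01 by (simp add: based_gauge_group_def smooth_unit_def)
  moreover have "config_eq (gauge_act h (\<alpha>, \<beta>)) (\<alpha>', \<beta>')"
    unfolding config_eq_def gauge_act_def
  proof (intro ballI conjI allI; simp only: prod.case fst_conv snd_conv)
    fix t :: real assume t: "t \<in> {0..1}"
    have inv: "matrix_inv (h t) = dag (h t)" by (rule matrix_inv_G[OF hG[OF t]])
    show "h t ** \<alpha> t ** matrix_inv (h t) - (1/2) *\<^sub>R (vector_derivative h (at t within {0..1}) ** matrix_inv (h t)) = \<alpha>' t"
      unfolding vector_derivative_unit[OF h[OF t] t] inv h'_def
      by (simp add: mmul_simps unitary_cancel[OF hG[OF t]])
    show "h t ** \<beta> i t ** matrix_inv (h t) = \<beta>' i t" for i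
      unfolding inv \<beta>[OF t] by (simp add: unitary_cancel[OF hG[OF t]])
  qed
  ultimately show ?thesis by blast
qed

text \<open>Exhibits the relation as the kernel of \<open>endpoint\<close> on the solutions, so it
  is an equivalence relation without any composition of gauge transformations, and injectivity on
  the quotient is immediate.\<close>

lemma gauge_rel_iff:
  "(A, B) \<in> gauge_rel G \<longleftrightarrow> A \<in> nahm_solutions G \<and> B \<in> nahm_solutions G \<and> endpoint A = endpoint B"
proof -
  obtain \<alpha> \<beta> \<alpha>' \<beta>' where AB: "A = (\<alpha>, \<beta>)" "B = (\<alpha>', \<beta>')" by (cases A; cases B)
  have "(\<exists>u\<in>based_gauge_group G. config_eq (gauge_act u A) B) \<longleftrightarrow> endpoint A = endpoint B"
    if "A \<in> nahm_solutions G" "B \<in> nahm_solutions G"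
    unfolding AB by (intro iffI; (elim bexE)?) (rule gauge_endpoint endpoint_gauge; use that AB in simp)+
  then show ?thesis unfolding gauge_rel_def by blast
qed

section \<open>Surjectivity of the endpoint map\<close>

text \<open>Before time 1 the path can be followed forward from t. At t = 1 it is run backwards,
  which changes the sign of the velocity.\<close>

lemma path_log_derivative:
  assumes v: "\<And>t. t \<in> {0..1} \<Longrightarrow> v t \<in> G" "\<And>t. t \<in> {0..1} \<Longrightarrow> (v has_vector_derivative v' t) (at t within {0..1})"
    and t: "t \<in> {0..1}"
  shows "dag (v t) ** v' t \<in> lie"
proof (cases "t < 1")
  case True
  show ?thesis
  proof (rule lie_algebraI_curve[OF G, where a=t and b=1 and c="\<lambda>s. dag (v t) ** v s"])
    have "(v has_vector_derivative v' t) (at t within {t..1})"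
      by (rule has_vector_derivative_within_subset[OF v(2)[OF t]]) (use t in auto)
    then show "((\<lambda>s. dag (v t) ** v s) has_vector_derivative dag (v t) ** v' t) (at t within {t..1})"
      by (rule has_vector_derivative_mmul_const(2))
    show "dag (v t) ** v s \<in> G" if "s \<in> {t..1}" for s using that t by (intro G_mult dag_G v) auto
    show "dag (v t) ** v t = mat 1" by (rule unitary'[OF v(1)[OF t]])
  qed (rule True)
next
  case False
  then have t1: "t = 1" using t by simp
  have "- (dag (v 1) ** v' 1) \<in> lie"
  proof (rule lie_algebraI_curve[OF G, where a=0 and b=1 and c="\<lambda>s. dag (v 1) ** v (1 - s)"])
    have img: "(\<lambda>s. 1 - s) ` {0..1} = {0..1::real}" by (auto simp: image_iff intro!: bexI[of _ "1 - _"])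
    have "(v \<circ> (\<lambda>s. 1 - s) has_vector_derivative (- 1) *\<^sub>R v' 1) (at 0 within {0..1})"
    proof (rule vector_diff_chain_within)
      show "((\<lambda>s. 1 - s) has_vector_derivative - 1) (at 0 within {0..1::real})" by (auto intro!: derivative_eq_intros)
      show "(v has_vector_derivative v' 1) (at (1 - 0) within (\<lambda>s. 1 - s) ` {0..1})" using v(2)[of 1] by (simp add: img)
    qed
    then have "((\<lambda>s. v (1 - s)) has_vector_derivative - v' 1) (at 0 within {0..1})" by (simp add: o_def)
    from has_vector_derivative_mmul_const(2)[OF this, of "dag (v 1)"]
    show "((\<lambda>s. dag (v 1) ** v (1 - s)) has_vector_derivative - (dag (v 1) ** v' 1)) (at 0 within {0..1})"
      by (simp add: mmul.minus_right)
    show "dag (v 1) ** v (1 - s) \<in> G" if "s \<in> {0..1}" for s using that by (intro G_mult dag_G v) auto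
    show "dag (v 1) ** v (1 - 0) = mat 1" using unitary'[OF v(1)[of 1]] by simp
  qed auto
  then have "- (- (dag (v 1) ** v' 1)) \<in> lie" by (rule subspace_neg[OF subspace_lie])
  then show ?thesis by (simp add: t1)
qed

text \<open>The Hermitian solution is transformed by the inverse of v. This is not a based gauge
  transformation: v 1 = k multiplies the endpoint of the frame by k, which is the factor missing
  from m.\<close>

lemma endpoint_surj:
  assumes con: "connected G" and m: "m \<in> polar" and \<tau>: "\<And>i. \<tau> i \<in> clie" "\<And>i j. bracket (\<tau> i) (\<tau> j) = 0"
  shows "\<exists>A\<in>nahm_solutions G. endpoint A = (m, \<tau>)"
proof -
  define T where "T = (\<chi> i. \<tau> i)"
  obtain A z k where z: "shot A T z" and k: "k \<in> G" "fr z 1 ** k = m"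
    using shooting[of T m] \<tau>(1) m by (auto simp: T_def)
  obtain v where v: "smooth_unit v" "\<And>t. t \<in> {0..1} \<Longrightarrow> v t \<in> G" "v 0 = mat 1" "v 1 = k"
    by (rule smooth_path_in_connected_group[OF G con k(1)]) blast
  obtain v' where v': "\<And>t. t \<in> {0..1} \<Longrightarrow> (v has_vector_derivative v' t) (at t within {0..1})" "smooth_unit v'"
    using smooth_unit_derivative[OF v(1)] by metis
  define \<eta> where "\<eta> t = dag (v t) ** v' t" for t
  define X where "X t = dag (v t) ** al z t ** v t" for t
  define \<alpha> where "\<alpha> t = X t + (1/2) *\<^sub>R \<eta> t" for t
  define \<beta> where "\<beta> i t = dag (v t) ** be z i t ** v t" for i t
  have \<eta>: "\<eta> t \<in> lie" if "t \<in> {0..1}" for t unfolding \<eta>_def by (rule path_log_derivative[OF v(2) v'(1) that])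
  have dag_\<eta>: "dag (\<eta> t) = - \<eta> t" if "t \<in> {0..1}" for t by (rule dag_lie[OF \<eta>[OF that]])
  have v'_\<eta>: "v' t = v t ** \<eta> t" if "t \<in> {0..1}" for t
    by (simp add: \<eta>_def matrix_mul_assoc unitary[OF v(2)[OF that]])
  have dag_v': "dag (v' t) = - (\<eta> t ** dag (v t))" if "t \<in> {0..1}" for t
    by (simp add: v'_\<eta>[OF that] dag_mult dag_\<eta>[OF that] mmul.minus_left)
  note cancel = unitary_cancel[OF v(2)] unitary'[OF v(2)]
  have Ad: "dag (v t) ** Y ** v t \<in> clie" if "t \<in> {0..1}" "Y \<in> clie" for Y t
    using clie_Ad[OF dag_G[OF v(2)[OF that(1)]] that(2)] by simp
  have dag_X: "dag (X t) = X t" if "t \<in> {0..1}" for t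
    by (simp add: X_def dag_mult shot_derivatives(4)[OF z that] matrix_mul_assoc)
  have smooth_z: "smooth_unit z"
  proof (rule smooth_unitI)
    show "(z has_vector_derivative nahm_quad (z t) (z t)) (at t within {0..1})" if "t \<in> {0..1}" for t
      using z that by (simp add: shot_def quad_sol_def)
    show "Ck_unit j (\<lambda>t. nahm_quad (z t) (z t))" if "Ck_unit j z" for j
      by (rule Ck_unit_bilinear[OF bounded_bilinear_nahm_quad that that])
  qed
  have smooth_lin: "smooth_unit (\<lambda>t. L (f t))" if "bounded_linear L" "smooth_unit f" for L :: "'b::real_normed_vector \<Rightarrow> 'c::real_normed_vector" and f
    using that Ck_unit_linear unfolding smooth_unit_def by blast
  have smooth_al: "smooth_unit (al z)" unfolding al_def by (rule smooth_lin[OF bounded_linear_fst smooth_z])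
  have smooth_be: "smooth_unit (be z i)" for i
    unfolding be_def by (intro smooth_lin[OF bounded_linear_vec_nth] smooth_lin[OF bounded_linear_fst] smooth_lin[OF bounded_linear_snd] smooth_z)
  have smooth_dv: "smooth_unit (\<lambda>t. dag (v t))" by (rule smooth_lin[OF bounded_linear_dag v(1)])
  have smooth_\<eta>: "smooth_unit \<eta>" unfolding \<eta>_def by (rule smooth_unit_mmul[OF smooth_dv v'(2)])
  have smooth_X: "smooth_unit X" unfolding X_def by (intro smooth_unit_mmul smooth_dv smooth_al v)
  have smooth_\<alpha>: "smooth_unit \<alpha>"
    unfolding \<alpha>_def using smooth_X smooth_\<eta> Ck_unit_add Ck_unit_scaleR unfolding smooth_unit_def by blast
  have smooth_\<beta>: "smooth_unit (\<beta> i)" for i unfolding \<beta>_def by (intro smooth_unit_mmul smooth_dv smooth_be v)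
  \<comment> \<open>Conjugating by v adds a bracket with \<eta> to every derivative; the summand
    \<eta> / 2 in \<alpha> is there to account for it.\<close>
  have conj_der: "((\<lambda>t. dag (v t) ** f t ** v t) has_vector_derivative dag (v t) ** f' ** v t + bracket (dag (v t) ** f t ** v t) (\<eta> t)) (at t within {0..1})"
    if t: "t \<in> {0..1}" and f: "(f has_vector_derivative f') (at t within {0..1})" for f f' t
    using has_vector_derivative_mmul[OF has_vector_derivative_mmul[OF has_vector_derivative_dag[OF v'(1)[OF t]] f] v'(1)[OF t]]
    by (simp add: dag_v'[OF t] bracket_def mmul_simps algebra_simps) (simp add: v'_\<eta>[OF t] matrix_mul_assoc)
  have conj_bracket: "bracket (dag (v t) ** P ** v t) (dag (v t) ** Q ** v t) = dag (v t) ** bracket P Q ** v t" if t: "t \<in> {0..1}" for P Q t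
    by (simp add: bracket_def mmul_simps cancel(1)[OF t])
  have be_comm: "bracket (be z i t) (be z j t) = 0" if t: "t \<in> {0..1}" for i j t
  proof -
    obtain d where d: "\<And>t. t \<in> {0..1} \<Longrightarrow> fr z t ** d t = mat 1" "\<And>t i. t \<in> {0..1} \<Longrightarrow> be z i t = d t ** T $ i ** fr z t"
      by (rule shot_frame[OF z]) blast
    have "be z i t ** be z j t = d t ** T $ i ** (fr z t ** d t) ** T $ j ** fr z t" for i j
      by (simp add: d(2)[OF t] matrix_mul_assoc)
    then have "be z i t ** be z j t = d t ** (\<tau> i ** \<tau> j) ** fr z t" for i j
      by (simp add: d(1)[OF t] T_def matrix_mul_assoc)
    moreover have "\<tau> i ** \<tau> j = \<tau> j ** \<tau> i" using \<tau>(2)[of i j] by (simp add: bracket_def)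
    ultimately show ?thesis by (simp add: bracket_def)
  qed
  have "(\<alpha>, \<beta>) \<in> nahm_solutions G"
    unfolding nahm_solutions_iff real_eq_def
  proof (intro conjI ballI allI smooth_\<alpha> smooth_\<beta>)
    fix t :: real assume t: "t \<in> {0..1}"
    show "\<alpha> t \<in> clie"
      unfolding \<alpha>_def X_def
      by (intro subspace_add[OF subspace_clie] subspace_scale[OF subspace_clie] Ad[OF t] lie_subset_clie \<eta>[OF t] hermD(1)[OF shot_values(1)[OF z t]])
    show "\<beta> i t \<in> clie" for i unfolding \<beta>_def by (rule Ad[OF t shot_values(2)[OF z t]])
    show "bracket (\<beta> i t) (\<beta> j t) = 0" for i j
      unfolding \<beta>_def conj_bracket[OF t] be_comm[OF t] by (simp add: mmul.zero_left mmul.zero_right)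
    show "(\<beta> i has_vector_derivative - (2 *\<^sub>R bracket (\<alpha> t) (\<beta> i t))) (at t within {0..1})" for i
    proof -
      have "dag (v t) ** - (2 *\<^sub>R bracket (al z t) (be z i t)) ** v t + bracket (\<beta> i t) (\<eta> t) = - (2 *\<^sub>R bracket (\<alpha> t) (\<beta> i t))"
      proof -
        have "bracket (X t) (\<beta> i t) = dag (v t) ** bracket (al z t) (be z i t) ** v t"
          unfolding X_def \<beta>_def by (rule conj_bracket[OF t])
        moreover have "bracket (\<alpha> t) (\<beta> i t) = bracket (X t) (\<beta> i t) - (1/2) *\<^sub>R bracket (\<beta> i t) (\<eta> t)"
          by (simp add: \<alpha>_def bracket_def mmul_simps algebra_simps)
        ultimately show ?thesis by (simp add: mmul_simps scaleR_diff_right)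
      qed
      then show ?thesis
        using conj_der[OF t shot_derivatives(2)[OF z t], of i] unfolding \<beta>_def[abs_def] by simp
    qed
    have S: "\<alpha> s + dag (\<alpha> s) = 2 *\<^sub>R X s" if "s \<in> {0..1}" for s
      by (simp add: \<alpha>_def dag_simps dag_X[OF that] dag_\<eta>[OF that] scaleR_2)
    define \<Sigma> where "\<Sigma> = (\<Sum>i\<in>UNIV. bracket (be z i t) (dag (be z i t)))"
    have "(X has_vector_derivative dag (v t) ** - \<Sigma> ** v t + bracket (X t) (\<eta> t)) (at t within {0..1})"
      using conj_der[OF t shot_derivatives(1)[OF z t]] unfolding X_def[abs_def] \<Sigma>_def .
    from bounded_linear.has_vector_derivative[OF bounded_linear_scaleR_right this, of 2]
    have "((\<lambda>t. \<alpha> t + dag (\<alpha> t)) has_vector_derivative 2 *\<^sub>R (dag (v t) ** - \<Sigma> ** v t + bracket (X t) (\<eta> t))) (at t within {0..1})"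
      by (rule has_vector_derivative_transform[OF t, rotated]) (simp add: S)
    moreover have "2 *\<^sub>R (dag (v t) ** - \<Sigma> ** v t + bracket (X t) (\<eta> t))
        = - (2 *\<^sub>R (bracket (\<alpha> t) (dag (\<alpha> t)) + (\<Sum>i\<in>UNIV. bracket (\<beta> i t) (dag (\<beta> i t)))))"
    proof -
      have da: "dag (\<alpha> t) = X t - (1/2) *\<^sub>R \<eta> t" by (simp add: \<alpha>_def dag_simps dag_X[OF t] dag_\<eta>[OF t])
      \<comment> \<open>X is Hermitian and \<eta> skew, so \<alpha> and its adjoint are X + \<eta> /
        2 and X - \<eta> / 2, and their bracket is - [X, \<eta>].\<close>
      have "bracket (\<alpha> t) (dag (\<alpha> t)) = - ((1/2) *\<^sub>R bracket (X t) (\<eta> t) + (1/2) *\<^sub>R bracket (X t) (\<eta> t))"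
        unfolding da unfolding \<alpha>_def by (simp add: bracket_def mmul_simps algebra_simps)
      then have 1: "bracket (\<alpha> t) (dag (\<alpha> t)) = - bracket (X t) (\<eta> t)" by (simp add: scaleR_left_distrib[symmetric])
      have "bracket (\<beta> i t) (dag (\<beta> i t)) = dag (v t) ** bracket (be z i t) (dag (be z i t)) ** v t" for i
      proof -
        have "dag (\<beta> i t) = dag (v t) ** dag (be z i t) ** v t" by (simp add: \<beta>_def dag_mult matrix_mul_assoc)
        then show ?thesis unfolding \<beta>_def by (simp add: conj_bracket[OF t])
      qed
      then have 2: "(\<Sum>i\<in>UNIV. bracket (\<beta> i t) (dag (\<beta> i t))) = dag (v t) ** \<Sigma> ** v t"
        by (simp add: \<Sigma>_def mmul.sum_left mmul.sum_right)
      show ?thesis unfolding 1 2 by (simp add: mmul_simps algebra_simps)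
    qed
    ultimately show "((\<lambda>t. \<alpha> t + dag (\<alpha> t)) has_vector_derivative
        - (2 *\<^sub>R (bracket (\<alpha> t) (dag (\<alpha> t)) + (\<Sum>i\<in>UNIV. bracket (\<beta> i t) (dag (\<beta> i t)))))) (at t within {0..1})"
      by simp
  qed
  moreover have "parallel_frame G \<alpha> (\<lambda>t. fr z t ** v t)"
    unfolding parallel_frame_def complexification_polar
  proof (intro conjI ballI)
    show "fr z 0 ** v 0 = mat 1" by (simp add: v(3) shot_start(3)[OF z])
    fix t :: real assume t: "t \<in> {0..1}"
    have "fr z t \<in> polar" by (rule shot_frame[OF z]) (use t in blast)
    then show "fr z t ** v t \<in> polar"
      using matrix_group_polar G_subset_polar[OF v(2)[OF t]] by (simp add: matrix_group_def)
    have "2 *\<^sub>R (fr z t ** v t ** \<alpha> t) = fr z t ** v' t + 2 *\<^sub>R (fr z t ** al z t) ** v t"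
      by (simp add: \<alpha>_def X_def v'_\<eta>[OF t] mmul_simps unitary_cancel[OF v(2)[OF t]] scaleR_add_right)
    then show "((\<lambda>t. fr z t ** v t) has_vector_derivative 2 *\<^sub>R (fr z t ** v t ** \<alpha> t)) (at t within {0..1})"
      using has_vector_derivative_mmul[OF shot_derivatives(3)[OF z t] v'(1)[OF t]] by simp
  qed
  ultimately have "endpoint (\<alpha>, \<beta>) = (fr z 1 ** v 1, \<lambda>i. (fr z 0 ** v 0) ** \<beta> i 0 ** matrix_inv (fr z 0 ** v 0))"
    using endpoint_eq[of \<alpha> \<beta> "\<lambda>t. fr z t ** v t" 0] by simp
  also have "\<dots> = (m, \<tau>)"
    using matrix_inv_eqI[of "mat 1 :: 'a cmat" "mat 1"]
    by (simp add: k(2) v(3,4) shot_start[OF z] \<beta>_def T_def)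
  finally show ?thesis using \<open>(\<alpha>, \<beta>) \<in> nahm_solutions G\<close> by blast
qed

section \<open>The bijection on the moduli space\<close>

theorem nahm_correspondence:
  assumes con: "connected G"
  shows "(\<forall>(\<alpha>, \<beta>)\<in>nahm_solutions G.
            \<exists>g. parallel_frame G \<alpha> g \<and>
                (\<forall>h. parallel_frame G \<alpha> h \<longrightarrow> (\<forall>t\<in>{0..1}. h t = g t)))" (is ?frames)
    and "\<exists>\<Theta>. (\<forall>(\<alpha>, \<beta>)\<in>nahm_solutions G. \<forall>g. parallel_frame G \<alpha> g \<longrightarrow>
                  (\<forall>t\<in>{0..1}. \<Theta> (gauge_rel G `` {(\<alpha>, \<beta>)}) =
                     (g 1, \<lambda>i. g t ** \<beta> i t ** matrix_inv (g t)))) \<and>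
              bij_betw \<Theta> (nahm_moduli G) (commuting_triples G)" (is ?moduli)
proof -
  show ?frames
  proof (intro ballI, clarify)
    fix \<alpha> \<beta> assume "(\<alpha>, \<beta>) \<in> nahm_solutions G"
    then obtain g d where "\<And>h. parallel_frame G \<alpha> h \<longleftrightarrow> (\<forall>t\<in>{0..1}. h t = g t)" by (rule solution_frame) blast
    then show "\<exists>g. parallel_frame G \<alpha> g \<and> (\<forall>h. parallel_frame G \<alpha> h \<longrightarrow> (\<forall>t\<in>{0..1}. h t = g t))"
      by (intro exI[of _ g]) simp
  qed
  \<comment> \<open>Evaluated at a chosen member of the class; by \<open>gauge_rel_iff\<close> all
    members have the same endpoint.\<close>
  define \<Theta> where "\<Theta> C = endpoint (SOME x. x \<in> C)" for C
  have cls: "\<Theta> (gauge_rel G `` {A}) = endpoint A" if "A \<in> nahm_solutions G" for A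
  proof -
    have "(SOME x. x \<in> gauge_rel G `` {A}) \<in> gauge_rel G `` {A}"
      by (rule someI[of _ A]) (simp add: gauge_rel_iff that)
    then have "(A, SOME x. x \<in> gauge_rel G `` {A}) \<in> gauge_rel G" by simp
    then show ?thesis unfolding \<Theta>_def gauge_rel_iff by simp
  qed
  have "bij_betw \<Theta> (nahm_moduli G) (commuting_triples G)"
    unfolding bij_betw_def
  proof
    show "inj_on \<Theta> (nahm_moduli G)"
    proof (rule inj_onI)
      fix C D assume C: "C \<in> nahm_moduli G" and D: "D \<in> nahm_moduli G" and eq: "\<Theta> C = \<Theta> D"
      obtain A where A: "A \<in> nahm_solutions G" "C = gauge_rel G `` {A}" using C unfolding nahm_moduli_def by (rule quotientE)
      obtain B where B: "B \<in> nahm_solutions G" "D = gauge_rel G `` {B}" using D unfolding nahm_moduli_def by (rule quotientE)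
      have "endpoint A = endpoint B" using eq by (simp add: A B cls)
      then show "C = D" unfolding A(2) B(2) using A(1) B(1) by (auto simp: gauge_rel_iff)
    qed
    show "\<Theta> ` nahm_moduli G = commuting_triples G"
    proof (intro equalityI subsetI)
      fix y assume "y \<in> \<Theta> ` nahm_moduli G"
      then obtain A where A: "A \<in> nahm_solutions G" "y = endpoint A"
        using cls unfolding nahm_moduli_def by (auto elim!: quotientE)
      obtain \<alpha> \<beta> where ab: "A = (\<alpha>, \<beta>)" by (cases A)
      have s: "(\<alpha>, \<beta>) \<in> nahm_solutions G" using A ab by simp
      obtain g d where f: "frame \<alpha> g d" "endpoint (\<alpha>, \<beta>) = (g 1, \<lambda>i. \<beta> i 0)" by (rule solution_frame[OF s]) blast
      have "g 1 \<in> polar" by (rule frameD(6)[OF f(1)]) simp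
      then show "y \<in> commuting_triples G"
        using s by (simp add: A(2) ab f(2) commuting_triples_def complexification_polar nahm_solutions_iff)
    next
      fix y assume y: "y \<in> commuting_triples G"
      obtain m \<tau> where mt: "y = (m, \<tau>)" by (cases y)
      then have "m \<in> polar" "\<And>i. \<tau> i \<in> clie" "\<And>i j. bracket (\<tau> i) (\<tau> j) = 0"
        using y by (auto simp: commuting_triples_def complexification_polar)
      from endpoint_surj[OF con this] obtain A where A: "A \<in> nahm_solutions G" "endpoint A = (m, \<tau>)" by (rule bexE)
      then have "gauge_rel G `` {A} \<in> nahm_moduli G" unfolding nahm_moduli_def by (intro quotientI)
      then show "y \<in> \<Theta> ` nahm_moduli G" by (rule image_eqI[rotated]) (simp add: cls A mt)
    qed
  qed
  moreover have "\<forall>(\<alpha>, \<beta>)\<in>nahm_solutions G. \<forall>g. parallel_frame G \<alpha> g \<longrightarrow>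
      (\<forall>t\<in>{0..1}. \<Theta> (gauge_rel G `` {(\<alpha>, \<beta>)}) = (g 1, \<lambda>i. g t ** \<beta> i t ** matrix_inv (g t)))"
    by (clarify, subst cls, assumption, rule endpoint_eq)
  ultimately show ?moduli by blast
qed

end

theorem theorem1p2:
  fixes G :: "('n::finite) cmat set"
  assumes "compact_lie_group G" and "connected G"
  shows "(\<forall>(\<alpha>, \<beta>)\<in>nahm_solutions G.
            \<exists>g. parallel_frame G \<alpha> g \<and>
                (\<forall>h. parallel_frame G \<alpha> h \<longrightarrow> (\<forall>t\<in>{0..1}. h t = g t))) \<and>
         (\<exists>\<Theta>. (\<forall>(\<alpha>, \<beta>)\<in>nahm_solutions G. \<forall>g. parallel_frame G \<alpha> g \<longrightarrow>
                  (\<forall>t\<in>{0..1}. \<Theta> (gauge_rel G `` {(\<alpha>, \<beta>)}) =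
                     (g 1, \<lambda>i. g t ** \<beta> i t ** matrix_inv (g t)))) \<and>
              bij_betw \<Theta> (nahm_moduli G) (commuting_triples G))"
proof -
  obtain dag where dag: "adjoint_form dag" "\<And>g. g \<in> G \<Longrightarrow> g ** dag g = mat 1"
    using adjoint_form_exists[OF assms(1)] by blast
  interpret unitary_group dag G
    by (intro unitary_group.intro unitary_group_axioms.intro dag assms)
  show ?thesis using nahm_correspondence[OF assms(2)] by (intro conjI)
qed

end
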